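(* Let $a$ be a symmetric, sub-gaussian random variable with $\mathbb{E}a^2=1$ and sub-gaussian norm $\kappa$, and suppose $\|a-g\|_{TV}\le\varepsilon$ where $g\sim N(0,1)$. Let $\mathbf{a}_1,\dots,\mathbf{a}_m$ be independent random vectors in $\mathbb{R}^n$ whose coordinates are i.i.d. copies of $a$. Let $K\subseteq B_2^n$ and fix $\mathbf{x}\in K$ with $\|\mathbf{x}\|_2=1$. Let $p\in[0,1/2)$, let $\varepsilon_1,\dots,\varepsilon_m$ be i.i.d., independent of the $\mathbf{a}_i$, with $P(\varepsilon_i=1)=1-p$, $P(\varepsilon_i=-1)=p$, and let $y_i=\varepsilon_i\,\mathrm{sign}(\langle\mathbf{a}_i,\mathbf{x}\rangle)$. Then for each $\beta>0$, with probability at least $1-4e^{-\beta^2}$, the solution $\widehat{\mathbf{x}}$ of $\max\sum_{i=1}^m y_i\langle\mathbf{a}_i,\mathbf{x}'\rangle$ subject to $\mathbf{x}'\in K$ satisfies $$\|\mathbf{x}-\widehat{\mathbf{x}}\|_2^2\le C\sqrt{\kappa}\,\varepsilon^{1/8}+\frac{C\kappa}{(1-2p)\sqrt m}\big(w(K)+\beta\big),$$ where $C>0$ is an absolute constant.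
   Context: $\|a-g\|_{TV}=\sup_A|P(a\in A)-P(g\in A)|$ over Borel sets $A$. $\mathrm{sign}(t)=1$ if $t\ge0$ and $-1$ otherwise. The sub-gaussian norm is $\kappa=\sup_{q\ge1}q^{-1/2}(\mathbb{E}|a|^q)^{1/q}<\infty$. $w(K)=\mathbb{E}\sup_{\mathbf{u}\in K-K}\langle\mathbf{g},\mathbf{u}\rangle$ with $\mathbf{g}$ standard Gaussian in $\mathbb{R}^n$; $B_2^n$ is the Euclidean unit ball. *)

theory Defs
  imports "HOL-Probability.Probability"
begin

definition sgnp :: "real \<Rightarrow> real" where
  "sgnp t = (if t \<ge> 0 then 1 else -1)"

definition gauss1 :: "real measure" where
  "gauss1 = density lborel std_normal_density"

definition tv_dist :: "real measure \<Rightarrow> real measure \<Rightarrow> real" where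
  "tv_dist P Q = (SUP A \<in> sets borel. \<bar>measure P A - measure Q A\<bar>)"

definition subg_norm :: "real measure \<Rightarrow> real" where
  "subg_norm P = (SUP q \<in> {1..}. q powr (-1/2) * (\<integral>t. \<bar>t\<bar> powr q \<partial>P) powr (1/q))"

definition subgaussian :: "real measure \<Rightarrow> bool" where
  "subgaussian P \<longleftrightarrow> (\<forall>q\<ge>1. integrable P (\<lambda>t. \<bar>t\<bar> powr q)) \<and>
     bdd_above ((\<lambda>q. q powr (-1/2) * (\<integral>t. \<bar>t\<bar> powr q \<partial>P) powr (1/q)) ` {1..})"

text \<open>Vectors of R^n are functions nat => real, only coordinates 0..n-1 are used.\<close>
definition ip :: "nat \<Rightarrow> (nat \<Rightarrow> real) \<Rightarrow> (nat \<Rightarrow> real) \<Rightarrow> real" where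
  "ip n u v = (\<Sum>j<n. u j * v j)"

definition nrm :: "nat \<Rightarrow> (nat \<Rightarrow> real) \<Rightarrow> real" where
  "nrm n u = sqrt (\<Sum>j<n. (u j)\<^sup>2)"

definition vecs :: "nat \<Rightarrow> (nat \<Rightarrow> real) set" where
  "vecs n = {v. \<forall>j\<ge>n. v j = 0}"

definition ball2 :: "nat \<Rightarrow> (nat \<Rightarrow> real) set" where
  "ball2 n = {v \<in> vecs n. nrm n v \<le> 1}"

definition gwidth :: "nat \<Rightarrow> (nat \<Rightarrow> real) set \<Rightarrow> real" where
  "gwidth n K = (\<integral>g. (SUP u \<in> {k1 - k2 | k1 k2. k1 \<in> K \<and> k2 \<in> K}. ip n g u)
                   \<partial>(PiM {..<n} (\<lambda>_. gauss1)))"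

text \<open>Canonical probability space: coordinates (a_i)_j, i<m, j<n, i.i.d. with law D,
  independent of the i.i.d. noise signs eps_i (True means +1, probability 1-p).\<close>
definition sample_space :: "nat \<Rightarrow> nat \<Rightarrow> real measure \<Rightarrow> real \<Rightarrow>
    ((nat \<times> nat \<Rightarrow> real) \<times> (nat \<Rightarrow> bool)) measure" where
  "sample_space m n D p =
     PiM ({..<m} \<times> {..<n}) (\<lambda>_. D) \<Otimes>\<^sub>M PiM {..<m} (\<lambda>_. measure_pmf (bernoulli_pmf (1 - p)))"

definition avec :: "nat \<Rightarrow> (nat \<times> nat \<Rightarrow> real) \<times> (nat \<Rightarrow> bool) \<Rightarrow> nat \<Rightarrow> real" where
  "avec i \<omega> = (\<lambda>j. fst \<omega> (i, j))"

definition yobs :: "nat \<Rightarrow> (nat \<Rightarrow> real) \<Rightarrow> nat \<Rightarrow> (nat \<times> nat \<Rightarrow> real) \<times> (nat \<Rightarrow> bool) \<Rightarrow> real" where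
  "yobs n x i \<omega> = (if snd \<omega> i then 1 else -1) * sgnp (ip n (avec i \<omega>) x)"

definition is_solution :: "nat \<Rightarrow> nat \<Rightarrow> (nat \<Rightarrow> real) set \<Rightarrow> (nat \<Rightarrow> real) \<Rightarrow>
    (nat \<times> nat \<Rightarrow> real) \<times> (nat \<Rightarrow> bool) \<Rightarrow> (nat \<Rightarrow> real) \<Rightarrow> bool" where
  "is_solution m n K x \<omega> xh \<longleftrightarrow> xh \<in> K \<and>
     (\<forall>x'\<in>K. (\<Sum>i<m. yobs n x i \<omega> * ip n (avec i \<omega>) x') \<le>
              (\<Sum>i<m. yobs n x i \<omega> * ip n (avec i \<omega>) xh))"

end

theory Submission
  imports Defs
begin

text \<open>
  Optimality of the solution reduces the claim to two facts. Let $v$ be the mean of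
  $\mathrm{sign}(\langle a, x\rangle) a$.

  Bias: $v$ is close to $\lambda x$ with $\lambda = \sqrt{2/\pi}$. Both $|v|$ and $\langle v, x\rangle$ are
  controlled by $E|\langle a, u\rangle|$ for unit vectors $u$, and a Lindeberg exchange of coordinates applied to
  $\sqrt{h^2 + s^2}$ shows that this differs from its Gaussian value $\lambda$ by at most
  $\delta = 4 \kappa \varepsilon^{1/4}$; hence $|v - \lambda x| = O(\sqrt\delta)$.

  Deviation: no chaining is needed. A symmetric sub-gaussian variable is dominated in the convex order by a multiple
  of a standard Gaussian, and convex order tensorises. So, after symmetrisation, the exponential moments of the
  supremum of the centred process are bounded by those of $\sup_{u \in K - K} \langle g, u\rangle$ for a Gaussian
  vector $g$. The latter follow from two rotations by $\pi/4$, leading from $X$ over $(X+Y)/\sqrt 2$ to an independent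
  copy $Y$; each step is controlled by a linear functional of the fresh Gaussian vector.
\<close>

section \<open>Integrals over product measures\<close>

text \<open>The exponent 1/8 is the outcome of three square roots. Total variation controls bounded
  functions only, so a quadratically growing function is truncated against its fourth moment, which
  turns \<open>\<epsilon>\<close> into its square root. Balancing the smoothing parameter
  \<open>h\<close> against the exchange error, of order
  \<open>\<kappa>\<^sup>2 * sqrt \<epsilon> / h\<close>, costs the second root and gives
  \<open>\<delta>\<close>. The third comes from geometry: the mean vector is known only through an
  upper bound for its norm and a lower bound for its inner product with \<open>x\<close>, and these
  control the square of its distance to the multiple of \<open>x\<close>. The absolute value is
  smoothed because then exchanging coordinate \<open>i\<close> costs a multiple of
  \<open>(u i)\<^sup>2\<close>; for a unit vector these costs sum to something independent of the
  dimension. Two quarter-of-pi rotations replace a single right-angle one because a step must keep a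
  positive multiple of the old vector. The price is a factor 1/2 in the exponent, which affects only
  constants. Exponential moments are nonnegative integrals throughout, so none has to be known
  finite beforehand. One replacement principle for products serves both the exchange (with errors)
  and the convex order (without).\<close>

lemma nn_integral_PiM_le:
  fixes M :: "'a measure" and N :: "'b measure" and K :: "'c measure"
    and f :: "('i \<Rightarrow> 'c) \<Rightarrow> ennreal"
  assumes "finite I" and M: "prob_space M" and N: "prob_space N"
    and X[measurable]: "X \<in> measurable M K" and Y[measurable]: "Y \<in> measurable N K"
    and "f \<in> borel_measurable (PiM I (\<lambda>_. K))"
    and "\<And>i x. i \<in> I \<Longrightarrow> x \<in> space (PiM (I - {i}) (\<lambda>_. K)) \<Longrightarrow>
      (\<integral>\<^sup>+t. f (x(i := X t)) \<partial>M) \<le> (\<integral>\<^sup>+t. f (x(i := Y t)) \<partial>N) + e i"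
  shows "(\<integral>\<^sup>+\<omega>. f (\<lambda>i\<in>I. X (\<omega> i)) \<partial>PiM I (\<lambda>_. M))
    \<le> (\<integral>\<^sup>+\<omega>. f (\<lambda>i\<in>I. Y (\<omega> i)) \<partial>PiM I (\<lambda>_. N)) + (\<Sum>i\<in>I. e i)"
  using assms(1,6,7)
\<comment> \<open>The maps \<open>X\<close> and \<open>Y\<close> carry both laws to a common space
  \<open>K\<close>, so a mixed vector with some coordinates from each law is an argument of
  \<open>f\<close>. The one-coordinate hypothesis is required for every frozen remainder, which lets
  it survive the replacement of other coordinates.\<close>
proof (induction I arbitrary: f rule: finite_induct)
  case empty
  then show ?case by (simp add: PiM_empty nn_integral_count_space_finite)
next
  case (insert i I)
  interpret M: prob_space M by fact
  interpret N: prob_space N by fact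
  interpret PM: product_prob_space "\<lambda>_. M" by (rule product_prob_spaceI) fact
  interpret PN: product_prob_space "\<lambda>_. N" by (rule product_prob_spaceI) fact
  interpret PMI: prob_space "PiM I (\<lambda>_. M)" by (intro prob_space_PiM assms)
  interpret PNI: prob_space "PiM I (\<lambda>_. N)" by (intro prob_space_PiM assms)
  interpret P: pair_sigma_finite N "PiM I (\<lambda>_. M)" ..
  note [measurable] = insert.prems(1)
  have eqX: "(\<lambda>k\<in>insert i I. X ((w(i := t)) k)) = (\<lambda>k\<in>I. X (w k))(i := X t)" for w t
    using insert.hyps by (auto simp: fun_eq_iff)
  have eqY: "(\<lambda>k\<in>insert i I. Y ((w(i := t)) k)) = (\<lambda>k\<in>I. Y (w k))(i := Y t)" for w t
    using insert.hyps by (auto simp: fun_eq_iff)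
  have spX: "(\<lambda>k\<in>I. X (\<omega> k)) \<in> space (PiM I (\<lambda>_. K))" if "\<omega> \<in> space (PiM I (\<lambda>_. M))" for \<omega>
    using that measurable_space[OF X] by (auto simp: space_PiM)
  have "(\<integral>\<^sup>+\<omega>. f (\<lambda>k\<in>insert i I. X (\<omega> k)) \<partial>PiM (insert i I) (\<lambda>_. M))
     = (\<integral>\<^sup>+\<omega>. \<integral>\<^sup>+t. f ((\<lambda>k\<in>I. X (\<omega> k))(i := X t)) \<partial>M \<partial>PiM I (\<lambda>_. M))"
    by (subst PM.product_nn_integral_insert) (use insert.hyps in \<open>simp_all only: eqX, simp_all\<close>)
  also have "\<dots> \<le> (\<integral>\<^sup>+\<omega>. (\<integral>\<^sup>+t. f ((\<lambda>k\<in>I. X (\<omega> k))(i := Y t)) \<partial>N) + e i \<partial>PiM I (\<lambda>_. M))"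
  proof (intro nn_integral_mono insert.prems(2))
    show "(\<lambda>k\<in>I. X (w k)) \<in> space (PiM (insert i I - {i}) (\<lambda>_. K))" if "w \<in> space (PiM I (\<lambda>_. M))" for w
      using spX[OF that] insert.hyps by (metis Diff_insert_absorb)
  qed simp
  also have "\<dots> = (\<integral>\<^sup>+\<omega>. (\<integral>\<^sup>+t. f ((\<lambda>k\<in>I. X (\<omega> k))(i := Y t)) \<partial>N) \<partial>PiM I (\<lambda>_. M)) + e i"
    by (subst nn_integral_add) (auto simp: PMI.emeasure_space_1)
  also have "(\<integral>\<^sup>+\<omega>. (\<integral>\<^sup>+t. f ((\<lambda>k\<in>I. X (\<omega> k))(i := Y t)) \<partial>N) \<partial>PiM I (\<lambda>_. M))
      = (\<integral>\<^sup>+t. (\<integral>\<^sup>+\<omega>. f ((\<lambda>k\<in>I. X (\<omega> k))(i := Y t)) \<partial>PiM I (\<lambda>_. M)) \<partial>N)"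
    by (rule P.Fubini') simp
  also have "\<dots> + e i \<le> (\<integral>\<^sup>+t. (\<integral>\<^sup>+\<omega>. f ((\<lambda>k\<in>I. Y (\<omega> k))(i := Y t)) \<partial>PiM I (\<lambda>_. N)) + (\<Sum>k\<in>I. e k) \<partial>N) + e i"
  proof (intro add_right_mono nn_integral_mono)
    fix t assume t: "t \<in> space N"
    then have Yt[measurable]: "Y t \<in> space K" by (rule measurable_space[OF Y])
    show "(\<integral>\<^sup>+\<omega>. f ((\<lambda>k\<in>I. X (\<omega> k))(i := Y t)) \<partial>PiM I (\<lambda>_. M)) \<le>
      (\<integral>\<^sup>+\<omega>. f ((\<lambda>k\<in>I. Y (\<omega> k))(i := Y t)) \<partial>PiM I (\<lambda>_. N)) + (\<Sum>k\<in>I. e k)"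
    proof (rule insert.IH)
      show "(\<lambda>x. f (x(i := Y t))) \<in> borel_measurable (Pi\<^sub>M I (\<lambda>_. K))" by measurable
      fix k x assume k: "k \<in> I" and x: "x \<in> space (Pi\<^sub>M (I - {k}) (\<lambda>_. K))"
      have ki: "k \<noteq> i" using k insert.hyps by auto
      have xi: "x(i := Y t) \<in> space (Pi\<^sub>M (insert i I - {k}) (\<lambda>_. K))"
        using x Yt ki by (auto simp: space_PiM PiE_def Pi_def extensional_def)
      show "(\<integral>\<^sup>+ s. f ((x(k := X s))(i := Y t)) \<partial>M) \<le> (\<integral>\<^sup>+ s. f ((x(k := Y s))(i := Y t)) \<partial>N) + e k"
        using insert.prems(2)[OF insertI2[OF k] xi] by (simp only: fun_upd_twist[OF ki])
    qed
  qed
  also have "(\<integral>\<^sup>+t. (\<integral>\<^sup>+\<omega>. f ((\<lambda>k\<in>I. Y (\<omega> k))(i := Y t)) \<partial>PiM I (\<lambda>_. N)) + (\<Sum>k\<in>I. e k) \<partial>N)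
     = (\<integral>\<^sup>+t. (\<integral>\<^sup>+\<omega>. f ((\<lambda>k\<in>I. Y (\<omega> k))(i := Y t)) \<partial>PiM I (\<lambda>_. N)) \<partial>N) + (\<Sum>k\<in>I. e k)"
    by (subst nn_integral_add) (auto simp: N.emeasure_space_1)
  also have "(\<integral>\<^sup>+t. (\<integral>\<^sup>+\<omega>. f ((\<lambda>k\<in>I. Y (\<omega> k))(i := Y t)) \<partial>PiM I (\<lambda>_. N)) \<partial>N)
     = (\<integral>\<^sup>+\<omega>. f (\<lambda>k\<in>insert i I. Y (\<omega> k)) \<partial>PiM (insert i I) (\<lambda>_. N))"
    by (subst PN.product_nn_integral_insert_rev) (use insert.hyps in \<open>simp_all only: eqY, simp_all\<close>)
  finally show ?case unfolding sum.insert[OF insert.hyps] by (simp only: add_ac)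
qed

corollary nn_integral_PiM_eq:
  fixes f :: "('i \<Rightarrow> 'c) \<Rightarrow> ennreal"
  assumes "finite I" "prob_space M" "prob_space N" "X \<in> measurable M K" "Y \<in> measurable N K"
    and "f \<in> borel_measurable (PiM I (\<lambda>_. K))"
    and "\<And>i x. i \<in> I \<Longrightarrow> x \<in> space (PiM (I - {i}) (\<lambda>_. K)) \<Longrightarrow>
      (\<integral>\<^sup>+t. f (x(i := X t)) \<partial>M) = (\<integral>\<^sup>+t. f (x(i := Y t)) \<partial>N)"
  shows "(\<integral>\<^sup>+\<omega>. f (\<lambda>i\<in>I. X (\<omega> i)) \<partial>PiM I (\<lambda>_. M)) = (\<integral>\<^sup>+\<omega>. f (\<lambda>i\<in>I. Y (\<omega> i)) \<partial>PiM I (\<lambda>_. N))"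
  using nn_integral_PiM_le[of I M N X K Y f "\<lambda>_. 0"] nn_integral_PiM_le[of I N M Y K X f "\<lambda>_. 0"] assms
  by (intro antisym) auto

text \<open>Regroups i.i.d. pairs as a pair of i.i.d. families. It lets a statement about two
  vectors be proved coordinate by coordinate, as for rotations, and lets each row be bundled with
  its label.\<close>

lemma nn_integral_PiM_pair:
  fixes M :: "'a measure" and N :: "'b measure" and f :: "('i \<Rightarrow> 'a) \<times> ('i \<Rightarrow> 'b) \<Rightarrow> ennreal"
  assumes "finite I" and M: "prob_space M" and N: "prob_space N"
    and "f \<in> borel_measurable (PiM I (\<lambda>_. M) \<Otimes>\<^sub>M PiM I (\<lambda>_. N))"
  shows "(\<integral>\<^sup>+z. f ((\<lambda>i\<in>I. fst (z i)), (\<lambda>i\<in>I. snd (z i))) \<partial>PiM I (\<lambda>_. M \<Otimes>\<^sub>M N))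
    = (\<integral>\<^sup>+x. \<integral>\<^sup>+y. f (x, y) \<partial>PiM I (\<lambda>_. N) \<partial>PiM I (\<lambda>_. M))"
  using assms(1,4)
proof (induction I arbitrary: f rule: finite_induct)
  case empty
  then show ?case by (simp add: PiM_empty nn_integral_count_space_finite)
next
  case (insert i I)
  interpret M: prob_space M by fact
  interpret N: prob_space N by fact
  interpret MN: pair_prob_space M N ..
  interpret PM: product_prob_space "\<lambda>_. M" by (rule product_prob_spaceI) fact
  interpret PN: product_prob_space "\<lambda>_. N" by (rule product_prob_spaceI) fact
  interpret PMN: product_prob_space "\<lambda>_. M \<Otimes>\<^sub>M N" by (rule product_prob_spaceI) unfold_locales
  interpret PMI: prob_space "PiM I (\<lambda>_. M)" by (intro prob_space_PiM assms)
  interpret PNI: prob_space "PiM I (\<lambda>_. N)" by (intro prob_space_PiM assms)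
  interpret PMNI: prob_space "PiM I (\<lambda>_. M \<Otimes>\<^sub>M N)" by (rule prob_space_PiM) unfold_locales
  interpret Q: pair_sigma_finite "PiM I (\<lambda>_. M)" N ..
  interpret P: pair_sigma_finite "PiM I (\<lambda>_. M)" M ..
  note [measurable] = insert.prems(1)
  have eq: "f ((\<lambda>k\<in>insert i I. fst ((z(i := s)) k)), (\<lambda>k\<in>insert i I. snd ((z(i := s)) k)))
     = f ((\<lambda>k\<in>I. fst (z k))(i := fst s), (\<lambda>k\<in>I. snd (z k))(i := snd s))" for z s
    using insert.hyps by (intro arg_cong[where f=f]) (auto simp: fun_eq_iff)
  have "(\<integral>\<^sup>+z. f ((\<lambda>k\<in>insert i I. fst (z k)), (\<lambda>k\<in>insert i I. snd (z k))) \<partial>PiM (insert i I) (\<lambda>_. M \<Otimes>\<^sub>M N))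
    = (\<integral>\<^sup>+s. \<integral>\<^sup>+z. f ((\<lambda>k\<in>I. fst (z k))(i := fst s), (\<lambda>k\<in>I. snd (z k))(i := snd s)) \<partial>PiM I (\<lambda>_. M \<Otimes>\<^sub>M N) \<partial>(M \<Otimes>\<^sub>M N))"
    using insert.hyps by (subst PMN.product_nn_integral_insert_rev) (simp_all only: eq, simp_all)
  also have "\<dots> = (\<integral>\<^sup>+s. \<integral>\<^sup>+x. \<integral>\<^sup>+y. f (x(i := fst s), y(i := snd s)) \<partial>PiM I (\<lambda>_. N) \<partial>PiM I (\<lambda>_. M) \<partial>(M \<Otimes>\<^sub>M N))"
  proof (rule nn_integral_cong)
    fix s assume "s \<in> space (M \<Otimes>\<^sub>M N)"
    then have [measurable]: "fst s \<in> space M" "snd s \<in> space N" by (auto simp: space_pair_measure)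
    have "(\<lambda>(x, y). f (x(i := fst s), y(i := snd s))) \<in> borel_measurable (PiM I (\<lambda>_. M) \<Otimes>\<^sub>M PiM I (\<lambda>_. N))"
      by measurable
    from insert.IH[OF this, unfolded prod.case]
    show "(\<integral>\<^sup>+z. f ((\<lambda>k\<in>I. fst (z k))(i := fst s), (\<lambda>k\<in>I. snd (z k))(i := snd s)) \<partial>PiM I (\<lambda>_. M \<Otimes>\<^sub>M N))
      = (\<integral>\<^sup>+x. \<integral>\<^sup>+y. f (x(i := fst s), y(i := snd s)) \<partial>PiM I (\<lambda>_. N) \<partial>PiM I (\<lambda>_. M))" .
  qed
  also have "\<dots> = (\<integral>\<^sup>+a. \<integral>\<^sup>+b. \<integral>\<^sup>+x. \<integral>\<^sup>+y. f (x(i := a), y(i := b)) \<partial>PiM I (\<lambda>_. N) \<partial>PiM I (\<lambda>_. M) \<partial>N \<partial>M)"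
    by (subst N.nn_integral_fst[symmetric]) simp_all
  also have "\<dots> = (\<integral>\<^sup>+a. \<integral>\<^sup>+x. \<integral>\<^sup>+b. \<integral>\<^sup>+y. f (x(i := a), y(i := b)) \<partial>PiM I (\<lambda>_. N) \<partial>N \<partial>PiM I (\<lambda>_. M) \<partial>M)"
    by (intro nn_integral_cong Q.Fubini') simp
  also have "\<dots> = (\<integral>\<^sup>+a. \<integral>\<^sup>+x. \<integral>\<^sup>+y. f (x(i := a), y) \<partial>PiM (insert i I) (\<lambda>_. N) \<partial>PiM I (\<lambda>_. M) \<partial>M)"
    using insert.hyps by (intro nn_integral_cong, subst PN.product_nn_integral_insert_rev) simp_all
  also have "\<dots> = (\<integral>\<^sup>+x. \<integral>\<^sup>+y. f (x, y) \<partial>PiM (insert i I) (\<lambda>_. N) \<partial>PiM (insert i I) (\<lambda>_. M))"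
  proof (rule PM.product_nn_integral_insert_rev[symmetric])
    interpret PNI': prob_space "PiM (insert i I) (\<lambda>_. N)" by (intro prob_space_PiM assms)
    show "(\<lambda>x. \<integral>\<^sup>+ y. f (x, y) \<partial>PiM (insert i I) (\<lambda>_. N)) \<in> borel_measurable (PiM (insert i I) (\<lambda>_. M))"
      by measurable
  qed (use insert.hyps in auto)
  finally show ?case .
qed

lemma measurable_uncurry_PiM:
  "(\<lambda>z. \<lambda>(i, j)\<in>I \<times> J. z i j) \<in> measurable (PiM I (\<lambda>_. PiM J (\<lambda>_. D))) (PiM (I \<times> J) (\<lambda>_. D))"
proof (rule measurable_restrict)
  fix k assume "k \<in> I \<times> J"
  then have a: "(\<lambda>z. z (fst k)) \<in> measurable (PiM I (\<lambda>_. PiM J (\<lambda>_. D))) (PiM J (\<lambda>_. D))"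
    and b: "(\<lambda>w. w (snd k)) \<in> measurable (PiM J (\<lambda>_. D)) D" by auto
  show "(\<lambda>z. case k of (i, j) \<Rightarrow> z i j) \<in> measurable (PiM I (\<lambda>_. PiM J (\<lambda>_. D))) D"
    using measurable_compose[OF a b] by (simp add: case_prod_unfold)
qed

text \<open>The sample space is indexed by pairs of row and column, while the argument replaces
  whole rows. Both product measures agree on boxes, and this determines them.\<close>

lemma distr_PiM_PiM:
  fixes D :: "'a measure" and I :: "'i set" and J :: "'j set"
  assumes "finite I" "finite J" and D: "prob_space D"
  shows "distr (PiM I (\<lambda>_. PiM J (\<lambda>_. D))) (PiM (I \<times> J) (\<lambda>_. D)) (\<lambda>z. \<lambda>(i,j)\<in>I \<times> J. z i j) = PiM (I \<times> J) (\<lambda>_. D)"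
    (is "distr ?P ?Q ?f = _")
proof -
  interpret PD: product_prob_space "\<lambda>_ :: 'i \<times> 'j. D" "I \<times> J" by (rule product_prob_spaceI) fact
  interpret PD': product_prob_space "\<lambda>_ :: 'j. D" J by (rule product_prob_spaceI) fact
  have PJ: "prob_space (PiM J (\<lambda>_. D))" by (intro prob_space_PiM assms)
  interpret PP: product_prob_space "\<lambda>_ :: 'i. PiM J (\<lambda>_. D)" I by (rule product_prob_spaceI) fact
  note f[measurable] = measurable_uncurry_PiM[of I J D]
  show ?thesis
  proof (rule product_sigma_finite.PiM_eqI[OF PD.product_sigma_finite_axioms])
    fix A :: "'i \<times> 'j \<Rightarrow> 'a set" assume A: "\<And>i. i \<in> I \<times> J \<Longrightarrow> A i \<in> sets D"
    have "?f -` (Pi\<^sub>E (I \<times> J) A) \<inter> space ?P = Pi\<^sub>E I (\<lambda>i. Pi\<^sub>E J (\<lambda>j. A (i, j)))"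
      using A[THEN sets.sets_into_space]
      by (auto simp: space_PiM PiE_def Pi_def extensional_def split: prod.splits if_splits; blast)
    then have "emeasure (distr ?P ?Q ?f) (Pi\<^sub>E (I \<times> J) A) = emeasure ?P (Pi\<^sub>E I (\<lambda>i. Pi\<^sub>E J (\<lambda>j. A (i, j))))"
      using A assms by (subst emeasure_distr) (auto intro!: sets_PiM_I_finite)
    also have "\<dots> = (\<Prod>i\<in>I. \<Prod>j\<in>J. emeasure D (A (i, j)))"
      using A assms by (subst PP.emeasure_PiM)  (auto intro!: prod.cong PD'.emeasure_PiM sets_PiM_I_finite)
    finally show "emeasure (distr ?P ?Q ?f) (Pi\<^sub>E (I \<times> J) A) = (\<Prod>i\<in>I \<times> J. emeasure D (A i))"
      by (simp add: prod.cartesian_product)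
  qed (use assms in auto)
qed

section \<open>Gaussian measures\<close>

lemma prob_space_gauss1: "prob_space gauss1"
  unfolding gauss1_def by (rule prob_space_normal_density) simp

lemma sets_gauss1[simp, measurable_cong]: "sets gauss1 = sets borel"
  by (simp add: gauss1_def)

lemma space_gauss1[simp]: "space gauss1 = UNIV"
  by (simp add: gauss1_def)

interpretation gauss1: prob_space gauss1 by (rule prob_space_gauss1)

interpretation gauss1_PiM: prob_space "PiM I (\<lambda>_. gauss1)" for I :: "'i set"
  by (intro prob_space_PiM prob_space_gauss1)

lemma emeasure_gauss1_UNIV[simp]: "emeasure gauss1 UNIV = 1"
  using gauss1.emeasure_space_1 by simp

lemma nn_integral_gauss1:
  "f \<in> borel_measurable borel \<Longrightarrow>
    (\<integral>\<^sup>+x. f x \<partial>gauss1) = (\<integral>\<^sup>+x. ennreal (std_normal_density x) * f x \<partial>lborel)"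
  unfolding gauss1_def by (subst nn_integral_density) auto

lemma nn_integral_gauss1_uminus:
  assumes [measurable]: "f \<in> borel_measurable borel"
  shows "(\<integral>\<^sup>+x. f (- x) \<partial>gauss1) = (\<integral>\<^sup>+x. f x \<partial>gauss1)"
  using nn_integral_real_affine[of "\<lambda>x. ennreal (std_normal_density x) * f x" "-1" 0]
  by (simp add: nn_integral_gauss1 normal_density_def)

text \<open>The product density depends on the Euclidean norm only. The planar change of variables
  is carried out as two affine substitutions on the line, first in \<open>x\<close> for fixed
  \<open>y\<close>, then in \<open>y\<close> for fixed \<open>u\<close>; their Jacobians
  \<open>1/c\<close> and \<open>c\<close> cancel. Dividing by \<open>c\<close> is the reason for
  \<open>c > 0\<close>.\<close>

lemma nn_integral_gauss1_rotation:
  fixes c s :: real and f :: "real \<times> real \<Rightarrow> ennreal"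
  assumes c: "c > 0" and cs: "c\<^sup>2 + s\<^sup>2 = 1"
    and [measurable]: "f \<in> borel_measurable (borel \<Otimes>\<^sub>M borel)"
  shows "(\<integral>\<^sup>+x. \<integral>\<^sup>+y. f (c * x + s * y, c * y - s * x) \<partial>gauss1 \<partial>gauss1) = (\<integral>\<^sup>+x. \<integral>\<^sup>+y. f (x, y) \<partial>gauss1 \<partial>gauss1)"
proof -
  define \<rho> :: "real \<Rightarrow> ennreal" where "\<rho> x = ennreal (std_normal_density x)" for x
  have [measurable]: "\<rho> \<in> borel_measurable borel" unfolding \<rho>_def by measurable
  define G where "G x y = \<rho> x * \<rho> y * f (c * x + s * y, c * y - s * x)" for x y
  have [measurable]: "case_prod G \<in> borel_measurable (borel \<Otimes>\<^sub>M borel)" unfolding G_def by measurable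
  have gen: "(\<integral>\<^sup>+x. \<integral>\<^sup>+y. g x y \<partial>gauss1 \<partial>gauss1) = (\<integral>\<^sup>+x. \<integral>\<^sup>+y. \<rho> x * \<rho> y * g x y \<partial>lborel \<partial>lborel)"
    if [measurable]: "case_prod g \<in> borel_measurable (borel \<Otimes>\<^sub>M borel)" for g :: "real \<Rightarrow> real \<Rightarrow> ennreal"
    by (simp add: nn_integral_gauss1 \<rho>_def[symmetric] nn_integral_cmult[symmetric] mult.assoc)
  have "(\<integral>\<^sup>+x. \<integral>\<^sup>+y. f (c * x + s * y, c * y - s * x) \<partial>gauss1 \<partial>gauss1) = (\<integral>\<^sup>+x. \<integral>\<^sup>+y. G x y \<partial>lborel \<partial>lborel)"
    unfolding G_def by (rule gen) measurable
  also have "\<dots> = (\<integral>\<^sup>+y. \<integral>\<^sup>+x. G x y \<partial>lborel \<partial>lborel)"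
    by (rule lborel_pair.Fubini'[symmetric]) simp
  also have "\<dots> = (\<integral>\<^sup>+y. \<integral>\<^sup>+u. ennreal (1/c) * G (- (s / c * y) + 1 / c * u) y \<partial>lborel \<partial>lborel)"
  proof (rule nn_integral_cong)
    fix y :: real
    show "(\<integral>\<^sup>+x. G x y \<partial>lborel) = (\<integral>\<^sup>+u. ennreal (1/c) * G (- (s / c * y) + 1 / c * u) y \<partial>lborel)"
      using c by (subst nn_integral_real_affine[where c="1/c" and t="- (s / c * y)"]) (simp_all add: nn_integral_cmult)
  qed
  also have "\<dots> = (\<integral>\<^sup>+u. \<integral>\<^sup>+y. ennreal (1/c) * G (- (s / c * y) + 1 / c * u) y \<partial>lborel \<partial>lborel)"
    by (rule lborel_pair.Fubini'[of "\<lambda>u y. ennreal (1/c) * G (- (s / c * y) + 1 / c * u) y"]) simp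
  also have "\<dots> = (\<integral>\<^sup>+u. \<integral>\<^sup>+v. \<rho> u * \<rho> v * f (u, v) \<partial>lborel \<partial>lborel)"
  proof (rule nn_integral_cong)
    fix u :: real
    have G: "G (c * u - s * v) (s * u + c * v) = \<rho> u * \<rho> v * f (u, v)" for v
    proof -
      have 1: "c * (c * u - s * v) + s * (s * u + c * v) = u" "c * (s * u + c * v) - s * (c * u - s * v) = v"
        using cs by algebra+
      have "(c * u - s * v)\<^sup>2 + (s * u + c * v)\<^sup>2 = u\<^sup>2 + v\<^sup>2" using cs by algebra
      then have "exp (- (c * u - s * v)\<^sup>2 / 2) * exp (- (s * u + c * v)\<^sup>2 / 2) = exp (- u\<^sup>2 / 2) * exp (- v\<^sup>2 / 2)"
        by (simp add: exp_add[symmetric] field_simps)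
      then have "\<rho> (c * u - s * v) * \<rho> (s * u + c * v) = \<rho> u * \<rho> v"
        by (simp add: \<rho>_def normal_density_def ennreal_mult[symmetric] field_simps)
      then show ?thesis unfolding G_def 1 by simp
    qed
    have A: "- (s / c * (s * u + c * v)) + 1 / c * u = c * u - s * v" for v
    proof -
      have "- (s / c * (s * u + c * v)) + 1 / c * u = ((1 - s\<^sup>2) * u - s * c * v) / c"
        using c by (simp add: field_simps power2_eq_square)
      also have "1 - s\<^sup>2 = c\<^sup>2" using cs by simp
      finally show ?thesis using c by (simp add: field_simps power2_eq_square)
    qed
    have "(\<integral>\<^sup>+y. ennreal (1/c) * G (- (s / c * y) + 1 / c * u) y \<partial>lborel)
      = ennreal c * (\<integral>\<^sup>+v. ennreal (1/c) * G (c * u - s * v) (s * u + c * v) \<partial>lborel)"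
      using c by (subst nn_integral_real_affine[where c=c and t="s * u"]) (simp_all only: A, simp_all)
    also have "\<dots> = (\<integral>\<^sup>+v. (ennreal c * ennreal (1/c)) * G (c * u - s * v) (s * u + c * v) \<partial>lborel)"
      by (subst nn_integral_cmult[symmetric]) (simp_all add: mult.assoc)
    also have "ennreal c * ennreal (1/c) = 1" using c by (simp add: ennreal_mult[symmetric])
    finally show "(\<integral>\<^sup>+y. ennreal (1/c) * G (- (s / c * y) + 1 / c * u) y \<partial>lborel) = (\<integral>\<^sup>+v. \<rho> u * \<rho> v * f (u, v) \<partial>lborel)"
      by (simp add: G)
  qed
  also have "\<dots> = (\<integral>\<^sup>+x. \<integral>\<^sup>+y. f (x, y) \<partial>gauss1 \<partial>gauss1)"
    by (rule gen[symmetric]) simp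
  finally show ?thesis .
qed

text \<open>Viewed as one vector of planar Gaussian points, the pair of vectors is rotated in each
  coordinate separately, so the planar case and the replacement principle suffice.\<close>

lemma nn_integral_PiM_gauss1_rotation:
  fixes c s :: real and f :: "('i \<Rightarrow> real) \<times> ('i \<Rightarrow> real) \<Rightarrow> ennreal"
  assumes c: "c > 0" and cs: "c\<^sup>2 + s\<^sup>2 = 1" and I: "finite I"
    and [measurable]: "f \<in> borel_measurable (PiM I (\<lambda>_. borel) \<Otimes>\<^sub>M PiM I (\<lambda>_. borel))"
  shows "(\<integral>\<^sup>+x. \<integral>\<^sup>+y. f (\<lambda>i\<in>I. c * x i + s * y i, \<lambda>i\<in>I. c * y i - s * x i)
       \<partial>PiM I (\<lambda>_. gauss1) \<partial>PiM I (\<lambda>_. gauss1)) =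
     (\<integral>\<^sup>+x. \<integral>\<^sup>+y. f (x, y) \<partial>PiM I (\<lambda>_. gauss1) \<partial>PiM I (\<lambda>_. gauss1))" (is "?L = ?R")
proof -
  interpret G2: pair_prob_space gauss1 gauss1 ..
  define R where "R z = (c * fst z + s * snd z, c * snd z - s * fst z)" for z :: "real \<times> real"
  define F where "F w = f (\<lambda>i\<in>I. fst (w i), \<lambda>i\<in>I. snd (w i))" for w :: "'i \<Rightarrow> real \<times> real"
  have [measurable]: "F \<in> borel_measurable (PiM I (\<lambda>_. borel \<Otimes>\<^sub>M borel))"
    unfolding F_def by measurable
  have "?L = (\<integral>\<^sup>+z. f (\<lambda>i\<in>I. c * (\<lambda>i\<in>I. fst (z i)) i + s * (\<lambda>i\<in>I. snd (z i)) i,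
      \<lambda>i\<in>I. c * (\<lambda>i\<in>I. snd (z i)) i - s * (\<lambda>i\<in>I. fst (z i)) i) \<partial>PiM I (\<lambda>_. gauss1 \<Otimes>\<^sub>M gauss1))"
    using nn_integral_PiM_pair[OF I prob_space_gauss1 prob_space_gauss1,
      of "\<lambda>(x, y). f (\<lambda>i\<in>I. c * x i + s * y i, \<lambda>i\<in>I. c * y i - s * x i)"] by simp
  also have "\<dots> = (\<integral>\<^sup>+z. F (\<lambda>i\<in>I. R (z i)) \<partial>PiM I (\<lambda>_. gauss1 \<Otimes>\<^sub>M gauss1))"
    unfolding F_def by (intro nn_integral_cong arg_cong[where f=f]) (auto simp: R_def fun_eq_iff)
  also have "\<dots> = (\<integral>\<^sup>+z. F (\<lambda>i\<in>I. z i) \<partial>PiM I (\<lambda>_. gauss1 \<Otimes>\<^sub>M gauss1))"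
  proof (rule nn_integral_PiM_eq[where K="borel \<Otimes>\<^sub>M borel"])
    fix i x assume i: "i \<in> I" and x: "x \<in> space (PiM (I - {i}) (\<lambda>_. borel \<Otimes>\<^sub>M borel :: (real \<times> real) measure))"
    have I': "insert i (I - {i}) = I" using i by auto
    have "(\<lambda>t. x(i := t)) \<in> measurable (borel \<Otimes>\<^sub>M borel) (PiM (insert i (I - {i})) (\<lambda>_. borel \<Otimes>\<^sub>M borel :: (real \<times> real) measure))"
      using x by measurable
    from this[unfolded I'] have [measurable]: "(\<lambda>t. x(i := t)) \<in> measurable (borel \<Otimes>\<^sub>M borel) (PiM I (\<lambda>_. borel \<Otimes>\<^sub>M borel :: (real \<times> real) measure))" .
    have [measurable]: "(\<lambda>t. F (x(i := t))) \<in> borel_measurable (borel \<Otimes>\<^sub>M borel)" by measurable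
    have "(\<integral>\<^sup>+t. F (x(i := R t)) \<partial>(gauss1 \<Otimes>\<^sub>M gauss1)) = (\<integral>\<^sup>+a. \<integral>\<^sup>+b. F (x(i := R (a, b))) \<partial>gauss1 \<partial>gauss1)"
      unfolding R_def by (subst gauss1.nn_integral_fst[symmetric]) simp_all
    also have "\<dots> = (\<integral>\<^sup>+a. \<integral>\<^sup>+b. F (x(i := (a, b))) \<partial>gauss1 \<partial>gauss1)"
      unfolding R_def fst_conv snd_conv by (rule nn_integral_gauss1_rotation[OF c cs, of "\<lambda>t. F (x(i := t))"]) simp
    also have "\<dots> = (\<integral>\<^sup>+t. F (x(i := t)) \<partial>(gauss1 \<Otimes>\<^sub>M gauss1))"
      by (subst gauss1.nn_integral_fst[symmetric]) simp_all
    finally show "(\<integral>\<^sup>+t. F (x(i := R t)) \<partial>(gauss1 \<Otimes>\<^sub>M gauss1)) = (\<integral>\<^sup>+t. F (x(i := t)) \<partial>(gauss1 \<Otimes>\<^sub>M gauss1))" .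
  qed (use I in \<open>auto simp: R_def intro: G2.prob_space_axioms\<close>)
  also have "\<dots> = (\<integral>\<^sup>+z. f (\<lambda>i\<in>I. fst (z i), \<lambda>i\<in>I. snd (z i)) \<partial>PiM I (\<lambda>_. gauss1 \<Otimes>\<^sub>M gauss1))"
    unfolding F_def by (intro nn_integral_cong arg_cong[where f=f]) (auto simp: fun_eq_iff)
  also have "\<dots> = ?R"
    by (rule nn_integral_PiM_pair[OF I prob_space_gauss1 prob_space_gauss1]) simp
  finally show ?thesis .
qed

text \<open>Rotating so that the first axis points along \<open>(a, b)\<close> leaves a function of
  one variable. The case \<open>a = 0\<close> falls outside the rotation lemma and uses the
  reflection symmetry for negative \<open>b\<close>.\<close>

lemma nn_integral_gauss1_add:
  fixes a b :: real
  assumes "a \<ge> 0" and [measurable]: "f \<in> borel_measurable borel"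
  shows "(\<integral>\<^sup>+x. \<integral>\<^sup>+y. f (a * x + b * y) \<partial>gauss1 \<partial>gauss1) = (\<integral>\<^sup>+x. f (sqrt (a\<^sup>2 + b\<^sup>2) * x) \<partial>gauss1)"
proof (cases "a = 0")
  case True
  show ?thesis
  proof (cases "b \<ge> 0")
    case True
    then show ?thesis using \<open>a = 0\<close> by (simp add: gauss1.emeasure_space_1)
  next
    case False
    then show ?thesis using \<open>a = 0\<close> nn_integral_gauss1_uminus[of "\<lambda>x. f (b * x)"]
      by (simp add: gauss1.emeasure_space_1)
  qed
next
  case False
  then have a: "a > 0" using assms by simp
  define r where "r = sqrt (a\<^sup>2 + b\<^sup>2)"
  have r: "r > 0" using a by (simp add: r_def sum_power2_gt_zero_iff)
  have r2: "r\<^sup>2 = a\<^sup>2 + b\<^sup>2" by (simp add: r_def)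
  have "(\<integral>\<^sup>+x. \<integral>\<^sup>+y. f (r * (a / r * x + b / r * y)) \<partial>gauss1 \<partial>gauss1) = (\<integral>\<^sup>+x. \<integral>\<^sup>+y. f (r * x) \<partial>gauss1 \<partial>gauss1)"
    using nn_integral_gauss1_rotation[of "a / r" "b / r" "\<lambda>(x, y). f (r * x)"] a r
    by (simp add: power_divide add_divide_distrib[symmetric] r2[symmetric])
  then show ?thesis using r by (simp add: algebra_simps gauss1.emeasure_space_1 r_def[symmetric])
qed

lemma borel_measurable_component:
  assumes "sets D = sets borel" "j \<in> I"
  shows "(\<lambda>g. g j) \<in> borel_measurable (PiM I (\<lambda>_. D))"
  using measurable_component_singleton[OF assms(2), of "\<lambda>_. D"] assms(1)
  by (simp cong: measurable_cong_sets)

lemma borel_measurable_ip: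
  assumes "\<And>j. j < n \<Longrightarrow> (\<lambda>w. f w j) \<in> borel_measurable M"
  shows "(\<lambda>w. ip n (f w) u) \<in> borel_measurable M"
  unfolding ip_def using assms by (intro borel_measurable_sum borel_measurable_times) auto

lemma nn_integral_gauss_ip:
  assumes "f \<in> borel_measurable borel"
  shows "(\<integral>\<^sup>+g. f (ip n g u) \<partial>PiM {..<n} (\<lambda>_. gauss1)) = (\<integral>\<^sup>+t. f (nrm n u * t) \<partial>gauss1)"
  using assms
proof (induction n arbitrary: f)
  case 0
  then show ?case by (simp add: ip_def nrm_def PiM_empty nn_integral_count_space_finite gauss1.emeasure_space_1)
next
  case (Suc n)
  note [measurable] = Suc.prems
  interpret PG: product_prob_space "\<lambda>_. gauss1" "{..<Suc n}" by (rule product_prob_spaceI) (rule prob_space_gauss1)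
  have ip: "ip (Suc n) (g(n := y)) u = ip n g u + y * u n" for g y
    by (simp add: ip_def)
  have [measurable]: "(\<lambda>g. ip (Suc n) g u) \<in> borel_measurable (PiM (insert n {..<n}) (\<lambda>_. gauss1))"
    by (intro borel_measurable_ip borel_measurable_component) auto
  have "(\<integral>\<^sup>+g. f (ip (Suc n) g u) \<partial>PiM {..<Suc n} (\<lambda>_. gauss1))
    = (\<integral>\<^sup>+y. \<integral>\<^sup>+g. f (ip n g u + y * u n) \<partial>PiM {..<n} (\<lambda>_. gauss1) \<partial>gauss1)"
    unfolding lessThan_Suc by (subst PG.product_nn_integral_insert_rev) (simp_all add: ip)
  also have "\<dots> = (\<integral>\<^sup>+y. \<integral>\<^sup>+t. f (nrm n u * t + y * u n) \<partial>gauss1 \<partial>gauss1)"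
    by (intro nn_integral_cong Suc.IH[of "\<lambda>s. f (s + _ * _)"]) simp
  also have "\<dots> = (\<integral>\<^sup>+t. \<integral>\<^sup>+y. f (nrm n u * t + u n * y) \<partial>gauss1 \<partial>gauss1)"
  proof -
    interpret P: pair_sigma_finite gauss1 gauss1 ..
    show ?thesis by (subst P.Fubini') (simp_all add: mult.commute)
  qed
  also have "\<dots> = (\<integral>\<^sup>+t. f (nrm (Suc n) u * t) \<partial>gauss1)"
    by (subst nn_integral_gauss1_add) (simp_all add: nrm_def sum_nonneg)
  finally show ?case .
qed

lemma nn_integral_gauss1_exp: "(\<integral>\<^sup>+t. ennreal (exp (b * t)) \<partial>gauss1) = ennreal (exp (b\<^sup>2 / 2))"
proof -
  have "(\<integral>\<^sup>+t. ennreal (exp (b * t)) \<partial>gauss1) = (\<integral>\<^sup>+t. ennreal (std_normal_density t) * ennreal (exp (b * t)) \<partial>lborel)"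
    by (rule nn_integral_gauss1) simp
  also have "\<dots> = (\<integral>\<^sup>+t. ennreal (exp (b\<^sup>2 / 2)) * ennreal (std_normal_density (- b + 1 * t)) \<partial>lborel)"
  proof (rule nn_integral_cong)
    fix t :: real
    have "- t\<^sup>2 / 2 + b * t = b\<^sup>2 / 2 + - (- b + 1 * t)\<^sup>2 / 2"
      by (simp add: power2_eq_square field_simps)
    then have "exp (- t\<^sup>2 / 2) * exp (b * t) = exp (b\<^sup>2 / 2) * exp (- (- b + 1 * t)\<^sup>2 / 2)"
      by (simp only: exp_add[symmetric])
    then show "ennreal (std_normal_density t) * ennreal (exp (b * t)) = ennreal (exp (b\<^sup>2 / 2)) * ennreal (std_normal_density (- b + 1 * t))"
      by (simp add: ennreal_mult[symmetric] normal_density_def)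
  qed
  also have "\<dots> = ennreal (exp (b\<^sup>2 / 2)) * (\<integral>\<^sup>+t. ennreal (std_normal_density (- b + 1 * t)) \<partial>lborel)"
    by (rule nn_integral_cmult) simp
  also have "(\<integral>\<^sup>+t. ennreal (std_normal_density (- b + 1 * t)) \<partial>lborel) = (\<integral>\<^sup>+t. ennreal (std_normal_density t) \<partial>lborel)"
    using nn_integral_real_affine[of "\<lambda>t. ennreal (std_normal_density t)" 1 "-b"] by simp
  also have "\<dots> = emeasure gauss1 (space gauss1)"
    unfolding gauss1_def by (simp add: emeasure_density)
  finally show ?thesis by (simp add: gauss1.emeasure_space_1)
qed

lemma nn_integral_gauss1_abs: "(\<integral>\<^sup>+t. ennreal \<bar>t\<bar> \<partial>gauss1) = ennreal (sqrt (2 / pi))"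
proof -
  have "has_bochner_integral lborel (\<lambda>x. std_normal_density x * \<bar>x\<bar>) (sqrt (2 / pi))"
    using std_normal_moment_abs_odd[of 0] by simp
  then have "(\<integral>\<^sup>+t. ennreal (std_normal_density t * \<bar>t\<bar>) \<partial>lborel) = ennreal (sqrt (2 / pi))"
    by (subst nn_integral_eq_integral) (auto simp: has_bochner_integral_iff)
  then show ?thesis by (simp add: nn_integral_gauss1 ennreal_mult)
qed

lemma nn_integral_gauss1_power4: "(\<integral>\<^sup>+t. ennreal (t ^ 4) \<partial>gauss1) = 3"
proof -
  have "has_bochner_integral lborel (\<lambda>x. std_normal_density x * x ^ 4) 3"
    using std_normal_moment_even[of 2] by (simp add: fact_numeral)
  then have "(\<integral>\<^sup>+t. ennreal (std_normal_density t * t ^ 4) \<partial>lborel) = ennreal 3"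
    by (subst nn_integral_eq_integral) (auto simp: has_bochner_integral_iff)
  then show ?thesis by (simp add: nn_integral_gauss1 ennreal_mult)
qed

section \<open>Symmetric sub-gaussian variables and convex order\<close>

text \<open>The quotient of \<open>k ^ k\<close> by \<open>fact k\<close> is a single term of the
  exponential series at \<open>k\<close>.\<close>

lemma power_self_le_exp_fact: "real k ^ k \<le> exp (real k) * fact k"
proof -
  have "real k ^ k / fact k \<le> (\<Sum>n. real k ^ n / fact n)"
    using sum_le_suminf[of "\<lambda>n. real k ^ n / fact n" "{k}"] summable_exp[of "real k"]
    by (simp add: divide_inverse mult.commute)
  also have "\<dots> = exp (real k)" by (simp add: exp_def divide_inverse mult.commute)
  finally show ?thesis by (simp add: divide_simps mult.commute)
qed

lemma nn_integral_even_part: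
  fixes f :: "real \<Rightarrow> real"
  assumes sym: "\<And>g :: real \<Rightarrow> ennreal. g \<in> borel_measurable borel \<Longrightarrow> (\<integral>\<^sup>+x. g (- x) \<partial>M) = (\<integral>\<^sup>+x. g x \<partial>M)"
    and M[measurable_cong]: "sets M = sets borel"
    and [measurable]: "f \<in> borel_measurable borel" and pos: "\<And>x. f x \<ge> 0"
  shows "(\<integral>\<^sup>+x. ennreal ((f x + f (- x)) / 2) \<partial>M) = (\<integral>\<^sup>+x. ennreal (f x) \<partial>M)"
proof -
  have "(\<integral>\<^sup>+x. ennreal ((f x + f (- x)) / 2) \<partial>M) = (\<integral>\<^sup>+x. ennreal (1/2 * f x) + ennreal (1/2 * f (- x)) \<partial>M)"
    using pos by (intro nn_integral_cong) (simp add: ennreal_plus[symmetric] add_divide_distrib del: ennreal_plus)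
  also have "\<dots> = (\<integral>\<^sup>+x. ennreal (1/2 * f x) \<partial>M) + (\<integral>\<^sup>+x. ennreal (1/2 * f (- x)) \<partial>M)"
    by (rule nn_integral_add) measurable
  also have "(\<integral>\<^sup>+x. ennreal (1/2 * f (- x)) \<partial>M) = (\<integral>\<^sup>+x. ennreal (1/2 * f x) \<partial>M)"
    by (rule sym[of "\<lambda>x. ennreal (1/2 * f x)"]) measurable
  also have "(\<integral>\<^sup>+x. ennreal (1/2 * f x) \<partial>M) + (\<integral>\<^sup>+x. ennreal (1/2 * f x) \<partial>M) = (\<integral>\<^sup>+x. ennreal (1/2 * f x) + ennreal (1/2 * f x) \<partial>M)"
    by (rule nn_integral_add[symmetric]) measurable
  also have "\<dots> = (\<integral>\<^sup>+x. ennreal (f x) \<partial>M)"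
    using pos by (intro nn_integral_cong) (simp add: ennreal_plus[symmetric] del: ennreal_plus)
  finally show ?thesis .
qed

text \<open>On the window, \<open>(s + 1)\<^sup>2 \<le> 2 * s\<^sup>2 + 2\<close> bounds the density
  from below. The loss in the exponent is harmless: the reciprocal \<open>exp (s\<^sup>2)\<close> is
  exactly what the square-exponential moment of \<open>D\<close> can absorb after scaling by
  \<open>R\<close>.\<close>

lemma gauss1_tail:
  assumes s: "s \<ge> 0"
  shows "ennreal (exp (- 1 - s\<^sup>2) / sqrt (2 * pi)) \<le> emeasure gauss1 {s..s+1}"
proof -
  have "ennreal (exp (- 1 - s\<^sup>2) / sqrt (2 * pi)) = (\<integral>\<^sup>+x. ennreal (exp (- 1 - s\<^sup>2) / sqrt (2 * pi)) * indicator {s..s+1} x \<partial>lborel)"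
    by (simp add: nn_integral_cmult_indicator)
  also have "\<dots> \<le> (\<integral>\<^sup>+x. ennreal (std_normal_density x) * indicator {s..s+1} x \<partial>lborel)"
  proof (rule nn_integral_mono)
    fix x :: real
    have "exp (- 1 - s\<^sup>2) / sqrt (2 * pi) \<le> std_normal_density x" if "x \<in> {s..s+1}"
    proof -
      have "x\<^sup>2 \<le> (s + 1)\<^sup>2" using that s by (intro power_mono) auto
      also have "\<dots> \<le> 2 * s\<^sup>2 + 2" using sum_squares_ge_zero[of "s - 1" 0] by (simp add: power2_eq_square algebra_simps)
      finally have "exp (- 1 - s\<^sup>2) \<le> exp (- x\<^sup>2 / 2)" by simp
      then show ?thesis by (simp add: normal_density_def divide_right_mono)
    qed
    then show "ennreal (exp (- 1 - s\<^sup>2) / sqrt (2 * pi)) * indicator {s..s+1} x \<le> ennreal (std_normal_density x) * indicator {s..s+1} x"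
      by (auto simp: indicator_def intro: ennreal_leI)
  qed
  also have "\<dots> = emeasure gauss1 {s..s+1}"
    unfolding gauss1_def by (simp add: emeasure_density)
  finally show ?thesis .
qed

locale symmetric_subgaussian = prob_space D for D :: "real measure" +
  assumes sets_D[simp, measurable_cong]: "sets D = sets borel"
    and distr_uminus: "distr D borel uminus = D"
    and subgaussian: "subgaussian D"
    and second_moment: "(\<integral>t. t\<^sup>2 \<partial>D) = 1"
begin

abbreviation \<kappa> :: real where "\<kappa> \<equiv> subg_norm D"

lemma space_D[simp]: "space D = UNIV"
  using sets_eq_imp_space_eq[OF sets_D] by simp

lemma emeasure_D_UNIV[simp]: "emeasure D UNIV = 1"
  using emeasure_space_1 by simp

lemma nn_integral_uminus:
  assumes [measurable]: "f \<in> borel_measurable borel"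
  shows "(\<integral>\<^sup>+x. f (- x) \<partial>D) = (\<integral>\<^sup>+x. f x \<partial>D)"
proof -
  have "(\<integral>\<^sup>+x. f x \<partial>D) = (\<integral>\<^sup>+x. f x \<partial>distr D borel uminus)" by (simp add: distr_uminus)
  also have "\<dots> = (\<integral>\<^sup>+x. f (- x) \<partial>D)" by (rule nn_integral_distr) auto
  finally show ?thesis by simp
qed

lemma moment_le_norm:
  assumes "q \<ge> 1"
  shows "q powr (-1/2) * (\<integral>t. \<bar>t\<bar> powr q \<partial>D) powr (1/q) \<le> \<kappa>"
  using subgaussian assms unfolding subgaussian_def subg_norm_def by (intro cSUP_upper) auto

lemma norm_nonneg: "\<kappa> \<ge> 0"
  by (rule order_trans[OF _ moment_le_norm[of 1]]) auto

lemma even_moment: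
  assumes k: "k > 0"
  shows "integrable D (\<lambda>t. t ^ (2 * k))" "(\<integral>t. t ^ (2 * k) \<partial>D) \<le> (\<kappa>\<^sup>2 * (2 * k)) ^ k"
proof -
  define q where "q = real (2 * k)"
  have q: "q \<ge> 1" using k by (simp add: q_def)
  have eq: "\<bar>t\<bar> powr q = t ^ (2 * k)" for t
    using k by (simp add: q_def powr_realpow' power_even_abs del: of_nat_mult)
  show "integrable D (\<lambda>t. t ^ (2 * k))"
    using subgaussian q unfolding subgaussian_def by (auto simp: eq)
  define m where "m = (\<integral>t. t ^ (2 * k) \<partial>D)"
  have m: "m \<ge> 0" unfolding m_def by (intro integral_nonneg_AE) (simp add: power_mult)
  have "q powr (-1/2) * m powr (1/q) \<le> \<kappa>"
    using moment_le_norm[OF q] by (simp add: eq m_def)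
  then have "m powr (1/q) \<le> \<kappa> * sqrt q"
    using q by (simp add: powr_minus powr_half_sqrt field_simps)
  then have "(m powr (1/q)) powr q \<le> (\<kappa> * sqrt q) powr q"
    using q by (intro powr_mono2) auto
  also have "(m powr (1/q)) powr q = m" using q m by (simp add: powr_powr)
  also have "(\<kappa> * sqrt q) powr q = (\<kappa> * sqrt q) ^ (2 * k)"
    using k norm_nonneg q by (subst q_def, subst powr_realpow') auto
  also have "\<dots> = (\<kappa>\<^sup>2 * (2 * k)) ^ k"
    using q by (simp add: power_mult power_mult_distrib q_def)
  finally show "(\<integral>t. t ^ (2 * k) \<partial>D) \<le> (\<kappa>\<^sup>2 * (2 * k)) ^ k" by (simp add: m_def)
qed

lemma nn_even_moment:
  assumes k: "k > 0"
  shows "(\<integral>\<^sup>+t. ennreal (t ^ (2 * k)) \<partial>D) \<le> ennreal ((\<kappa>\<^sup>2 * (2 * k)) ^ k)"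
  using even_moment[OF k] by (subst nn_integral_eq_integral) (auto simp: power_mult intro: ennreal_leI)

text \<open>Unit variance is the case \<open>k = 1\<close> of the moment bound. This lower bound on
  \<open>\<kappa>\<close> later absorbs absolute Gaussian constants.\<close>

lemma norm_ge: "\<kappa>\<^sup>2 \<ge> 1 / 2"
  using even_moment(2)[of 1] second_moment by simp

lemma norm_pos: "\<kappa> > 0"
  using norm_ge norm_nonneg by (cases "\<kappa> = 0") auto

lemma integrable_id_abs: "integrable D (\<lambda>t. \<bar>t\<bar>)"
  using conjunct1[OF subgaussian[unfolded subgaussian_def], rule_format, of 1] by simp

text \<open>Expanding the exponential, the \<open>k\<close>-th term is at most
  \<open>(\<kappa>\<^sup>2 * (2 * k) / R\<^sup>2) ^ k / fact k\<close>. The choice of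
  \<open>R\<close> makes the base \<open>k / (2 * exp 1)\<close>, so the bound on
  \<open>k ^ k\<close> leaves a geometric series with ratio 1/2 and sum 2.\<close>

lemma nn_integral_exp_square:
  assumes R: "R\<^sup>2 = 4 * exp 1 * \<kappa>\<^sup>2"
  shows "(\<integral>\<^sup>+t. ennreal (exp (t\<^sup>2 / R\<^sup>2)) \<partial>D) \<le> 2"
proof -
  have R0: "R\<^sup>2 > 0" unfolding R using norm_pos by simp
  have exp: "ennreal (exp (t\<^sup>2 / R\<^sup>2)) = (\<Sum>k. ennreal ((t\<^sup>2 / R\<^sup>2) ^ k / fact k))" for t
    using summable_exp[of "t\<^sup>2 / R\<^sup>2"]
    by (subst suminf_ennreal2) (auto simp: exp_def divide_inverse mult.commute)
  have summand_le: "(\<integral>\<^sup>+t. ennreal ((t\<^sup>2 / R\<^sup>2) ^ k / fact k) \<partial>D) \<le> ennreal ((1/2) ^ k)" for k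
  proof (cases "k = 0")
    case False
    have "(\<integral>\<^sup>+t. ennreal ((t\<^sup>2 / R\<^sup>2) ^ k / fact k) \<partial>D) = (\<integral>\<^sup>+t. ennreal (1 / ((R\<^sup>2) ^ k * fact k)) * ennreal (t ^ (2 * k)) \<partial>D)"
      by (intro nn_integral_cong) (simp add: ennreal_mult[symmetric] power_divide power_mult)
    also have "\<dots> = ennreal (1 / ((R\<^sup>2) ^ k * fact k)) * (\<integral>\<^sup>+t. ennreal (t ^ (2 * k)) \<partial>D)"
      by (rule nn_integral_cmult) simp
    also have "\<dots> \<le> ennreal (1 / ((R\<^sup>2) ^ k * fact k)) * ennreal ((\<kappa>\<^sup>2 * (2 * k)) ^ k)"
      using False by (intro mult_left_mono nn_even_moment) auto
    also have "\<dots> = ennreal (1 / ((R\<^sup>2) ^ k * fact k) * (\<kappa>\<^sup>2 * (2 * k)) ^ k)"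
      by (rule ennreal_mult[symmetric]) auto
    also have "\<dots> \<le> ennreal ((1/2) ^ k)"
    proof (rule ennreal_leI)
      have "1 / ((R\<^sup>2) ^ k * fact k) * (\<kappa>\<^sup>2 * (2 * k)) ^ k = (\<kappa>\<^sup>2 * (2 * k) / R\<^sup>2) ^ k / fact k"
        by (simp add: power_divide)
      also have "\<kappa>\<^sup>2 * (2 * k) / R\<^sup>2 = (1/2) * (real k / exp 1)"
        unfolding R using norm_pos by (simp add: field_simps)
      also have "((1/2) * (real k / exp 1)) ^ k / fact k = (1/2) ^ k * (real k ^ k / (exp (real k) * fact k))"
        by (simp add: power_mult_distrib power_divide exp_of_nat_mult[symmetric])
      also have "\<dots> \<le> (1/2) ^ k * 1"
        using power_self_le_exp_fact[of k] by (intro mult_left_mono) (auto simp: divide_simps)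
      finally show "1 / ((R\<^sup>2) ^ k * fact k) * (\<kappa>\<^sup>2 * (2 * k)) ^ k \<le> (1/2) ^ k" by simp
    qed
    finally show ?thesis .
  qed simp
  have "(\<integral>\<^sup>+t. ennreal (exp (t\<^sup>2 / R\<^sup>2)) \<partial>D) = (\<Sum>k. \<integral>\<^sup>+t. ennreal ((t\<^sup>2 / R\<^sup>2) ^ k / fact k) \<partial>D)"
    unfolding exp by (rule nn_integral_suminf) measurable
  also have "\<dots> \<le> (\<Sum>k. ennreal ((1/2) ^ k))"
    by (intro suminf_le summand_le) auto
  also have "\<dots> = ennreal 2"
    by (subst suminf_ennreal2) (auto simp: suminf_geometric)
  finally show ?thesis by simp
qed

text \<open>By symmetry of both laws only the even part of \<open>\<phi>\<close> matters. Its value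
  at 0 is subtracted first, since a constant gains nothing from dilation, and is restored at the end
  because both laws have mass 1. The remainder \<open>\<psi>\<close> is nonnegative and increasing
  in the absolute value of its argument.\<close>

lemma nn_integral_convex_le_gauss1:
  fixes \<phi> :: "real \<Rightarrow> real"
  assumes R: "R\<^sup>2 = 4 * exp 1 * \<kappa>\<^sup>2" "R > 0"
    and conv: "convex_on UNIV \<phi>" and pos: "\<And>t. \<phi> t \<ge> 0" and [measurable]: "\<phi> \<in> borel_measurable borel"
  shows "(\<integral>\<^sup>+t. ennreal (\<phi> t) \<partial>D) \<le> (\<integral>\<^sup>+t. ennreal (\<phi> (17 * R * t)) \<partial>gauss1)"
proof -
  define e where "e t = (\<phi> t + \<phi> (- t)) / 2" for t
  define \<psi> where "\<psi> t = e t - e 0" for t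
  have [measurable]: "e \<in> borel_measurable borel" "\<psi> \<in> borel_measurable borel"
    unfolding e_def \<psi>_def by measurable
  have even: "e (- t) = e t" for t by (simp add: e_def)
  have e_conv: "e (a * s + (1 - a) * t) \<le> a * e s + (1 - a) * e t" if "0 \<le> a" "a \<le> 1" for a s t
  proof -
    have 1: "\<phi> (a * s + (1 - a) * t) \<le> a * \<phi> s + (1 - a) * \<phi> t"
      using convex_onD[OF conv, of "1 - a" s t] that by simp
    have "\<phi> (a * - s + (1 - a) * - t) \<le> a * \<phi> (- s) + (1 - a) * \<phi> (- t)"
      using convex_onD[OF conv, of "1 - a" "- s" "- t"] that by simp
    also have "a * - s + (1 - a) * - t = - (a * s + (1 - a) * t)" by simp
    finally show ?thesis using 1 unfolding e_def by argo
  qed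
  have e_pos: "e t \<ge> 0" for t using pos[of t] pos[of "-t"] by (simp add: e_def)
  have \<psi>_pos: "\<psi> t \<ge> 0" for t
    using e_conv[of "1/2" t "- t"] by (simp add: \<psi>_def even)
  have \<psi>_mono: "\<psi> s \<le> \<psi> t" if "0 \<le> s" "s \<le> t" for s t
  proof (cases "t = 0")
    case False
    then have t: "t > 0" using that by simp
    have "s = (s + t) / (2 * t) * t + (1 - (s + t) / (2 * t)) * (- t)" using t by (simp add: field_simps)
    then have "e s \<le> (s + t) / (2 * t) * e t + (1 - (s + t) / (2 * t)) * e (- t)"
      using e_conv[of "(s + t) / (2 * t)" t "- t"] that t by simp
    then show ?thesis by (simp add: \<psi>_def even algebra_simps)
  qed (use that in simp)
  have \<psi>_17: "17 * \<psi> s \<le> \<psi> (17 * s)" for s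
    using e_conv[of "1/17" "17 * s" 0] by (simp add: \<psi>_def field_simps)
  define B where "B = (\<integral>\<^sup>+t. ennreal (\<psi> (R * t)) \<partial>gauss1)"
  define k where "k = exp (- 1) / sqrt (2 * pi)"
  have k: "k > 0" by (simp add: k_def)
  \<comment> \<open>Here 2 is the bound on the square-exponential moment and \<open>1 / k\<close>
    the inverse constant of the Gaussian window. The product is
    \<open>2 * exp 1 * sqrt (2 * pi)\<close>, and 17 is \<open>2 * 3 * (17 / 6)\<close>.\<close>
  have k17: "2 / k \<le> 17"
  proof -
    have "2 / k = 2 * exp 1 * sqrt (2 * pi)" by (simp add: k_def exp_minus field_simps)
    also have "\<dots> \<le> 2 * 3 * sqrt 8"
      using exp_le pi_less_4 by (intro mult_mono real_sqrt_le_mono) auto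
    also have "sqrt 8 \<le> 17 / 6" by (rule real_le_lsqrt) (auto simp: power2_eq_square)
    finally show ?thesis by simp
  qed
  (* Markov's inequality for the Gaussian bounds psi pointwise; integrating this bound against D
     costs only a constant factor, which psi_17 turns into a dilation. *)
  have B: "ennreal (\<psi> t) \<le> B * ennreal (exp (t\<^sup>2 / R\<^sup>2) / k)" for t
  proof -
    define s where "s = \<bar>t\<bar> / R"
    have s: "s \<ge> 0" "R * s = \<bar>t\<bar>" using R by (simp_all add: s_def)
    have "\<psi> t = \<psi> \<bar>t\<bar>" by (cases "t \<ge> 0") (auto simp: \<psi>_def even)
    have "ennreal (\<psi> t) * ennreal (k * exp (- s\<^sup>2)) \<le> ennreal (\<psi> t) * emeasure gauss1 {s..s+1}"
      using gauss1_tail[OF s(1)] by (intro mult_left_mono) (auto simp: k_def exp_add[symmetric])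
    also have "\<dots> = (\<integral>\<^sup>+x. ennreal (\<psi> t) * indicator {s..s+1} x \<partial>gauss1)"
      by (simp add: nn_integral_cmult_indicator)
    also have "\<dots> \<le> B" unfolding B_def
    proof (rule nn_integral_mono)
      fix x
      have "\<psi> t \<le> \<psi> (R * x)" if "s \<le> x"
        using \<psi>_mono[of "\<bar>t\<bar>" "R * x"] that s R \<open>\<psi> t = \<psi> \<bar>t\<bar>\<close> mult_left_mono[OF that, of R] by simp
      then show "ennreal (\<psi> t) * indicator {s..s+1} x \<le> ennreal (\<psi> (R * x))"
        by (auto simp: indicator_def intro: ennreal_leI)
    qed
    finally have "ennreal (\<psi> t) * ennreal (k * exp (- s\<^sup>2)) * ennreal (exp (s\<^sup>2) / k) \<le> B * ennreal (exp (s\<^sup>2) / k)"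
      by (rule mult_right_mono) simp
    moreover have "ennreal (k * exp (- s\<^sup>2)) * ennreal (exp (s\<^sup>2) / k) = 1"
      using k by (simp add: ennreal_mult[symmetric] exp_minus)
    moreover have "s\<^sup>2 = t\<^sup>2 / R\<^sup>2" by (simp add: s_def power_divide)
    ultimately show ?thesis by (simp add: mult.assoc)
  qed
  have "(\<integral>\<^sup>+t. ennreal (\<psi> t) \<partial>D) \<le> (\<integral>\<^sup>+t. (B * ennreal (1 / k)) * ennreal (exp (t\<^sup>2 / R\<^sup>2)) \<partial>D)"
  proof (rule nn_integral_mono)
    fix t
    have "ennreal (exp (t\<^sup>2 / R\<^sup>2) / k) = ennreal (1 / k) * ennreal (exp (t\<^sup>2 / R\<^sup>2))"
      using k by (simp add: ennreal_mult[symmetric])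
    then show "ennreal (\<psi> t) \<le> (B * ennreal (1 / k)) * ennreal (exp (t\<^sup>2 / R\<^sup>2))"
      using B[of t] by (simp add: mult.assoc)
  qed
  also have "\<dots> = (B * ennreal (1 / k)) * (\<integral>\<^sup>+t. ennreal (exp (t\<^sup>2 / R\<^sup>2)) \<partial>D)"
    by (rule nn_integral_cmult) measurable
  also have "\<dots> \<le> (B * ennreal (1 / k)) * 2"
    by (intro mult_left_mono nn_integral_exp_square R) auto
  also have "\<dots> = B * ennreal (2 / k)"
  proof -
    have "ennreal (1 / k) * 2 = ennreal (1 / k) * ennreal 2" by simp
    also have "\<dots> = ennreal (2 / k)" using k by (subst ennreal_mult[symmetric]) auto
    finally show ?thesis by (simp only: mult.assoc)
  qed
  also have "\<dots> \<le> B * ennreal 17" using k17 by (intro mult_left_mono ennreal_leI) auto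
  also have "\<dots> = (\<integral>\<^sup>+t. ennreal 17 * ennreal (\<psi> (R * t)) \<partial>gauss1)"
    unfolding B_def by (subst nn_integral_cmult) (auto simp: mult.commute)
  also have "\<dots> \<le> (\<integral>\<^sup>+t. ennreal (\<psi> (17 * R * t)) \<partial>gauss1)"
  proof (rule nn_integral_mono)
    fix t
    have "ennreal 17 * ennreal (\<psi> (R * t)) = ennreal (17 * \<psi> (R * t))" by (subst ennreal_mult) (auto simp: \<psi>_pos)
    also have "\<dots> \<le> ennreal (\<psi> (17 * R * t))" using \<psi>_17[of "R * t"] by (intro ennreal_leI) (simp add: mult.assoc)
    finally show "ennreal 17 * ennreal (\<psi> (R * t)) \<le> ennreal (\<psi> (17 * R * t))" .
  qed
  finally have main: "(\<integral>\<^sup>+t. ennreal (\<psi> t) \<partial>D) \<le> (\<integral>\<^sup>+t. ennreal (\<psi> (17 * R * t)) \<partial>gauss1)" .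
  have e_split: "ennreal (e t) = ennreal (\<psi> t) + ennreal (e 0)" for t
    using \<psi>_pos[of t] e_pos[of 0] by (subst ennreal_plus[symmetric]) (auto simp: \<psi>_def)
  have "(\<integral>\<^sup>+t. ennreal (\<phi> t) \<partial>D) = (\<integral>\<^sup>+t. ennreal (e t) \<partial>D)"
    unfolding e_def by (rule nn_integral_even_part[symmetric]) (auto intro: nn_integral_uminus pos)
  also have "\<dots> = (\<integral>\<^sup>+t. ennreal (\<psi> t) + ennreal (e 0) \<partial>D)"
    by (intro nn_integral_cong e_split)
  also have "\<dots> = (\<integral>\<^sup>+t. ennreal (\<psi> t) \<partial>D) + ennreal (e 0)"
    by (subst nn_integral_add) auto
  also have "\<dots> \<le> (\<integral>\<^sup>+t. ennreal (\<psi> (17 * R * t)) \<partial>gauss1) + ennreal (e 0)"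
    by (rule add_right_mono) (rule main)
  also have "\<dots> = (\<integral>\<^sup>+t. ennreal (\<psi> (17 * R * t)) + ennreal (e 0) \<partial>gauss1)"
    by (subst nn_integral_add) auto
  also have "\<dots> = (\<integral>\<^sup>+t. ennreal (e (17 * R * t)) \<partial>gauss1)"
    by (intro nn_integral_cong e_split[symmetric])
  also have "\<dots> = (\<integral>\<^sup>+t. ennreal (\<phi> (17 * R * t)) \<partial>gauss1)"
    unfolding e_def using nn_integral_even_part[of gauss1 "\<lambda>t. \<phi> (17 * R * t)"]
    by (simp add: nn_integral_gauss1_uminus pos)
  finally show ?thesis .
qed

end

section \<open>Comparison of first absolute moments in total variation\<close>

text \<open>Layer-cake formula: the integral is that of the masses of the level sets
  \<open>{t. s < f t}\<close> over \<open>s\<close> from 0 to \<open>b\<close>, and each level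
  contributes an error of at most \<open>\<epsilon>\<close>.\<close>

lemma nn_integral_bounded_le:
  fixes f :: "real \<Rightarrow> real"
  assumes P: "prob_space P" and Q: "prob_space Q"
    and [simp, measurable_cong]: "sets P = sets borel" "sets Q = sets borel"
    and le: "\<And>A. A \<in> sets borel \<Longrightarrow> measure P A \<le> measure Q A + \<epsilon>"
    and [measurable]: "f \<in> borel_measurable borel" and f: "\<And>t. 0 \<le> f t" "\<And>t. f t \<le> b"
    and b: "b \<ge> 0" and \<epsilon>: "\<epsilon> \<ge> 0"
  shows "(\<integral>\<^sup>+t. ennreal (f t) \<partial>P) \<le> (\<integral>\<^sup>+t. ennreal (f t) \<partial>Q) + ennreal (b * \<epsilon>)"
proof -
  interpret P: prob_space P by fact
  interpret Q: prob_space Q by fact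
  have [simp]: "space P = UNIV" "space Q = UNIV"
    using sets_eq_imp_space_eq[OF assms(3)] sets_eq_imp_space_eq[OF assms(4)] by simp_all
  have layer: "(\<integral>\<^sup>+t. ennreal (f t) \<partial>M) = (\<integral>\<^sup>+s. emeasure M {t. s < f t} * indicator {0..<b} s \<partial>lborel)"
    if M: "prob_space M" and setsM: "sets M = sets borel" for M :: "real measure"
  proof -
    note setsM[simp, measurable_cong]
    interpret M: prob_space M by fact
    interpret Mlb: pair_sigma_finite M lborel ..
    have "(\<integral>\<^sup>+t. ennreal (f t) \<partial>M) = (\<integral>\<^sup>+t. \<integral>\<^sup>+s. indicator {t. s < f t} t * indicator {0..<b} s \<partial>lborel \<partial>M)"
    proof (rule nn_integral_cong)
      fix t
      have "ennreal (f t) = emeasure lborel {0..<f t}" using f by simp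
      also have "\<dots> = (\<integral>\<^sup>+s. indicator {0..<f t} s \<partial>lborel)" by simp
      also have "\<dots> = (\<integral>\<^sup>+s. indicator {t. s < f t} t * indicator {0..<b} s \<partial>lborel)"
        using f[of t] by (intro nn_integral_cong) (auto simp: indicator_def)
      finally show "ennreal (f t) = (\<integral>\<^sup>+s. indicator {t. s < f t} t * indicator {0..<b} s \<partial>lborel)" .
    qed
    also have "\<dots> = (\<integral>\<^sup>+s. \<integral>\<^sup>+t. indicator {t. s < f t} t * indicator {0..<b} s \<partial>M \<partial>lborel)"
      by (rule Mlb.Fubini'[symmetric]) (simp add: indicator_def)
    also have "\<dots> = (\<integral>\<^sup>+s. emeasure M {t. s < f t} * indicator {0..<b} s \<partial>lborel)"
      by (intro nn_integral_cong) (simp add: nn_integral_multc)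
    finally show ?thesis .
  qed
  have [measurable]: "(\<lambda>s. emeasure Q {t. s < f t}) \<in> borel_measurable borel"
  proof -
    have "{x \<in> space (borel \<Otimes>\<^sub>M Q). fst x < f (snd x)} \<in> sets (borel \<Otimes>\<^sub>M Q)" by measurable
    from Q.measurable_emeasure_Pair[OF this] show ?thesis
      by (simp add: space_pair_measure vimage_def)
  qed
  have "(\<integral>\<^sup>+t. ennreal (f t) \<partial>P) \<le> (\<integral>\<^sup>+s. emeasure Q {t. s < f t} * indicator {0..<b} s + ennreal \<epsilon> * indicator {0..<b} s \<partial>lborel)"
    unfolding layer[OF P assms(3)]
  proof (rule nn_integral_mono)
    fix s :: real
    have "{t. s < f t} \<in> sets borel" by measurable
    then have "emeasure P {t. s < f t} \<le> emeasure Q {t. s < f t} + ennreal \<epsilon>"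
      using le[of "{t. s < f t}"] \<epsilon>
      by (simp add: P.emeasure_eq_measure Q.emeasure_eq_measure ennreal_plus[symmetric] del: ennreal_plus)
    then show "emeasure P {t. s < f t} * indicator {0..<b} s \<le> emeasure Q {t. s < f t} * indicator {0..<b} s + ennreal \<epsilon> * indicator {0..<b} s"
      by (simp add: indicator_def)
  qed
  also have "\<dots> = (\<integral>\<^sup>+t. ennreal (f t) \<partial>Q) + ennreal \<epsilon> * ennreal b"
    unfolding layer[OF Q assms(4)] using b
    by (subst nn_integral_add) (auto simp: nn_integral_cmult_indicator)
  finally show ?thesis using b \<epsilon> by (simp add: ennreal_mult mult.commute)
qed

text \<open>Where \<open>t\<^sup>2 \<le> S\<close> the function is bounded by \<open>b * S\<close>;
  beyond that it is at most \<open>b / S * t ^ 4\<close>. Only the tail under \<open>P\<close> has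
  to be paid for, because truncation merely lowers the integral under \<open>Q\<close>.\<close>

lemma nn_integral_quadratic_le:
  fixes f :: "real \<Rightarrow> real"
  assumes P: "prob_space P" and Q: "prob_space Q"
    and [simp, measurable_cong]: "sets P = sets borel" "sets Q = sets borel"
    and le: "\<And>A. A \<in> sets borel \<Longrightarrow> measure P A \<le> measure Q A + \<epsilon>"
    and P4: "(\<integral>\<^sup>+t. ennreal (t ^ 4) \<partial>P) \<le> ennreal (16 * \<kappa> ^ 4)"
    and [measurable]: "f \<in> borel_measurable borel" and f: "\<And>t. 0 \<le> f t" "\<And>t. f t \<le> b * t\<^sup>2"
    and b: "b \<ge> 0" and \<epsilon>: "\<epsilon> > 0" and \<kappa>: "\<kappa> > 0"
  shows "(\<integral>\<^sup>+t. ennreal (f t) \<partial>P) \<le> (\<integral>\<^sup>+t. ennreal (f t) \<partial>Q) + ennreal (8 * b * \<kappa>\<^sup>2 * sqrt \<epsilon>)"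
proof -
  \<comment> \<open>This level makes the truncation error \<open>b * S * \<epsilon>\<close> and the
    tail error \<open>b / S * (16 * \<kappa> ^ 4)\<close> equal; each is
    \<open>4 * b * \<kappa>\<^sup>2 * sqrt \<epsilon>\<close>.\<close>
  define S where "S = 4 * \<kappa>\<^sup>2 / sqrt \<epsilon>"
  have S: "S > 0" using \<epsilon> \<kappa> by (simp add: S_def)
  define g where "g t = (if t\<^sup>2 \<le> S then f t else 0)" for t
  have [measurable]: "g \<in> borel_measurable borel" unfolding g_def by measurable
  have g: "0 \<le> g t" "g t \<le> b * S" for t
    using f[of t] b S mult_left_mono[of "t\<^sup>2" S b] by (auto simp: g_def)
  have "(\<integral>\<^sup>+t. ennreal (f t) \<partial>P) \<le> (\<integral>\<^sup>+t. ennreal (g t) + ennreal (b / S) * ennreal (t ^ 4) \<partial>P)"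
  proof (rule nn_integral_mono)
    fix t
    have "f t \<le> g t + b / S * t ^ 4"
    proof (cases "t\<^sup>2 \<le> S")
      case False
      then have "b * t\<^sup>2 * S \<le> b * t\<^sup>2 * t\<^sup>2" using b by (intro mult_left_mono) auto
      then have "b * t\<^sup>2 \<le> b / S * t ^ 4" using S by (simp add: field_simps)
      then show ?thesis using f(2)[of t] False by (simp add: g_def)
    qed (use b S in \<open>simp add: g_def\<close>)
    then show "ennreal (f t) \<le> ennreal (g t) + ennreal (b / S) * ennreal (t ^ 4)"
      using b S g(1)[of t] by (simp add: ennreal_mult[symmetric] ennreal_plus[symmetric] ennreal_leI del: ennreal_plus)
  qed
  also have "\<dots> = (\<integral>\<^sup>+t. ennreal (g t) \<partial>P) + ennreal (b / S) * (\<integral>\<^sup>+t. ennreal (t ^ 4) \<partial>P)"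
    by (simp add: nn_integral_add nn_integral_cmult)
  also have "\<dots> \<le> ((\<integral>\<^sup>+t. ennreal (g t) \<partial>Q) + ennreal (b * S * \<epsilon>)) + ennreal (b / S) * ennreal (16 * \<kappa> ^ 4)"
    using b S \<epsilon> by (intro add_mono mult_left_mono P4 nn_integral_bounded_le assms g) auto
  also have "\<dots> = (\<integral>\<^sup>+t. ennreal (g t) \<partial>Q) + ennreal (b * S * \<epsilon> + b / S * (16 * \<kappa> ^ 4))"
  proof -
    have "ennreal (b / S) * ennreal (16 * \<kappa> ^ 4) = ennreal (b / S * (16 * \<kappa> ^ 4))"
      using b S \<kappa> by (intro ennreal_mult[symmetric]) auto
    then show ?thesis using b S \<epsilon> \<kappa> by (subst ennreal_plus) (simp_all add: add.assoc)
  qed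
  also have "b * S * \<epsilon> + b / S * (16 * \<kappa> ^ 4) = 8 * b * \<kappa>\<^sup>2 * sqrt \<epsilon>"
  proof -
    have "S * \<epsilon> = 4 * \<kappa>\<^sup>2 * sqrt \<epsilon>" using \<epsilon> by (simp add: S_def field_simps real_sqrt_mult_self)
    moreover have "16 * \<kappa> ^ 4 / S = 4 * \<kappa>\<^sup>2 * sqrt \<epsilon>" using \<epsilon> \<kappa> by (simp add: S_def field_simps power2_eq_square power4_eq_xxxx)
    moreover have "b * S * \<epsilon> = b * (S * \<epsilon>)" "b / S * (16 * \<kappa> ^ 4) = b * (16 * \<kappa> ^ 4 / S)" by simp_all
    ultimately show ?thesis by (simp only:)
  qed
  also have "(\<integral>\<^sup>+t. ennreal (g t) \<partial>Q) \<le> (\<integral>\<^sup>+t. ennreal (f t) \<partial>Q)"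
    using f(1) by (intro nn_integral_mono ennreal_leI) (auto simp: g_def)
  finally show ?thesis by (simp add: add_right_mono)
qed

text \<open>\<open>F s\<close> is the modulus of the complex number with real part \<open>h\<close>
  and imaginary part \<open>s\<close>, so the first bound is the triangle inequality. The second
  adds two tangent estimates for the square root, whose linear terms cancel, and uses
  \<open>F c \<ge> h\<close>.\<close>

lemma sqrt_smooth_abs_bounds:
  fixes h c y :: real
  assumes h: "h > 0"
  defines "F \<equiv> \<lambda>s. sqrt (h\<^sup>2 + s\<^sup>2)"
  shows "2 * F c \<le> F (c + y) + F (c - y)" "F (c + y) + F (c - y) \<le> 2 * F c + y\<^sup>2 / h"
proof -
  have "2 * F c = norm (Complex h (c + y) + Complex h (c - y))"
  proof -
    have "Complex h (c + y) + Complex h (c - y) = of_real 2 * Complex h c" by (simp add: complex_eq_iff)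
    then show ?thesis by (simp only: norm_mult) (simp add: F_def complex_norm)
  qed
  also have "\<dots> \<le> norm (Complex h (c + y)) + norm (Complex h (c - y))" by (rule norm_triangle_ineq)
  finally show "2 * F c \<le> F (c + y) + F (c - y)" by (simp add: F_def complex_norm)
  have Fc: "F c \<ge> h" unfolding F_def using h by (intro real_le_rsqrt) simp
  have tangent: "F s \<le> F c + (s\<^sup>2 - c\<^sup>2) / (2 * F c)" for s
  proof -
    have "2 * F c * F s \<le> (F c)\<^sup>2 + (F s)\<^sup>2" using sum_squares_bound[of "F c" "F s"] by simp
    also have "\<dots> = 2 * (F c)\<^sup>2 + (s\<^sup>2 - c\<^sup>2)" by (simp add: F_def)
    finally show ?thesis using Fc h by (simp add: field_simps power2_eq_square)
  qed
  have "F (c + y) + F (c - y) \<le> 2 * F c + ((c + y)\<^sup>2 - c\<^sup>2) / (2 * F c) + ((c - y)\<^sup>2 - c\<^sup>2) / (2 * F c)"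
    using tangent[of "c + y"] tangent[of "c - y"] by simp
  also have "\<dots> = 2 * F c + y\<^sup>2 / F c"
    using Fc h by (simp add: field_simps power2_eq_square)
  also have "\<dots> \<le> 2 * F c + y\<^sup>2 / h" using Fc h by (simp add: frac_le)
  finally show "F (c + y) + F (c - y) \<le> 2 * F c + y\<^sup>2 / h" .
qed

text \<open>Symmetry of the laws removes the part odd in \<open>t\<close>. What remains is half a
  second difference, lying between 0 and \<open>u\<^sup>2 / (2 * h) * t\<^sup>2\<close>, so the
  quadratic comparison applies and its error is proportional to \<open>u\<^sup>2\<close>.\<close>

lemma nn_integral_sqrt_smooth_abs_le:
  assumes P: "prob_space P" and Q: "prob_space Q"
    and [simp, measurable_cong]: "sets P = sets borel" "sets Q = sets borel"
    and symP: "\<And>g :: real \<Rightarrow> ennreal. g \<in> borel_measurable borel \<Longrightarrow> (\<integral>\<^sup>+x. g (- x) \<partial>P) = (\<integral>\<^sup>+x. g x \<partial>P)"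
    and symQ: "\<And>g :: real \<Rightarrow> ennreal. g \<in> borel_measurable borel \<Longrightarrow> (\<integral>\<^sup>+x. g (- x) \<partial>Q) = (\<integral>\<^sup>+x. g x \<partial>Q)"
    and le: "\<And>A. A \<in> sets borel \<Longrightarrow> measure P A \<le> measure Q A + \<epsilon>"
    and P4: "(\<integral>\<^sup>+t. ennreal (t ^ 4) \<partial>P) \<le> ennreal (16 * \<kappa> ^ 4)"
    and h: "h > 0" and \<epsilon>: "\<epsilon> > 0" and \<kappa>: "\<kappa> > 0"
  shows "(\<integral>\<^sup>+t. ennreal (sqrt (h\<^sup>2 + (c + u * t)\<^sup>2)) \<partial>P) \<le>
    (\<integral>\<^sup>+t. ennreal (sqrt (h\<^sup>2 + (c + u * t)\<^sup>2)) \<partial>Q) + ennreal (4 * u\<^sup>2 * \<kappa>\<^sup>2 * sqrt \<epsilon> / h)"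
proof -
  interpret P: prob_space P by fact
  interpret Q: prob_space Q by fact
  define F where "F s = sqrt (h\<^sup>2 + s\<^sup>2)" for s
  have [measurable]: "F \<in> borel_measurable borel" unfolding F_def by measurable
  have F_pos: "F s \<ge> 0" for s by (simp add: F_def)
  define \<psi> where "\<psi> t = (F (c + u * t) + F (c - u * t)) / 2 - F c" for t
  have [measurable]: "\<psi> \<in> borel_measurable borel" unfolding \<psi>_def by measurable
  have \<psi>_pos: "\<psi> t \<ge> 0" for t
    using sqrt_smooth_abs_bounds(1)[OF h, of c "u * t"] by (simp add: \<psi>_def F_def)
  have \<psi>_le: "\<psi> t \<le> u\<^sup>2 / (2 * h) * t\<^sup>2" for t
    using sqrt_smooth_abs_bounds(2)[OF h, of c "u * t"] by (simp add: \<psi>_def F_def field_simps)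
  have split: "(\<integral>\<^sup>+t. ennreal (F (c + u * t)) \<partial>M) = (\<integral>\<^sup>+t. ennreal (\<psi> t) \<partial>M) + ennreal (F c)"
    if "prob_space M" and setsM: "sets M = sets borel"
      and sym: "\<And>g :: real \<Rightarrow> ennreal. g \<in> borel_measurable borel \<Longrightarrow> (\<integral>\<^sup>+x. g (- x) \<partial>M) = (\<integral>\<^sup>+x. g x \<partial>M)"
    for M :: "real measure"
  proof -
    note setsM[simp, measurable_cong]
    interpret M: prob_space M by fact
    have "(\<integral>\<^sup>+t. ennreal (F (c + u * t)) \<partial>M) = (\<integral>\<^sup>+t. ennreal ((F (c + u * t) + F (c + u * (- t))) / 2) \<partial>M)"
      using F_pos by (intro nn_integral_even_part[symmetric] sym) auto
    also have "\<dots> = (\<integral>\<^sup>+t. ennreal (\<psi> t) + ennreal (F c) \<partial>M)"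
      using \<psi>_pos F_pos by (intro nn_integral_cong, subst ennreal_plus[symmetric]) (auto simp: \<psi>_def)
    also have "\<dots> = (\<integral>\<^sup>+t. ennreal (\<psi> t) \<partial>M) + ennreal (F c)"
      by (subst nn_integral_add) (auto simp: M.emeasure_space_1)
    finally show ?thesis .
  qed
  have "(\<integral>\<^sup>+t. ennreal (\<psi> t) \<partial>P) \<le> (\<integral>\<^sup>+t. ennreal (\<psi> t) \<partial>Q) + ennreal (8 * (u\<^sup>2 / (2 * h)) * \<kappa>\<^sup>2 * sqrt \<epsilon>)"
    using h by (intro nn_integral_quadratic_le assms \<psi>_pos \<psi>_le) auto
  also have "8 * (u\<^sup>2 / (2 * h)) * \<kappa>\<^sup>2 * sqrt \<epsilon> = 4 * u\<^sup>2 * \<kappa>\<^sup>2 * sqrt \<epsilon> / h" by simp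
  finally have le': "(\<integral>\<^sup>+t. ennreal (\<psi> t) \<partial>P) \<le> (\<integral>\<^sup>+t. ennreal (\<psi> t) \<partial>Q) + ennreal (4 * u\<^sup>2 * \<kappa>\<^sup>2 * sqrt \<epsilon> / h)" .
  have "(\<integral>\<^sup>+t. ennreal (\<psi> t) \<partial>P) + ennreal (F c) \<le> (\<integral>\<^sup>+t. ennreal (\<psi> t) \<partial>Q) + ennreal (F c) + ennreal (4 * u\<^sup>2 * \<kappa>\<^sup>2 * sqrt \<epsilon> / h)"
    using add_right_mono[OF le', of "ennreal (F c)"] by (simp only: ac_simps)
  then show ?thesis
    unfolding F_def[symmetric] by (simp add: split P Q symP symQ)
qed

lemma ip_restrict: "ip n (restrict a {..<n}) u = ip n a u"
  unfolding ip_def by (rule sum.cong) auto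

text \<open>Since \<open>F s\<close> dominates the absolute value, smoothing is free on the side of
  \<open>P\<close> and costs \<open>h\<close> on the side of \<open>Q\<close>; the exchange errors
  sum to \<open>4 * \<kappa>\<^sup>2 * sqrt \<epsilon> / h\<close>. The statement is one-sided with
  symmetric assumptions on the two laws, so the reverse estimate follows by swapping them.\<close>

lemma nn_integral_abs_ip_le:
  assumes P: "prob_space P" and Q: "prob_space Q"
    and sets[simp, measurable_cong]: "sets P = sets borel" "sets Q = sets borel"
    and symP: "\<And>g :: real \<Rightarrow> ennreal. g \<in> borel_measurable borel \<Longrightarrow> (\<integral>\<^sup>+x. g (- x) \<partial>P) = (\<integral>\<^sup>+x. g x \<partial>P)"
    and symQ: "\<And>g :: real \<Rightarrow> ennreal. g \<in> borel_measurable borel \<Longrightarrow> (\<integral>\<^sup>+x. g (- x) \<partial>Q) = (\<integral>\<^sup>+x. g x \<partial>Q)"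
    and le: "\<And>A. A \<in> sets borel \<Longrightarrow> measure P A \<le> measure Q A + \<epsilon>"
    and P4: "(\<integral>\<^sup>+t. ennreal (t ^ 4) \<partial>P) \<le> ennreal (16 * \<kappa> ^ 4)"
    and \<epsilon>: "\<epsilon> > 0" and \<kappa>: "\<kappa> > 0" and u: "nrm n u = 1"
  shows "(\<integral>\<^sup>+a. ennreal \<bar>ip n a u\<bar> \<partial>PiM {..<n} (\<lambda>_. P)) \<le>
    (\<integral>\<^sup>+a. ennreal \<bar>ip n a u\<bar> \<partial>PiM {..<n} (\<lambda>_. Q)) + ennreal (4 * \<kappa> * \<epsilon> powr (1/4))"
proof -
  interpret PQ: prob_space "PiM {..<n} (\<lambda>_. Q)" by (intro prob_space_PiM Q)
  \<comment> \<open>With this value the total exchange error equals the smoothing error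
    \<open>h\<close>, so the two together give \<open>2 * h\<close>.\<close>
  define h where "h = 2 * \<kappa> * \<epsilon> powr (1/4)"
  have h: "h > 0" using \<epsilon> \<kappa> by (simp add: h_def)
  define F where "F s = sqrt (h\<^sup>2 + s\<^sup>2)" for s
  have [measurable]: "F \<in> borel_measurable borel" unfolding F_def by measurable
  have F_ge: "\<bar>s\<bar> \<le> F s" for s unfolding F_def by (rule real_le_rsqrt) simp
  have F_le: "F s \<le> \<bar>s\<bar> + h" for s
    unfolding F_def using h sqrt_sum_squares_le_sum[of h "\<bar>s\<bar>"] by simp
  have F_le': "ennreal (F s) \<le> ennreal \<bar>s\<bar> + ennreal h" for s
  proof -
    have "ennreal (F s) \<le> ennreal (\<bar>s\<bar> + h)" by (rule ennreal_leI) (rule F_le)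
    then show ?thesis using h by simp
  qed
  have ip_upd: "ip n (x(i := t)) u = ip n (x(i := 0)) u + u i * t" if "i < n" for i x t
    using that unfolding ip_def
    by (subst (1 2) sum.remove[of _ i]) (auto intro!: sum.cong)
  have ipm[measurable]: "(\<lambda>x. ip n x u) \<in> borel_measurable (PiM {..<n} (\<lambda>_. borel))"
    by (intro borel_measurable_ip borel_measurable_component) auto
  have sum_err: "(\<Sum>i<n. ennreal (4 * (u i)\<^sup>2 * \<kappa>\<^sup>2 * sqrt \<epsilon> / h)) = ennreal h"
  proof -
    have "(\<Sum>i<n. (u i)\<^sup>2) = 1" using u by (simp add: nrm_def)
    then have "(\<Sum>i<n. 4 * (u i)\<^sup>2 * \<kappa>\<^sup>2 * sqrt \<epsilon> / h) = 4 * \<kappa>\<^sup>2 * sqrt \<epsilon> / h"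
      by (simp add: sum_divide_distrib[symmetric] sum_distrib_left[symmetric] sum_distrib_right[symmetric])
    also have "\<dots> = h"
    proof -
      have "sqrt \<epsilon> = (\<epsilon> powr (1/4))\<^sup>2"
        using \<epsilon> by (simp add: powr_half_sqrt[symmetric] power2_eq_square powr_add[symmetric])
      then show ?thesis using h by (simp add: h_def power2_eq_square)
    qed
    finally show ?thesis using h \<epsilon> by (subst sum_ennreal) auto
  qed
  have "(\<integral>\<^sup>+a. ennreal \<bar>ip n a u\<bar> \<partial>PiM {..<n} (\<lambda>_. P)) \<le> (\<integral>\<^sup>+a. ennreal (F (ip n (\<lambda>i\<in>{..<n}. a i) u)) \<partial>PiM {..<n} (\<lambda>_. P))"
    unfolding ip_restrict by (intro nn_integral_mono ennreal_leI F_ge)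
  also have "\<dots> \<le> (\<integral>\<^sup>+a. ennreal (F (ip n (\<lambda>i\<in>{..<n}. a i) u)) \<partial>PiM {..<n} (\<lambda>_. Q)) + (\<Sum>i<n. ennreal (4 * (u i)\<^sup>2 * \<kappa>\<^sup>2 * sqrt \<epsilon> / h))"
  proof (rule nn_integral_PiM_le[where K=borel and f="\<lambda>x. ennreal (F (ip n x u))" and X="\<lambda>t. t" and Y="\<lambda>t. t"])
    fix i x assume "i \<in> {..<n}"
    then have eq: "ip n (x(i := t)) u = ip n (x(i := 0)) u + u i * t" for t
      by (intro ip_upd) simp
    show "(\<integral>\<^sup>+t. ennreal (F (ip n (x(i := t)) u)) \<partial>P) \<le> (\<integral>\<^sup>+t. ennreal (F (ip n (x(i := t)) u)) \<partial>Q) + ennreal (4 * (u i)\<^sup>2 * \<kappa>\<^sup>2 * sqrt \<epsilon> / h)"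
      using nn_integral_sqrt_smooth_abs_le[OF P Q sets symP symQ le P4 h \<epsilon> \<kappa>, of "ip n (x(i := 0)) u" "u i"]
      by (simp only: eq[symmetric] F_def[symmetric])
  qed (use P Q in auto)
  also have "\<dots> \<le> (\<integral>\<^sup>+a. ennreal \<bar>ip n a u\<bar> + ennreal h \<partial>PiM {..<n} (\<lambda>_. Q)) + ennreal h"
    unfolding sum_err ip_restrict by (intro add_right_mono nn_integral_mono F_le')
  also have "\<dots> = (\<integral>\<^sup>+a. ennreal \<bar>ip n a u\<bar> \<partial>PiM {..<n} (\<lambda>_. Q)) + (ennreal h + ennreal h)"
    by (subst nn_integral_add) (auto simp: PQ.emeasure_space_1 add.assoc intro!: borel_measurable_ip borel_measurable_component)
  also have "ennreal h + ennreal h = ennreal (4 * \<kappa> * \<epsilon> powr (1/4))"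
    using h by (simp add: ennreal_plus[symmetric] h_def del: ennreal_plus)
  finally show ?thesis .
qed

section \<open>Exponential moments of support functions\<close>

lemma exp_midpoint: "exp ((a + b) / 2) \<le> (exp a + exp b) / (2 :: real)"
proof -
  have "0 \<le> (exp (a / 2) - exp (b / 2))\<^sup>2" by simp
  also have "\<dots> = exp a + exp b - 2 * exp ((a + b) / 2)"
    by (simp add: power2_eq_square algebra_simps exp_add[symmetric] add_divide_distrib)
  finally show ?thesis by simp
qed

text \<open>The exponential lies above its tangent at the mean. If the right-hand side is infinite
  there is nothing to show, so only integrability of \<open>X\<close> itself is assumed.\<close>

lemma (in prob_space) jensen_exp:
  fixes X :: "'a \<Rightarrow> real"
  assumes X: "integrable M X"
  shows "ennreal (exp (expectation X)) \<le> (\<integral>\<^sup>+\<omega>. ennreal (exp (X \<omega>)) \<partial>M)"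
proof (cases "(\<integral>\<^sup>+\<omega>. ennreal (exp (X \<omega>)) \<partial>M) = \<infinity>")
  case False
  have [measurable]: "X \<in> borel_measurable M" using X by simp
  have int: "integrable M (\<lambda>\<omega>. exp (X \<omega>))"
    using False by (intro integrableI_nonneg) (auto simp: top.not_eq_extremum)
  define e where "e = expectation X"
  have "expectation (\<lambda>\<omega>. exp e * (1 + (X \<omega> - e))) \<le> expectation (\<lambda>\<omega>. exp (X \<omega>))"
  proof (rule integral_mono)
    show "exp e * (1 + (X \<omega> - e)) \<le> exp (X \<omega>)" for \<omega>
    proof -
      have "exp e * (1 + (X \<omega> - e)) \<le> exp e * exp (X \<omega> - e)" by (intro mult_left_mono exp_ge_add_one_self) auto
      then show ?thesis by (simp add: exp_add[symmetric])
    qed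
  qed (use X int in auto)
  also have "expectation (\<lambda>\<omega>. exp e * (1 + (X \<omega> - e))) = exp e"
    using X by (simp add: prob_space e_def)
  finally show ?thesis
    using int by (subst nn_integral_eq_integral) (auto simp: e_def intro: ennreal_leI)
qed simp

lemma integrable_PiM_component_abs:
  assumes D: "prob_space D" and sets: "sets D = sets borel" and int: "integrable D (\<lambda>t. \<bar>t\<bar> :: real)" and j: "j \<in> I"
  shows "integrable (PiM I (\<lambda>_. D)) (\<lambda>g. \<bar>g j\<bar>)"
proof -
  have "integrable (distr (PiM I (\<lambda>_. D)) D (\<lambda>g. g j)) (\<lambda>t. \<bar>t\<bar>)"
    using distr_PiM_component[of I "\<lambda>_. D" j] D j int by simp
  then show ?thesis
    using j sets by (subst (asm) integrable_distr_eq) (auto simp: measurable_cong_sets[OF sets refl])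
qed

lemma integrable_gauss1_abs: "integrable gauss1 (\<lambda>t. \<bar>t\<bar>)"
  using nn_integral_gauss1_abs by (intro integrableI_nonneg) (auto simp: gauss1_def)

text \<open>For \<open>U\<close> the difference set of \<open>K\<close> this is the integrand of
  \<open>gwidth\<close>. The supremum is taken in the reals, so it carries information only for
  nonempty \<open>U\<close> with bounded inner products; \<open>bounded_index\<close> supplies
  both.\<close>

definition support_fun :: "nat \<Rightarrow> (nat \<Rightarrow> real) set \<Rightarrow> (nat \<Rightarrow> real) \<Rightarrow> real" where
  "support_fun n U c = (SUP u\<in>U. ip n c u)"

section \<open>Calculus and measurability of the support function\<close>

lemma ip_cong: "(\<And>j. j < n \<Longrightarrow> c j = d j) \<Longrightarrow> ip n c u = ip n d u"
  unfolding ip_def by (intro sum.cong) auto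

lemma ip_combination: "ip n (\<lambda>j. a * c j + b * d j) u = a * ip n c u + b * ip n d u"
  unfolding ip_def by (simp add: sum.distrib sum_distrib_left algebra_simps)

lemma abs_coordinate_le_nrm: "j < n \<Longrightarrow> \<bar>u j\<bar> \<le> nrm n u"
  unfolding nrm_def using member_le_sum[of j "{..<n}" "\<lambda>j. (u j)\<^sup>2"]
  by (intro real_le_rsqrt) auto

locale bounded_index =
  fixes n :: nat and U :: "(nat \<Rightarrow> real) set"
  assumes nonempty: "U \<noteq> {}" and bounded: "u \<in> U \<Longrightarrow> nrm n u \<le> 2"
begin

abbreviation h :: "(nat \<Rightarrow> real) \<Rightarrow> real" where "h \<equiv> support_fun n U"

lemma abs_ip_le: "u \<in> U \<Longrightarrow> \<bar>ip n c u\<bar> \<le> 2 * (\<Sum>j<n. \<bar>c j\<bar>)"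
proof -
  assume u: "u \<in> U"
  have "\<bar>ip n c u\<bar> \<le> (\<Sum>j<n. \<bar>c j * u j\<bar>)" unfolding ip_def by (rule sum_abs)
  also have "\<dots> \<le> (\<Sum>j<n. 2 * \<bar>c j\<bar>)"
  proof (rule sum_mono)
    fix j assume "j \<in> {..<n}"
    then have "\<bar>u j\<bar> \<le> 2" using abs_coordinate_le_nrm[of j n u] bounded[OF u] by simp
    then show "\<bar>c j * u j\<bar> \<le> 2 * \<bar>c j\<bar>" by (simp add: abs_mult mult_left_mono mult.commute)
  qed
  finally show ?thesis by (simp add: sum_distrib_left)
qed

lemma support_fun_upper: "u \<in> U \<Longrightarrow> ip n c u \<le> h c"
  unfolding support_fun_def
  by (rule cSUP_upper) (auto intro!: bdd_aboveI[of _ "2 * (\<Sum>j<n. \<bar>c j\<bar>)"] dest: abs_ip_le[of _ c])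

lemma support_fun_least: "(\<And>u. u \<in> U \<Longrightarrow> ip n c u \<le> B) \<Longrightarrow> h c \<le> B"
  unfolding support_fun_def using nonempty by (rule cSUP_least)

lemma abs_support_fun_le: "\<bar>h c\<bar> \<le> 2 * (\<Sum>j<n. \<bar>c j\<bar>)"
proof -
  obtain u where u: "u \<in> U" using nonempty by auto
  have "h c \<le> 2 * (\<Sum>j<n. \<bar>c j\<bar>)" using abs_ip_le[of _ c] by (intro support_fun_least) (auto simp: abs_le_iff)
  moreover have "- (2 * (\<Sum>j<n. \<bar>c j\<bar>)) \<le> h c"
    using abs_ip_le[OF u, of c] support_fun_upper[OF u, of c] by linarith
  ultimately show ?thesis by linarith
qed

lemma support_fun_cong: "(\<And>j. j < n \<Longrightarrow> c j = d j) \<Longrightarrow> h c = h d"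
  unfolding support_fun_def by (intro SUP_cong ip_cong) auto

lemma support_fun_combination:
  "a \<ge> 0 \<Longrightarrow> b \<ge> 0 \<Longrightarrow> h (\<lambda>j. a * c j + b * d j) \<le> a * h c + b * h d"
  by (intro support_fun_least) (simp add: ip_combination add_mono mult_left_mono support_fun_upper)

lemma support_fun_scale:
  assumes "a > 0"
  shows "h (\<lambda>j. a * c j) = a * h c"
proof (rule antisym)
  show "h (\<lambda>j. a * c j) \<le> a * h c"
    using support_fun_combination[of a 0 c c] assms by simp
  have "h (\<lambda>j. (1 / a) * (a * c j)) \<le> (1 / a) * h (\<lambda>j. a * c j)"
    using support_fun_combination[of "1 / a" 0 "\<lambda>j. a * c j" c] assms by simp
  then show "a * h c \<le> h (\<lambda>j. a * c j)" using assms by (simp add: field_simps)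
qed

lemma support_fun_lipschitz: "h c \<le> h d + 2 * (\<Sum>j<n. \<bar>c j - d j\<bar>)"
proof -
  have "h c = h (\<lambda>j. 1 * d j + 1 * (c j - d j))" by simp
  also have "\<dots> \<le> h d + h (\<lambda>j. c j - d j)" using support_fun_combination[of 1 1 d "\<lambda>j. c j - d j"] by simp
  also have "h (\<lambda>j. c j - d j) \<le> 2 * (\<Sum>j<n. \<bar>c j - d j\<bar>)" using abs_support_fun_le[of "\<lambda>j. c j - d j"] by simp
  finally show ?thesis by simp
qed

text \<open>\<open>U\<close> may be uncountable and arbitrary, so measurability of the supremum
  cannot be read off from its members. It follows from continuity, which holds because the function
  is Lipschitz in finitely many coordinates and these are continuous in the product
  topology.\<close>

lemma continuous_on_support_fun: "continuous_on UNIV h"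
proof -
  have "(h \<longlongrightarrow> h c) (at c)" for c
  proof (rule LIM_zero_cancel, rule Lim_null_comparison)
    show "\<forall>\<^sub>F d in at c. norm (h d - h c) \<le> 2 * (\<Sum>j<n. \<bar>d j - c j\<bar>)"
    proof (intro always_eventually allI)
      fix d
      have "(\<Sum>j<n. \<bar>d j - c j\<bar>) = (\<Sum>j<n. \<bar>c j - d j\<bar>)" by (intro sum.cong) auto
      then show "norm (h d - h c) \<le> 2 * (\<Sum>j<n. \<bar>d j - c j\<bar>)"
        using support_fun_lipschitz[of c d] support_fun_lipschitz[of d c] by (simp add: abs_le_iff)
    qed
    have "((\<lambda>d. d j) \<longlongrightarrow> c j) (at c)" for j
    proof -
      have "continuous_on UNIV (\<lambda>d :: nat \<Rightarrow> real. d j)" by (rule continuous_on_product_coordinates)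
      then show ?thesis by (simp add: continuous_on_def)
    qed
    then have "((\<lambda>d. 2 * (\<Sum>j<n. \<bar>d j - c j\<bar>)) \<longlongrightarrow> 2 * (\<Sum>j<n. \<bar>c j - c j\<bar>)) (at c)"
      by (intro tendsto_intros)
    then show "((\<lambda>d. 2 * (\<Sum>j<n. \<bar>d j - c j\<bar>)) \<longlongrightarrow> 0) (at c)" by simp
  qed
  then show ?thesis by (simp add: continuous_on_def)
qed

lemma borel_measurable_support_fun:
  assumes "\<And>j. j < n \<Longrightarrow> (\<lambda>\<omega>. f \<omega> j) \<in> borel_measurable M"
  shows "(\<lambda>\<omega>. h (f \<omega>)) \<in> borel_measurable M"
proof -
  \<comment> \<open>Coordinates from \<open>n\<close> on may be non-measurable in
    \<open>\<omega>\<close>; setting them to zero makes the whole map measurable and leaves the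
    support function unchanged.\<close>
  define g where "g \<omega> j = (if j < n then f \<omega> j else 0)" for \<omega> j
  have "g \<in> measurable M borel"
  proof (rule measurable_coordinatewise_then_product)
    show "(\<lambda>\<omega>. g \<omega> j) \<in> borel_measurable M" for j
      using assms by (cases "j < n") (auto simp: g_def)
  qed
  then have "(\<lambda>\<omega>. h (g \<omega>)) \<in> borel_measurable M"
    by (rule measurable_compose) (rule borel_measurable_continuous_onI[OF continuous_on_support_fun])
  also have "(\<lambda>\<omega>. h (g \<omega>)) = (\<lambda>\<omega>. h (f \<omega>))"
    by (intro ext support_fun_cong) (simp add: g_def)
  finally show ?thesis .
qed

lemma integrable_support_fun_gauss: "integrable (PiM {..<n} (\<lambda>_. gauss1)) h"
proof (rule Bochner_Integration.integrable_bound)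
  show "integrable (PiM {..<n} (\<lambda>_. gauss1)) (\<lambda>g. 2 * (\<Sum>j<n. \<bar>g j\<bar>))"
    by (intro integrable_mult_right Bochner_Integration.integrable_sum integrable_PiM_component_abs prob_space_gauss1 integrable_gauss1_abs) auto
  show "h \<in> borel_measurable (PiM {..<n} (\<lambda>_. gauss1))"
    by (intro borel_measurable_support_fun[of "\<lambda>g. g"] borel_measurable_component) auto
qed (use abs_support_fun_le in auto)


text \<open>Take \<open>u\<close> nearly maximising at the fixed \<open>X\<close>. Then
  \<open>h\<close> at the new point is at least \<open>q * ip n X u + s * ip n Y u\<close>, so the
  exponent is essentially a linear functional of \<open>Y\<close>. This is a centred Gaussian with
  variance at most \<open>4 * (r * s)\<^sup>2\<close>, the norm of \<open>u\<close> being at most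
  2.\<close>

lemma nn_integral_exp_support_fun_step:
  assumes r: "r > 0" and q: "q > 0"
  shows "(\<integral>\<^sup>+Y. ennreal (exp (r * (q * h X - h (\<lambda>j. q * X j + s * Y j)))) \<partial>PiM {..<n} (\<lambda>_. gauss1))
     \<le> ennreal (exp (2 * (r * s)\<^sup>2))" (is "?L \<le> ?Q")
proof -
  let ?G = "PiM {..<n} (\<lambda>_. gauss1)"
  have comp: "(\<lambda>Y. Y j) \<in> borel_measurable ?G" if "j < n" for j
    using that by (intro borel_measurable_component) auto
  have [measurable]: "(\<lambda>Y. h (\<lambda>j. q * X j + s * Y j)) \<in> borel_measurable ?G"
    using comp by (intro borel_measurable_support_fun) auto
  have [measurable]: "(\<lambda>Y. ip n Y u) \<in> borel_measurable ?G" for u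
    using comp by (intro borel_measurable_ip) auto
  define I where "I = (\<integral>\<^sup>+Y. ennreal (exp (- r * h (\<lambda>j. q * X j + s * Y j))) \<partial>?G)"
  have le: "ennreal (exp (r * q * ip n X u)) * I \<le> ?Q" if u: "u \<in> U" for u
  proof -
    have "ennreal (exp (r * q * ip n X u)) * I
      = (\<integral>\<^sup>+Y. ennreal (exp (r * q * ip n X u)) * ennreal (exp (- r * h (\<lambda>j. q * X j + s * Y j))) \<partial>?G)"
      unfolding I_def by (rule nn_integral_cmult[symmetric]) measurable
    also have "\<dots> \<le> (\<integral>\<^sup>+Y. ennreal (exp ((- r * s) * ip n Y u)) \<partial>?G)"
    proof (rule nn_integral_mono)
      fix Y
      have "q * ip n X u + s * ip n Y u \<le> h (\<lambda>j. q * X j + s * Y j)"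
        using support_fun_upper[OF u, of "\<lambda>j. q * X j + s * Y j"] by (simp add: ip_combination)
      from mult_left_mono[OF this, of r] r
      have "exp (r * q * ip n X u + - r * h (\<lambda>j. q * X j + s * Y j)) \<le> exp ((- r * s) * ip n Y u)"
        by (simp add: algebra_simps)
      then show "ennreal (exp (r * q * ip n X u)) * ennreal (exp (- r * h (\<lambda>j. q * X j + s * Y j))) \<le> ennreal (exp ((- r * s) * ip n Y u))"
        by (subst ennreal_mult[symmetric]) (auto simp: exp_add[symmetric] intro: ennreal_leI)
    qed
    also have "\<dots> = (\<integral>\<^sup>+t. ennreal (exp ((- r * s * nrm n u) * t)) \<partial>gauss1)"
      using nn_integral_gauss_ip[of "\<lambda>z. ennreal (exp ((- r * s) * z))" n u] by (simp add: mult.assoc)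
    also have "\<dots> = ennreal (exp ((r * s * nrm n u)\<^sup>2 / 2))"
      by (subst nn_integral_gauss1_exp) simp
    also have "\<dots> \<le> ?Q"
    proof -
      have "(nrm n u)\<^sup>2 \<le> 2\<^sup>2" using bounded[OF u] by (intro power_mono) (auto simp: nrm_def sum_nonneg)
      from mult_left_mono[OF this, of "(r * s)\<^sup>2"] show ?thesis by (intro ennreal_leI) (simp add: power_mult_distrib)
    qed
    finally show ?thesis .
  qed
  \<comment> \<open>The supremum need not be attained. As \<open>I\<close> depends on no
    \<open>u\<close>, the bound is solved for \<open>ip n X u\<close> by logarithms, passed to the
    supremum and exponentiated again; this needs \<open>I\<close> finite and nonzero.\<close>
  have "ennreal (exp (r * q * h X)) * I \<le> ?Q"
  proof (cases "I = 0")
    case False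
    obtain u where "u \<in> U" using nonempty by auto
    from le[OF this] have "I \<noteq> \<top>" by (auto simp: ennreal_mult_top top_unique)
    then obtain i where i: "I = ennreal i" "i \<ge> 0" by (cases I) auto
    then have i0: "i > 0" using False by (cases "i = 0") auto
    have "ip n X u \<le> (2 * (r * s)\<^sup>2 - ln i) / (r * q)" if u: "u \<in> U" for u
    proof -
      have "exp (r * q * ip n X u) * i \<le> exp (2 * (r * s)\<^sup>2)"
        using le[OF u] i by (simp add: ennreal_mult[symmetric])
      then have "exp (r * q * ip n X u + ln i) \<le> exp (2 * (r * s)\<^sup>2)" using i0 by (simp add: exp_add)
      then show ?thesis using r q by (simp add: field_simps)
    qed
    then have "h X \<le> (2 * (r * s)\<^sup>2 - ln i) / (r * q)" by (rule support_fun_least)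
    then have "exp (r * q * h X + ln i) \<le> exp (2 * (r * s)\<^sup>2)" using r q by (simp add: field_simps)
    then show ?thesis using i i0 by (simp add: exp_add ennreal_mult[symmetric])
  qed simp
  moreover have "?L = ennreal (exp (r * q * h X)) * I"
    unfolding I_def
    by (subst nn_integral_cmult[symmetric], measurable)
      (auto intro!: nn_integral_cong simp: ennreal_mult[symmetric] exp_add[symmetric] algebra_simps)
  ultimately show ?thesis by simp
qed

text \<open>Comparing \<open>X\<close> with an independent copy \<open>Y\<close> bounds a product of
  two exponential moments. The one of \<open>- t * h Y\<close> is at least
  \<open>exp (- t * w)\<close> by Jensen, and dividing by it leaves the claim.\<close>

lemma nn_integral_exp_support_fun_gauss:
  assumes t: "t > 0"
  shows "(\<integral>\<^sup>+X. ennreal (exp (t / 2 * h X)) \<partial>PiM {..<n} (\<lambda>_. gauss1))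
     \<le> ennreal (exp (t * (\<integral>g. h g \<partial>PiM {..<n} (\<lambda>_. gauss1)) + 4 * t\<^sup>2))"
proof -
  let ?G = "PiM {..<n} (\<lambda>_. gauss1)"
  let ?B = "PiM {..<n} (\<lambda>_. borel :: real measure)"
  define q :: real where "q = 1 / sqrt 2"
  have q: "q > 0" "q * q = 1 / 2" "q\<^sup>2 + q\<^sup>2 = 1" by (auto simp: q_def power2_eq_square)
  define w where "w = (\<integral>g. h g \<partial>?G)"
  have compB: "(\<lambda>z. fst z j) \<in> borel_measurable (?B \<Otimes>\<^sub>M ?B)" "(\<lambda>z. snd z j) \<in> borel_measurable (?B \<Otimes>\<^sub>M ?B)"
    if "j < n" for j
    using that by (auto intro!: measurable_compose[OF measurable_fst] measurable_compose[OF measurable_snd])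
  have compG: "(\<lambda>z. fst z j) \<in> borel_measurable (?G \<Otimes>\<^sub>M ?G)" "(\<lambda>z. snd z j) \<in> borel_measurable (?G \<Otimes>\<^sub>M ?G)"
    if "j < n" for j
    using that by (auto intro!: measurable_compose[OF measurable_fst] measurable_compose[OF measurable_snd] borel_measurable_component)
  have [measurable]: "h \<in> borel_measurable ?G"
    using integrable_support_fun_gauss by simp
  define f where "f z = ennreal (exp (2 * t * (q * h (fst z) - h (\<lambda>j. q * fst z j + q * snd z j))))" for z
  have f[measurable]: "f \<in> borel_measurable (?B \<Otimes>\<^sub>M ?B)"
  proof -
    have [measurable]: "(\<lambda>z. h (fst z)) \<in> borel_measurable (?B \<Otimes>\<^sub>M ?B)"
      "(\<lambda>z. h (\<lambda>j. q * fst z j + q * snd z j)) \<in> borel_measurable (?B \<Otimes>\<^sub>M ?B)"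
      using compB by (auto intro!: borel_measurable_support_fun borel_measurable_add borel_measurable_times)
    show ?thesis unfolding f_def by measurable
  qed
  define f' where "f' z = ennreal (exp (2 * t * q * (q * h (fst z) - h (\<lambda>j. q * fst z j + q * snd z j))))" for z
  have [measurable]: "f' \<in> borel_measurable (?G \<Otimes>\<^sub>M ?G)"
  proof -
    have [measurable]: "(\<lambda>z. h (fst z)) \<in> borel_measurable (?G \<Otimes>\<^sub>M ?G)"
      "(\<lambda>z. h (\<lambda>j. q * fst z j + q * snd z j)) \<in> borel_measurable (?G \<Otimes>\<^sub>M ?G)"
      using compG by (auto intro!: borel_measurable_support_fun borel_measurable_add borel_measurable_times)
    show ?thesis unfolding f'_def by measurable
  qed
  \<comment> \<open>The second step read in rotated variables: from \<open>(X + Y) / sqrt 2\<close>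
    with fresh vector \<open>(Y - X) / sqrt 2\<close>. Their rotation by the same angle is
    \<open>Y\<close>, and rotation invariance turns the integral of \<open>f2\<close> into that of
    \<open>f\<close>.\<close>
  define f2 where "f2 z = f (\<lambda>j\<in>{..<n}. q * fst z j + q * snd z j, \<lambda>j\<in>{..<n}. q * snd z j - q * fst z j)" for z
  have [measurable]: "f2 \<in> borel_measurable (?G \<Otimes>\<^sub>M ?G)"
    unfolding f2_def using compG
    by (intro measurable_compose[OF _ f] measurable_Pair measurable_restrict borel_measurable_add borel_measurable_times borel_measurable_diff) auto
  have step: "(\<integral>\<^sup>+X. \<integral>\<^sup>+Y. ennreal (exp (r * (q * h X - h (\<lambda>j. q * X j + q * Y j)))) \<partial>?G \<partial>?G)
      \<le> ennreal (exp (4 * t\<^sup>2))" if r: "r > 0" "r \<le> 2 * t" for r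
  proof -
    have "2 * (r * q)\<^sup>2 = r\<^sup>2" using q(2) by (simp add: power2_eq_square)
    also have "\<dots> \<le> (2 * t)\<^sup>2" using r by (intro power_mono) auto
    finally have "exp (2 * (r * q)\<^sup>2) \<le> exp (4 * t\<^sup>2)" by (simp add: power_mult_distrib)
    then have "(\<integral>\<^sup>+Y. ennreal (exp (r * (q * h X - h (\<lambda>j. q * X j + q * Y j)))) \<partial>?G) \<le> ennreal (exp (4 * t\<^sup>2))" for X
      using nn_integral_exp_support_fun_step[OF r(1) q(1), of X q] by (meson order_trans ennreal_leI)
    then have "(\<integral>\<^sup>+X. \<integral>\<^sup>+Y. ennreal (exp (r * (q * h X - h (\<lambda>j. q * X j + q * Y j)))) \<partial>?G \<partial>?G)
      \<le> (\<integral>\<^sup>+X. ennreal (exp (4 * t\<^sup>2)) \<partial>?G)" by (intro nn_integral_mono)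
    then show ?thesis by (simp add: gauss1_PiM.emeasure_space_1)
  qed
  have "q \<le> 1" by (simp add: q_def)
  have "(\<integral>\<^sup>+X. \<integral>\<^sup>+Y. ennreal (exp (t / 2 * h X)) * ennreal (exp (- t * h Y)) \<partial>?G \<partial>?G)
    \<le> (\<integral>\<^sup>+X. \<integral>\<^sup>+Y. ennreal (1/2) * f' (X, Y) + ennreal (1/2) * f2 (X, Y) \<partial>?G \<partial>?G)"
  proof (intro nn_integral_mono)
    fix X Y :: "nat \<Rightarrow> real"
    define X1 where "X1 = (\<lambda>j. q * X j + q * Y j)"
    \<comment> \<open>The weights are chosen so that \<open>h X1\<close> cancels in
      \<open>a + b\<close>; the coefficient of \<open>h X\<close> becomes
      \<open>2 * t * (q * q)\<close>, that is \<open>t\<close>. The two steps share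
      \<open>X1\<close> and are dependent, so midpoint convexity of the exponential separates them
      at the price of doubling the exponents.\<close>
    define a where "a = 2 * t * q * (q * h X - h X1)"
    define b where "b = 2 * t * (q * h X1 - h Y)"
    have "a + b = 2 * t * (q * q) * h X - 2 * t * h Y"
      by (simp add: a_def b_def algebra_simps)
    then have ab: "(a + b) / 2 = t / 2 * h X - t * h Y" unfolding q(2) by simp
    have 1: "f' (X, Y) = ennreal (exp a)" by (simp add: f'_def a_def X1_def)
    have "h (\<lambda>j\<in>{..<n}. q * X j + q * Y j) = h X1" by (intro support_fun_cong) (simp add: X1_def)
    moreover have "h (\<lambda>j. q * (\<lambda>j\<in>{..<n}. q * X j + q * Y j) j + q * (\<lambda>j\<in>{..<n}. q * Y j - q * X j) j) = h Y"
    proof (rule support_fun_cong)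
      fix j assume "j < n"
      have "q * (q * X j + q * Y j) + q * (q * Y j - q * X j) = 2 * (q * q) * Y j" by (simp add: algebra_simps)
      then show "q * (\<lambda>j\<in>{..<n}. q * X j + q * Y j) j + q * (\<lambda>j\<in>{..<n}. q * Y j - q * X j) j = Y j"
        unfolding q(2) using \<open>j < n\<close> by simp
    qed
    ultimately have 2: "f2 (X, Y) = ennreal (exp b)" by (simp only: f2_def f_def b_def fst_conv snd_conv)
    have "ennreal (exp (t / 2 * h X)) * ennreal (exp (- t * h Y)) = ennreal (exp ((a + b) / 2))"
      unfolding ab by (subst ennreal_mult[symmetric]) (simp_all add: exp_add[symmetric])
    also have "\<dots> \<le> ennreal (1/2 * exp a + 1/2 * exp b)"
      using exp_midpoint[of a b] by (intro ennreal_leI) simp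
    also have "\<dots> = ennreal (1/2 * exp a) + ennreal (1/2 * exp b)"
      by (rule ennreal_plus) auto
    also have "\<dots> = ennreal (1/2) * f' (X, Y) + ennreal (1/2) * f2 (X, Y)"
      unfolding 1 2 by (intro arg_cong2[where f="(+)"] ennreal_mult) auto
    finally show "ennreal (exp (t / 2 * h X)) * ennreal (exp (- t * h Y)) \<le> ennreal (1/2) * f' (X, Y) + ennreal (1/2) * f2 (X, Y)" .
  qed
  also have "\<dots> = ennreal (1/2) * (\<integral>\<^sup>+X. \<integral>\<^sup>+Y. f' (X, Y) \<partial>?G \<partial>?G) + ennreal (1/2) * (\<integral>\<^sup>+X. \<integral>\<^sup>+Y. f2 (X, Y) \<partial>?G \<partial>?G)"
  proof -
    have "(\<integral>\<^sup>+X. \<integral>\<^sup>+Y. ennreal (1/2) * f' (X, Y) + ennreal (1/2) * f2 (X, Y) \<partial>?G \<partial>?G)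
      = (\<integral>\<^sup>+z. ennreal (1/2) * f' z + ennreal (1/2) * f2 z \<partial>(?G \<Otimes>\<^sub>M ?G))"
      by (rule gauss1_PiM.nn_integral_fst) measurable
    also have "\<dots> = ennreal (1/2) * (\<integral>\<^sup>+z. f' z \<partial>(?G \<Otimes>\<^sub>M ?G)) + ennreal (1/2) * (\<integral>\<^sup>+z. f2 z \<partial>(?G \<Otimes>\<^sub>M ?G))"
      by (subst nn_integral_add) (simp_all add: nn_integral_cmult)
    finally show ?thesis by (simp only: gauss1_PiM.nn_integral_fst \<open>f' \<in> _\<close> \<open>f2 \<in> _\<close>)
  qed
  also have "(\<integral>\<^sup>+X. \<integral>\<^sup>+Y. f2 (X, Y) \<partial>?G \<partial>?G) = (\<integral>\<^sup>+X. \<integral>\<^sup>+Y. f (X, Y) \<partial>?G \<partial>?G)"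
    unfolding f2_def fst_conv snd_conv
    by (rule nn_integral_PiM_gauss1_rotation[OF q(1) q(3) _ f]) simp
  also have "ennreal (1/2) * (\<integral>\<^sup>+X. \<integral>\<^sup>+Y. f' (X, Y) \<partial>?G \<partial>?G) + ennreal (1/2) * (\<integral>\<^sup>+X. \<integral>\<^sup>+Y. f (X, Y) \<partial>?G \<partial>?G)
    \<le> ennreal (1/2) * ennreal (exp (4 * t\<^sup>2)) + ennreal (1/2) * ennreal (exp (4 * t\<^sup>2))"
    unfolding f_def f'_def fst_conv snd_conv using t q \<open>q \<le> 1\<close>
    by (intro add_mono mult_left_mono step) auto
  also have "\<dots> = ennreal (exp (4 * t\<^sup>2))"
  proof -
    have "ennreal (1/2) + ennreal (1/2) = 1" by (subst ennreal_plus[symmetric]) auto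
    then show ?thesis by (simp only: distrib_right[symmetric] mult_1)
  qed
  also have "(\<integral>\<^sup>+X. \<integral>\<^sup>+Y. ennreal (exp (t / 2 * h X)) * ennreal (exp (- t * h Y)) \<partial>?G \<partial>?G)
    = (\<integral>\<^sup>+X. ennreal (exp (t / 2 * h X)) \<partial>?G) * (\<integral>\<^sup>+Y. ennreal (exp (- t * h Y)) \<partial>?G)"
    by (simp add: nn_integral_cmult nn_integral_multc)
  finally have prod: "(\<integral>\<^sup>+X. ennreal (exp (t / 2 * h X)) \<partial>?G) * (\<integral>\<^sup>+Y. ennreal (exp (- t * h Y)) \<partial>?G) \<le> ennreal (exp (4 * t\<^sup>2))" .
  have "ennreal (exp (- t * w)) \<le> (\<integral>\<^sup>+Y. ennreal (exp (- t * h Y)) \<partial>?G)"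
    using gauss1_PiM.jensen_exp[of "{..<n}" "\<lambda>Y. - t * h Y"] integrable_support_fun_gauss by (simp add: w_def)
  from order_trans[OF mult_left_mono[OF this] prod]
  have "(\<integral>\<^sup>+X. ennreal (exp (t / 2 * h X)) \<partial>?G) * ennreal (exp (- t * w)) \<le> ennreal (exp (4 * t\<^sup>2))" by simp
  from mult_right_mono[OF this, of "ennreal (exp (t * w))"]
  have "(\<integral>\<^sup>+X. ennreal (exp (t / 2 * h X)) \<partial>?G) * (ennreal (exp (- t * w)) * ennreal (exp (t * w))) \<le> ennreal (exp (4 * t\<^sup>2)) * ennreal (exp (t * w))"
    by (simp add: mult.assoc)
  also have "ennreal (exp (- t * w)) * ennreal (exp (t * w)) = 1"
    by (simp add: ennreal_mult[symmetric] exp_add[symmetric])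
  also have "ennreal (exp (4 * t\<^sup>2)) * ennreal (exp (t * w)) = ennreal (exp (t * w + 4 * t\<^sup>2))"
    by (simp add: ennreal_mult[symmetric] exp_add[symmetric] add.commute)
  finally show ?thesis by (simp add: w_def)
qed

end

lemma nn_integral_gauss_row_sum:
  fixes f :: "(nat \<Rightarrow> real) \<Rightarrow> ennreal"
  assumes "f \<in> borel_measurable (PiM {..<n} (\<lambda>_. borel))"
  shows "(\<integral>\<^sup>+r. f (\<lambda>j\<in>{..<n}. \<Sum>i<m. r i j) \<partial>PiM {..<m} (\<lambda>_. PiM {..<n} (\<lambda>_. gauss1)))
    = (\<integral>\<^sup>+g. f (\<lambda>j\<in>{..<n}. sqrt (real m) * g j) \<partial>PiM {..<n} (\<lambda>_. gauss1))"
  using assms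
proof (induction m arbitrary: f)
  case 0
  then show ?case by (simp add: PiM_empty nn_integral_count_space_finite gauss1_PiM.emeasure_space_1)
next
  case (Suc m)
  let ?G = "PiM {..<n} (\<lambda>_. gauss1)"
  let ?B = "PiM {..<n} (\<lambda>_. borel :: real measure)"
  note f[measurable] = Suc.prems
  interpret PG: product_prob_space "\<lambda>_ :: nat. ?G" "{..<Suc m}"
    by (rule product_prob_spaceI) (rule gauss1_PiM.prob_space_axioms)
  interpret GG: pair_sigma_finite ?G ?G ..
  have eq: "(\<lambda>j\<in>{..<n}. \<Sum>i<Suc m. (r(m := y)) i j) = (\<lambda>j\<in>{..<n}. (\<lambda>j\<in>{..<n}. \<Sum>i<m. r i j) j + y j)" for r and y :: "nat \<Rightarrow> real"
    by (auto simp: fun_eq_iff)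
  have "(\<integral>\<^sup>+r. f (\<lambda>j\<in>{..<n}. \<Sum>i<Suc m. r i j) \<partial>PiM {..<Suc m} (\<lambda>_. ?G))
    = (\<integral>\<^sup>+y. \<integral>\<^sup>+r. f (\<lambda>j\<in>{..<n}. \<Sum>i<Suc m. (r(m := y)) i j) \<partial>PiM {..<m} (\<lambda>_. ?G) \<partial>?G)"
    unfolding lessThan_Suc
  proof (rule PG.product_nn_integral_insert_rev)
    have "(\<lambda>r. r i j) \<in> borel_measurable (PiM (insert m {..<m}) (\<lambda>_. ?G))" if "i \<in> insert m {..<m}" "j < n" for i j
      using that by (intro measurable_compose[of "\<lambda>r. r i" _ ?G "\<lambda>g. g j"]) (auto intro: borel_measurable_component)
    then show "(\<lambda>r. f (\<lambda>j\<in>{..<n}. \<Sum>i\<in>insert m {..<m}. r i j)) \<in> borel_measurable (PiM (insert m {..<m}) (\<lambda>_. ?G))"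
      by (intro measurable_compose[OF _ f] measurable_restrict borel_measurable_sum) auto
  qed auto
  also have "\<dots> = (\<integral>\<^sup>+y. \<integral>\<^sup>+g. f (\<lambda>j\<in>{..<n}. (\<lambda>j\<in>{..<n}. sqrt (real m) * g j) j + y j) \<partial>?G \<partial>?G)"
    unfolding eq
    by (intro nn_integral_cong Suc.IH[where f="\<lambda>z. f (\<lambda>j\<in>{..<n}. z j + _ j)"])
      (auto intro!: measurable_compose[OF _ f] measurable_restrict)
  also have "\<dots> = (\<integral>\<^sup>+y. \<integral>\<^sup>+g. f (\<lambda>j\<in>{..<n}. sqrt (real m) * g j + y j) \<partial>?G \<partial>?G)"
    by (intro nn_integral_cong arg_cong[where f=f]) auto
  also have "\<dots> = (\<integral>\<^sup>+g. \<integral>\<^sup>+y. f (\<lambda>j\<in>{..<n}. sqrt (real m) * g j + y j) \<partial>?G \<partial>?G)"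
    by (rule GG.Fubini') simp
  also have "\<dots> = (\<integral>\<^sup>+g. f (\<lambda>j\<in>{..<n}. sqrt (real (Suc m)) * g j) \<partial>?G)"
  \<comment> \<open>The sum of independent vectors with scales \<open>sqrt m\<close> and 1 is a
    rotation followed by the scale \<open>sqrt (m + 1)\<close>. The cosine vanishes for
    \<open>m = 0\<close>, which the rotation lemma excludes.\<close>
  proof (cases "m = 0")
    case True
    then show ?thesis by (simp add: gauss1_PiM.emeasure_space_1)
  next
    case False
    define a where "a = sqrt (real (Suc m))"
    have a: "a > 0" "a\<^sup>2 = real m + 1" by (simp_all add: a_def)
    have cs: "(sqrt (real m) / a)\<^sup>2 + (1 / a)\<^sup>2 = 1" using a by (simp add: power_divide add_divide_distrib[symmetric])
    have "(\<integral>\<^sup>+g. \<integral>\<^sup>+y. f (\<lambda>j\<in>{..<n}. sqrt (real m) * g j + y j) \<partial>?G \<partial>?G)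
      = (\<integral>\<^sup>+g. \<integral>\<^sup>+y. f (\<lambda>j\<in>{..<n}. a * (\<lambda>j\<in>{..<n}. sqrt (real m) / a * g j + 1 / a * y j) j) \<partial>?G \<partial>?G)"
      using a by (intro nn_integral_cong arg_cong[where f=f]) (auto simp: field_simps)
    also have "\<dots> = (\<integral>\<^sup>+g. \<integral>\<^sup>+y. f (\<lambda>j\<in>{..<n}. a * g j) \<partial>?G \<partial>?G)"
      using nn_integral_PiM_gauss1_rotation[OF _ cs, of "{..<n}" "\<lambda>z. f (\<lambda>j\<in>{..<n}. a * fst z j)"] False a
      by simp
    finally show ?thesis by (simp add: a_def gauss1_PiM.emeasure_space_1)
  qed
  finally show ?case .
qed

section \<open>The one-bit model\<close>

text \<open>Rewrites the canonical space as \<open>m\<close> i.i.d. pairs of a row and its label,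
  the units exchanged for Gaussian vectors later.\<close>

lemma nn_integral_sample_space:
  assumes D: "prob_space D" and [measurable]: "F \<in> borel_measurable (sample_space m n D p)"
  shows "(\<integral>\<^sup>+\<omega>. F \<omega> \<partial>sample_space m n D p) =
    (\<integral>\<^sup>+r. F (\<lambda>(i, j)\<in>{..<m} \<times> {..<n}. (\<lambda>i\<in>{..<m}. fst (r i)) i j, \<lambda>i\<in>{..<m}. snd (r i))
      \<partial>PiM {..<m} (\<lambda>_. PiM {..<n} (\<lambda>_. D) \<Otimes>\<^sub>M measure_pmf (bernoulli_pmf (1 - p))))"
proof -
  let ?A = "PiM ({..<m} \<times> {..<n}) (\<lambda>_. D)" and ?R = "PiM {..<n} (\<lambda>_. D)"
  let ?b = "measure_pmf (bernoulli_pmf (1 - p))"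
  let ?f = "\<lambda>z :: nat \<Rightarrow> nat \<Rightarrow> 'a. \<lambda>(i, j)\<in>{..<m} \<times> {..<n}. z i j"
  have b: "prob_space ?b" by (rule measure_pmf.prob_space_axioms)
  interpret B: prob_space "PiM {..<m} (\<lambda>_. ?b)" by (intro prob_space_PiM b)
  have R: "prob_space ?R" by (intro prob_space_PiM D)
  have F[measurable]: "F \<in> borel_measurable (?A \<Otimes>\<^sub>M PiM {..<m} (\<lambda>_. ?b))"
    using assms(2) by (simp add: sample_space_def)
  note f[measurable] = measurable_uncurry_PiM[of "{..<m}" "{..<n}" D]
  have "(\<integral>\<^sup>+\<omega>. F \<omega> \<partial>sample_space m n D p) = (\<integral>\<^sup>+a. \<integral>\<^sup>+y. F (a, y) \<partial>PiM {..<m} (\<lambda>_. ?b) \<partial>?A)"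
    unfolding sample_space_def by (rule B.nn_integral_fst[symmetric]) simp
  also have "\<dots> = (\<integral>\<^sup>+a. \<integral>\<^sup>+y. F (a, y) \<partial>PiM {..<m} (\<lambda>_. ?b) \<partial>distr (PiM {..<m} (\<lambda>_. ?R)) ?A ?f)"
    by (subst distr_PiM_PiM) (use D in auto)
  also have "\<dots> = (\<integral>\<^sup>+z. \<integral>\<^sup>+y. F (?f z, y) \<partial>PiM {..<m} (\<lambda>_. ?b) \<partial>PiM {..<m} (\<lambda>_. ?R))"
    by (rule nn_integral_distr[OF f]) simp
  also have "\<dots> = (\<integral>\<^sup>+r. F (?f (\<lambda>i\<in>{..<m}. fst (r i)), \<lambda>i\<in>{..<m}. snd (r i)) \<partial>PiM {..<m} (\<lambda>_. ?R \<Otimes>\<^sub>M ?b))"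
  proof -
    have meas: "(\<lambda>z. F (?f (fst z), snd z)) \<in> borel_measurable (PiM {..<m} (\<lambda>_. ?R) \<Otimes>\<^sub>M PiM {..<m} (\<lambda>_. ?b))"
      by measurable
    show ?thesis by (rule nn_integral_PiM_pair[OF _ R b meas, unfolded fst_conv snd_conv, symmetric]) simp
  qed
  finally show ?thesis .
qed

lemma sqrt_mult_powr_eighth_square:
  assumes "k \<ge> 0" "\<epsilon> > 0"
  shows "(sqrt k * \<epsilon> powr (1/8))\<^sup>2 = k * \<epsilon> powr (1/4)"
proof -
  have "(\<epsilon> powr (1/8))\<^sup>2 = \<epsilon> powr (1/8 + 1/8)" by (simp only: power2_eq_square powr_add)
  then show ?thesis using assms by (simp add: power_mult_distrib)
qed

locale one_bit_model = symmetric_subgaussian D + bounded_index n U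
  for D :: "real measure" and n :: nat and U :: "(nat \<Rightarrow> real) set" +
  fixes x :: "nat \<Rightarrow> real" and p :: real
  assumes p: "0 \<le> p" "p \<le> 1"
begin

abbreviation row :: "(nat \<Rightarrow> real) measure" where "row \<equiv> PiM {..<n} (\<lambda>_. D)"
abbreviation gauss :: "(nat \<Rightarrow> real) measure" where "gauss \<equiv> PiM {..<n} (\<lambda>_. gauss1)"
abbreviation noise :: "bool measure" where "noise \<equiv> measure_pmf (bernoulli_pmf (1 - p))"

definition R :: real where "R = 2 * sqrt (exp 1) * \<kappa>"

lemma R: "R\<^sup>2 = 4 * exp 1 * \<kappa>\<^sup>2" "R > 0"
  using norm_pos by (auto simp: R_def power_mult_distrib)

sublocale row: prob_space row by (intro prob_space_PiM prob_space_axioms)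
sublocale sample: pair_prob_space row noise ..

lemma component_row[measurable]: "j < n \<Longrightarrow> (\<lambda>a. a j) \<in> borel_measurable row"
  by (intro borel_measurable_component) auto

lemma ip_row[measurable]: "(\<lambda>a. ip n a u) \<in> borel_measurable row"
  by (intro borel_measurable_ip component_row)

lemma sgnp_measurable[measurable]: "sgnp \<in> borel_measurable borel"
  unfolding sgnp_def by measurable

lemma integrable_row_component: "j < n \<Longrightarrow> integrable row (\<lambda>a. \<bar>a j\<bar>)"
  by (intro integrable_PiM_component_abs prob_space_axioms integrable_id_abs) auto

text \<open>One summand of the objective, the label times its row, on the space of a single row and
  noise bit. It is always plus or minus the row itself.\<close>

definition obs :: "(nat \<Rightarrow> real) \<times> bool \<Rightarrow> nat \<Rightarrow> real" where
  "obs r j = (if snd r then 1 else - 1) * sgnp (ip n (fst r) x) * fst r j"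

definition v :: "nat \<Rightarrow> real" where
  "v j = (\<integral>a. sgnp (ip n a x) * a j \<partial>row)"

lemma abs_sgnp[simp]: "\<bar>sgnp t\<bar> = 1" by (simp add: sgnp_def)

lemma abs_obs: "\<bar>obs r j\<bar> = \<bar>fst r j\<bar>" by (simp add: obs_def abs_mult)

lemma obs_measurable[measurable]: "j < n \<Longrightarrow> (\<lambda>r. obs r j) \<in> borel_measurable (row \<Otimes>\<^sub>M noise)"
proof -
  assume j: "j < n"
  have 1: "(\<lambda>r. fst r k) \<in> borel_measurable (row \<Otimes>\<^sub>M noise)" if "k < n" for k
    using that by (intro measurable_compose[OF measurable_fst] component_row)
  have 2: "(\<lambda>r. ip n (fst r) x) \<in> borel_measurable (row \<Otimes>\<^sub>M noise)"
    using 1 by (intro borel_measurable_ip) auto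
  note [measurable] = 1[OF j] 2
  show ?thesis unfolding obs_def by measurable
qed

lemma integrable_obs_abs: "j < n \<Longrightarrow> integrable (row \<Otimes>\<^sub>M noise) (\<lambda>r. \<bar>fst r j\<bar>)"
proof -
  assume j: "j < n"
  have "integrable (distr (row \<Otimes>\<^sub>M noise) row fst) (\<lambda>a. \<bar>a j\<bar>)"
    using integrable_row_component[OF j] by (subst measure_pmf.distr_pair_fst)
  then show ?thesis by (rule integrable_distr[OF measurable_fst])
qed

lemma integrable_obs: "j < n \<Longrightarrow> integrable (row \<Otimes>\<^sub>M noise) (\<lambda>r. obs r j)"
  using integrable_obs_abs[of j]
  by (rule Bochner_Integration.integrable_bound) (auto simp: abs_obs)

lemma integral_obs:
  assumes j: "j < n"
  shows "(\<integral>r. obs r j \<partial>(row \<Otimes>\<^sub>M noise)) = (1 - 2 * p) * v j"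
proof -
  have "(\<integral>r. obs r j \<partial>(row \<Otimes>\<^sub>M noise)) = (\<integral>a. \<integral>b. obs (a, b) j \<partial>noise \<partial>row)"
    by (rule sample.integral_fst'[symmetric]) (rule integrable_obs[OF j])
  also have "\<dots> = (\<integral>a. (1 - 2 * p) * (sgnp (ip n a x) * a j) \<partial>row)"
    using p by (intro Bochner_Integration.integral_cong) (auto simp: obs_def algebra_simps)
  finally show ?thesis by (simp add: v_def)
qed

text \<open>With the other coordinates frozen, the exponential of the support function is convex in
  the remaining one, so the scalar comparison can be applied coordinate by coordinate. The offset
  \<open>c\<close> leaves room for the other rows, and the sign \<open>\<sigma>\<close> is absorbed
  by the symmetry of \<open>D\<close>.\<close>

lemma nn_integral_exp_row_le_gauss:
  assumes s: "s > 0" and \<sigma>: "\<sigma> = 1 \<or> \<sigma> = - 1"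
  shows "(\<integral>\<^sup>+a. ennreal (exp (s * h (\<lambda>j. c j + \<beta> * (\<sigma> * a j)))) \<partial>row)
    \<le> (\<integral>\<^sup>+g. ennreal (exp (s * h (\<lambda>j. c j + \<beta> * (17 * R * g j)))) \<partial>gauss)"
proof -
  define f where "f a = ennreal (exp (s * h (\<lambda>j. c j + \<beta> * a j)))" for a
  have hm: "(\<lambda>a. h (\<lambda>j. c j + \<beta> * a j)) \<in> borel_measurable (PiM {..<n} (\<lambda>_. borel))"
    by (intro borel_measurable_support_fun borel_measurable_add borel_measurable_times borel_measurable_const borel_measurable_component) auto
  have "(\<integral>\<^sup>+a. ennreal (exp (s * h (\<lambda>j. c j + \<beta> * (\<sigma> * a j)))) \<partial>row) = (\<integral>\<^sup>+a. f (\<lambda>j\<in>{..<n}. \<sigma> * a j) \<partial>row)"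
    unfolding f_def by (intro nn_integral_cong arg_cong[where f="\<lambda>t. ennreal (exp (s * t))"] support_fun_cong) auto
  also have "\<dots> \<le> (\<integral>\<^sup>+g. f (\<lambda>j\<in>{..<n}. 17 * R * g j) \<partial>gauss) + (\<Sum>j\<in>{..<n}. 0)"
  proof (rule nn_integral_PiM_le[where K=borel and f=f and X="\<lambda>t. \<sigma> * t" and Y="\<lambda>t. 17 * R * t"])
    show "f \<in> borel_measurable (PiM {..<n} (\<lambda>_. borel))" unfolding f_def using hm by measurable
    fix i y assume i: "i \<in> {..<n}"
    define \<phi> where "\<phi> t = exp (s * h (\<lambda>j. c j + \<beta> * (y(i := t)) j))" for t
    have conv: "convex_on UNIV \<phi>"
    proof (rule convex_onI)
      fix t a b :: real assume t: "t > 0" "t < 1"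
      have "(\<lambda>j. c j + \<beta> * (y(i := (1 - t) * a + t * b)) j)
        = (\<lambda>j. (1 - t) * (c j + \<beta> * (y(i := a)) j) + t * (c j + \<beta> * (y(i := b)) j))"
        by (auto simp: fun_eq_iff algebra_simps)
      then have "h (\<lambda>j. c j + \<beta> * (y(i := (1 - t) * a + t * b)) j)
        \<le> (1 - t) * h (\<lambda>j. c j + \<beta> * (y(i := a)) j) + t * h (\<lambda>j. c j + \<beta> * (y(i := b)) j)"
        using t by (simp only:) (rule support_fun_combination, auto)
      from mult_left_mono[OF this, of s] s
      have "\<phi> ((1 - t) * a + t * b) \<le> exp ((1 - t) *\<^sub>R (s * h (\<lambda>j. c j + \<beta> * (y(i := a)) j)) + t *\<^sub>R (s * h (\<lambda>j. c j + \<beta> * (y(i := b)) j)))"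
        unfolding \<phi>_def by (simp add: algebra_simps)
      also have "\<dots> \<le> (1 - t) * \<phi> a + t * \<phi> b"
        unfolding \<phi>_def using t by (intro convex_onD[OF exp_convex]) auto
      finally show "\<phi> ((1 - t) *\<^sub>R a + t *\<^sub>R b) \<le> (1 - t) * \<phi> a + t * \<phi> b" by simp
    qed simp
    have [measurable]: "\<phi> \<in> borel_measurable borel"
    proof -
      have [measurable]: "(\<lambda>t. h (\<lambda>j. c j + \<beta> * (y(i := t)) j)) \<in> borel_measurable borel"
      proof (intro borel_measurable_support_fun borel_measurable_add borel_measurable_times borel_measurable_const)
        show "(\<lambda>t. (y(i := t)) j) \<in> borel_measurable borel" for j by (cases "j = i") auto
      qed
      show ?thesis unfolding \<phi>_def by measurable
    qed
    have "(\<integral>\<^sup>+t. ennreal (\<phi> (\<sigma> * t)) \<partial>D) = (\<integral>\<^sup>+t. ennreal (\<phi> t) \<partial>D)"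
      using \<sigma> nn_integral_uminus[of "\<lambda>t. ennreal (\<phi> t)"] by auto
    also have "\<dots> \<le> (\<integral>\<^sup>+t. ennreal (\<phi> (17 * R * t)) \<partial>gauss1)"
      by (rule nn_integral_convex_le_gauss1[OF R conv]) (auto simp: \<phi>_def)
    finally show "(\<integral>\<^sup>+t. f (y(i := \<sigma> * t)) \<partial>D) \<le> (\<integral>\<^sup>+t. f (y(i := 17 * R * t)) \<partial>gauss1) + 0"
      by (simp add: f_def \<phi>_def)
  next
    show "(\<lambda>t. \<sigma> * t) \<in> borel_measurable D" "(\<lambda>t. 17 * R * t) \<in> borel_measurable gauss1"
      by (intro borel_measurable_times borel_measurable_const measurable_ident_sets; simp)+
  qed (auto intro: prob_space_axioms prob_space_gauss1)
  also have "(\<integral>\<^sup>+g. f (\<lambda>j\<in>{..<n}. 17 * R * g j) \<partial>gauss) = (\<integral>\<^sup>+g. ennreal (exp (s * h (\<lambda>j. c j + \<beta> * (17 * R * g j)))) \<partial>gauss)"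
    unfolding f_def by (intro nn_integral_cong arg_cong[where f="\<lambda>t. ennreal (exp (s * t))"] support_fun_cong) auto
  finally show ?thesis by simp
qed

section \<open>Symmetrisation and Gaussian domination of one observation\<close>

lemma ip_shift: "ip n (\<lambda>j. c j - \<alpha> * w j) u = ip n c u - \<alpha> * ip n w u"
  using ip_combination[of n 1 c "- \<alpha>" w u] by simp

text \<open>Jensen's inequality for a supremum: every linear functional commutes with the
  expectation and lies below \<open>h\<close>. It allows the mean of an observation to be replaced
  by an independent copy.\<close>

lemma support_fun_mean_le:
  assumes "\<alpha> \<ge> 0"
  shows "integrable (row \<Otimes>\<^sub>M noise) (\<lambda>r. h (\<lambda>j. c j - \<alpha> * obs r j))"
    and "h (\<lambda>j. c j - \<alpha> * ((1 - 2 * p) * v j)) \<le> (\<integral>r. h (\<lambda>j. c j - \<alpha> * obs r j) \<partial>(row \<Otimes>\<^sub>M noise))"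
proof -
  show int: "integrable (row \<Otimes>\<^sub>M noise) (\<lambda>r. h (\<lambda>j. c j - \<alpha> * obs r j))"
  proof (rule Bochner_Integration.integrable_bound)
    show "integrable (row \<Otimes>\<^sub>M noise) (\<lambda>r. 2 * (\<Sum>j<n. \<bar>c j - \<alpha> * obs r j\<bar>))"
      by (intro integrable_mult_right Bochner_Integration.integrable_sum Bochner_Integration.integrable_abs
        Bochner_Integration.integrable_diff integrable_obs) auto
    show "(\<lambda>r. h (\<lambda>j. c j - \<alpha> * obs r j)) \<in> borel_measurable (row \<Otimes>\<^sub>M noise)"
      by (intro borel_measurable_support_fun) auto
    show "AE r in row \<Otimes>\<^sub>M noise. norm (h (\<lambda>j. c j - \<alpha> * obs r j)) \<le> norm (2 * (\<Sum>j<n. \<bar>c j - \<alpha> * obs r j\<bar>))"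
      using abs_support_fun_le[of "\<lambda>j. c j - \<alpha> * obs _ j"] by (intro AE_I2) (auto intro: order_trans)
  qed
  show "h (\<lambda>j. c j - \<alpha> * ((1 - 2 * p) * v j)) \<le> (\<integral>r. h (\<lambda>j. c j - \<alpha> * obs r j) \<partial>(row \<Otimes>\<^sub>M noise))"
  proof (rule support_fun_least)
    fix u assume u: "u \<in> U"
    have ip_int: "integrable (row \<Otimes>\<^sub>M noise) (\<lambda>r. ip n (obs r) u)"
      unfolding ip_def by (intro Bochner_Integration.integrable_sum integrable_mult_left integrable_obs) auto
    have "(\<integral>r. ip n (obs r) u \<partial>(row \<Otimes>\<^sub>M noise)) = (\<Sum>j<n. (\<integral>r. obs r j \<partial>(row \<Otimes>\<^sub>M noise)) * u j)"
      unfolding ip_def by (subst Bochner_Integration.integral_sum) (auto intro: integrable_mult_left integrable_obs)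
    also have "\<dots> = ip n (\<lambda>j. (1 - 2 * p) * v j) u"
      unfolding ip_def by (intro sum.cong) (auto simp: integral_obs)
    finally have "ip n (\<lambda>j. c j - \<alpha> * ((1 - 2 * p) * v j)) u = ip n c u - \<alpha> * (\<integral>r. ip n (obs r) u \<partial>(row \<Otimes>\<^sub>M noise))"
      by (simp add: ip_shift)
    also have "\<dots> = (\<integral>r. ip n c u - \<alpha> * ip n (obs r) u \<partial>(row \<Otimes>\<^sub>M noise))"
      using ip_int by (subst Bochner_Integration.integral_diff) (auto simp: sample.prob_space)
    also have "\<dots> = (\<integral>r. ip n (\<lambda>j. c j - \<alpha> * obs r j) u \<partial>(row \<Otimes>\<^sub>M noise))"
      by (simp add: ip_shift)
    also have "\<dots> \<le> (\<integral>r. h (\<lambda>j. c j - \<alpha> * obs r j) \<partial>(row \<Otimes>\<^sub>M noise))"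
      using ip_int int by (intro integral_mono) (auto simp: ip_shift intro: support_fun_upper[OF u, of "\<lambda>j. c j - \<alpha> * obs _ j", unfolded ip_shift])
    finally show "ip n (\<lambda>j. c j - \<alpha> * ((1 - 2 * p) * v j)) u \<le> (\<integral>r. h (\<lambda>j. c j - \<alpha> * obs r j) \<partial>(row \<Otimes>\<^sub>M noise))" .
  qed
qed

text \<open>Symmetrisation with an independent copy. Convexity separates the two copies, and since a label only
  flips the sign of a symmetric vector, the label disappears without auxiliary Rademacher signs.\<close>

lemma nn_integral_exp_obs_le_gauss:
  assumes s: "s > 0" and \<alpha>: "\<alpha> > 0"
  shows "(\<integral>\<^sup>+r. ennreal (exp (s * h (\<lambda>j. c j + \<alpha> * (obs r j - (1 - 2 * p) * v j)))) \<partial>(row \<Otimes>\<^sub>M noise))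
    \<le> (\<integral>\<^sup>+g. ennreal (exp (s * h (\<lambda>j. c j + \<alpha> * (34 * R * g j)))) \<partial>gauss)"
proof -
  define H where "H c = ennreal (exp (s * h c))" for c
  have H_meas: "(\<lambda>\<omega>. H (f \<omega>)) \<in> borel_measurable M" if "\<And>j. j < n \<Longrightarrow> (\<lambda>\<omega>. f \<omega> j) \<in> borel_measurable M"
    for f and M :: "'z measure"
    using borel_measurable_support_fun[of f M] that unfolding H_def by measurable
  have [measurable]: "(\<lambda>r. H (\<lambda>j. c j + 2 * \<alpha> * obs r j)) \<in> borel_measurable (row \<Otimes>\<^sub>M noise)"
    "(\<lambda>r. H (\<lambda>j. c j - 2 * \<alpha> * obs r j)) \<in> borel_measurable (row \<Otimes>\<^sub>M noise)"
    by (intro H_meas, auto)+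
  have [measurable]: "(\<lambda>a. H (\<lambda>j. c j + 2 * \<alpha> * (\<sigma> * a j))) \<in> borel_measurable row" for \<sigma>
    by (intro H_meas) auto
  let ?half = "ennreal (1/2)"
  have half: "?half * t + ?half * t = t" for t :: ennreal
  proof -
    have "?half + ?half = 1" by (subst ennreal_plus[symmetric]) auto
    then show ?thesis by (simp only: distrib_right[symmetric] mult_1)
  qed
  \<comment> \<open>The mean is replaced by an independent copy \<open>r'\<close>. The difference of
    the copies, shifted by \<open>c\<close>, is the midpoint of
    \<open>c + 2 * \<alpha> * obs r\<close> and \<open>c - 2 * \<alpha> * obs r'\<close>; the
    doubling turns 17 into 34.\<close>
  have pt: "H (\<lambda>j. c j + \<alpha> * (obs r j - (1 - 2 * p) * v j))
      \<le> ?half * H (\<lambda>j. c j + 2 * \<alpha> * obs r j) + ?half * (\<integral>\<^sup>+r. H (\<lambda>j. c j - 2 * \<alpha> * obs r j) \<partial>(row \<Otimes>\<^sub>M noise))" for r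
  proof -
    define d where "d j = c j + \<alpha> * obs r j" for j
    have "H (\<lambda>j. c j + \<alpha> * (obs r j - (1 - 2 * p) * v j)) = ennreal (exp (s * h (\<lambda>j. d j - \<alpha> * ((1 - 2 * p) * v j))))"
      unfolding H_def d_def by (simp add: algebra_simps)
    also have "\<dots> \<le> ennreal (exp (\<integral>r'. s * h (\<lambda>j. d j - \<alpha> * obs r' j) \<partial>(row \<Otimes>\<^sub>M noise)))"
      using support_fun_mean_le(2)[of \<alpha> d] \<alpha> s by (intro ennreal_leI) simp
    also have "\<dots> \<le> (\<integral>\<^sup>+r'. H (\<lambda>j. d j - \<alpha> * obs r' j) \<partial>(row \<Otimes>\<^sub>M noise))"
      unfolding H_def using support_fun_mean_le(1)[of \<alpha> d] \<alpha> by (intro sample.jensen_exp) auto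
    also have "\<dots> \<le> (\<integral>\<^sup>+r'. ?half * H (\<lambda>j. c j + 2 * \<alpha> * obs r j) + ?half * H (\<lambda>j. c j - 2 * \<alpha> * obs r' j) \<partial>(row \<Otimes>\<^sub>M noise))"
    proof (rule nn_integral_mono)
      fix r'
      define A where "A = s * h (\<lambda>j. c j + 2 * \<alpha> * obs r j)"
      define B where "B = s * h (\<lambda>j. c j - 2 * \<alpha> * obs r' j)"
      have "(\<lambda>j. d j - \<alpha> * obs r' j) = (\<lambda>j. 1/2 * (c j + 2 * \<alpha> * obs r j) + 1/2 * (c j - 2 * \<alpha> * obs r' j))"
        by (auto simp: d_def fun_eq_iff algebra_simps)
      then have "h (\<lambda>j. d j - \<alpha> * obs r' j) \<le> 1/2 * h (\<lambda>j. c j + 2 * \<alpha> * obs r j) + 1/2 * h (\<lambda>j. c j - 2 * \<alpha> * obs r' j)"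
        by (simp only:) (rule support_fun_combination, auto)
      from mult_left_mono[OF this, of s] s have "s * h (\<lambda>j. d j - \<alpha> * obs r' j) \<le> (A + B) / 2"
        by (simp add: A_def B_def algebra_simps)
      then have "exp (s * h (\<lambda>j. d j - \<alpha> * obs r' j)) \<le> exp ((A + B) / 2)" by simp
      also have "\<dots> \<le> 1/2 * exp A + 1/2 * exp B" using exp_midpoint[of A B] by simp
      finally have "exp (s * h (\<lambda>j. d j - \<alpha> * obs r' j)) \<le> 1/2 * exp A + 1/2 * exp B" .
      then have "H (\<lambda>j. d j - \<alpha> * obs r' j) \<le> ennreal (1/2 * exp A + 1/2 * exp B)"
        unfolding H_def by (rule ennreal_leI)
      also have "\<dots> = ennreal (1/2 * exp A) + ennreal (1/2 * exp B)" by (rule ennreal_plus) auto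
      also have "\<dots> = ?half * H (\<lambda>j. c j + 2 * \<alpha> * obs r j) + ?half * H (\<lambda>j. c j - 2 * \<alpha> * obs r' j)"
        unfolding H_def A_def B_def by (intro arg_cong2[where f="(+)"] ennreal_mult) auto
      finally show "H (\<lambda>j. d j - \<alpha> * obs r' j) \<le> ?half * H (\<lambda>j. c j + 2 * \<alpha> * obs r j) + ?half * H (\<lambda>j. c j - 2 * \<alpha> * obs r' j)" .
    qed
    also have "\<dots> = ?half * H (\<lambda>j. c j + 2 * \<alpha> * obs r j) + ?half * (\<integral>\<^sup>+r. H (\<lambda>j. c j - 2 * \<alpha> * obs r j) \<partial>(row \<Otimes>\<^sub>M noise))"
      by (subst nn_integral_add) (auto simp: sample.emeasure_space_1 nn_integral_cmult)
    finally show ?thesis .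
  qed
  have "(\<integral>\<^sup>+r. H (\<lambda>j. c j + \<alpha> * (obs r j - (1 - 2 * p) * v j)) \<partial>(row \<Otimes>\<^sub>M noise))
    \<le> (\<integral>\<^sup>+r. ?half * H (\<lambda>j. c j + 2 * \<alpha> * obs r j) + ?half * (\<integral>\<^sup>+r. H (\<lambda>j. c j - 2 * \<alpha> * obs r j) \<partial>(row \<Otimes>\<^sub>M noise)) \<partial>(row \<Otimes>\<^sub>M noise))"
    by (intro nn_integral_mono pt)
  also have "\<dots> = (\<integral>\<^sup>+r. ?half * H (\<lambda>j. c j + 2 * \<alpha> * obs r j) + ?half * H (\<lambda>j. c j - 2 * \<alpha> * obs r j) \<partial>(row \<Otimes>\<^sub>M noise))"
    by (simp add: nn_integral_add nn_integral_cmult sample.emeasure_space_1)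
  \<comment> \<open>The sign in \<open>obs r\<close> depends on the row: negating the row changes
    the sign of a nonzero \<open>ip n (fst r) x\<close> too, so \<open>obs\<close> need not be
    symmetric. The sum of the two halves, however, is unchanged when \<open>obs r\<close> is
    negated, and so may be written with the bare row.\<close>
  also have "\<dots> \<le> (\<integral>\<^sup>+r. ?half * H (\<lambda>j. c j + 2 * \<alpha> * (1 * fst r j)) + ?half * H (\<lambda>j. c j + 2 * \<alpha> * (- 1 * fst r j)) \<partial>(row \<Otimes>\<^sub>M noise))"
  proof (rule nn_integral_mono)
    fix r
    have "(obs r = (\<lambda>j. fst r j)) \<or> (obs r = (\<lambda>j. - fst r j))"
      by (auto simp: obs_def fun_eq_iff sgnp_def)
    then show "?half * H (\<lambda>j. c j + 2 * \<alpha> * obs r j) + ?half * H (\<lambda>j. c j - 2 * \<alpha> * obs r j)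
      \<le> ?half * H (\<lambda>j. c j + 2 * \<alpha> * (1 * fst r j)) + ?half * H (\<lambda>j. c j + 2 * \<alpha> * (- 1 * fst r j))"
      by (elim disjE) (simp_all add: add.commute)
  qed
  also have "\<dots> = (\<integral>\<^sup>+a. \<integral>\<^sup>+b. ?half * H (\<lambda>j. c j + 2 * \<alpha> * (1 * a j)) + ?half * H (\<lambda>j. c j + 2 * \<alpha> * (- 1 * a j)) \<partial>noise \<partial>row)"
  proof -
    define T where "T a = ?half * H (\<lambda>j. c j + 2 * \<alpha> * (1 * a j)) + ?half * H (\<lambda>j. c j + 2 * \<alpha> * (- 1 * a j))" for a
    have [measurable]: "T \<in> borel_measurable row" unfolding T_def by measurable
    have "(\<integral>\<^sup>+r. T (fst r) \<partial>(row \<Otimes>\<^sub>M noise)) = (\<integral>\<^sup>+a. \<integral>\<^sup>+b. T a \<partial>noise \<partial>row)"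
      by (subst measure_pmf.nn_integral_fst[symmetric]) simp_all
    then show ?thesis unfolding T_def .
  qed
  also have "\<dots> = ?half * (\<integral>\<^sup>+a. H (\<lambda>j. c j + 2 * \<alpha> * (1 * a j)) \<partial>row) + ?half * (\<integral>\<^sup>+a. H (\<lambda>j. c j + 2 * \<alpha> * (- 1 * a j)) \<partial>row)"
  proof -
    have "(\<integral>\<^sup>+a. ?half * H (\<lambda>j. c j + 2 * \<alpha> * (1 * a j)) + ?half * H (\<lambda>j. c j + 2 * \<alpha> * (- 1 * a j)) \<partial>row)
      = (\<integral>\<^sup>+a. ?half * H (\<lambda>j. c j + 2 * \<alpha> * (1 * a j)) \<partial>row) + (\<integral>\<^sup>+a. ?half * H (\<lambda>j. c j + 2 * \<alpha> * (- 1 * a j)) \<partial>row)"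
      by (rule nn_integral_add) measurable
    also have "(\<integral>\<^sup>+a. ?half * H (\<lambda>j. c j + 2 * \<alpha> * (1 * a j)) \<partial>row) = ?half * (\<integral>\<^sup>+a. H (\<lambda>j. c j + 2 * \<alpha> * (1 * a j)) \<partial>row)"
      by (rule nn_integral_cmult) measurable
    also have "(\<integral>\<^sup>+a. ?half * H (\<lambda>j. c j + 2 * \<alpha> * (- 1 * a j)) \<partial>row) = ?half * (\<integral>\<^sup>+a. H (\<lambda>j. c j + 2 * \<alpha> * (- 1 * a j)) \<partial>row)"
      by (rule nn_integral_cmult) measurable
    finally show ?thesis by (simp add: measure_pmf.emeasure_space_1)
  qed
  also have "\<dots> \<le> ?half * (\<integral>\<^sup>+g. H (\<lambda>j. c j + 2 * \<alpha> * (17 * R * g j)) \<partial>gauss) + ?half * (\<integral>\<^sup>+g. H (\<lambda>j. c j + 2 * \<alpha> * (17 * R * g j)) \<partial>gauss)"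
    unfolding H_def using s by (intro add_mono mult_left_mono nn_integral_exp_row_le_gauss) auto
  also have "\<dots> = (\<integral>\<^sup>+g. H (\<lambda>j. c j + 2 * \<alpha> * (17 * R * g j)) \<partial>gauss)" by (rule half)
  finally show ?thesis by (simp add: H_def mult.assoc mult.left_commute)
qed

section \<open>Deviation of the averaged observations from their mean\<close>

definition dev :: "nat \<Rightarrow> (nat \<times> nat \<Rightarrow> real) \<times> (nat \<Rightarrow> bool) \<Rightarrow> nat \<Rightarrow> real" where
  "dev m \<omega> j = (\<Sum>i<m. (1 / real m) * (yobs n x i \<omega> * avec i \<omega> j - (1 - 2 * p) * v j))"

lemma dev_measurable:
  assumes j: "j < n"
  shows "(\<lambda>\<omega>. dev m \<omega> j) \<in> borel_measurable (sample_space m n D p)"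
proof -
  let ?S = "sample_space m n D p"
  have a: "(\<lambda>\<omega>. avec i \<omega> k) \<in> borel_measurable ?S" if "i < m" "k < n" for i k
    unfolding avec_def sample_space_def using that
    by (intro measurable_compose[OF measurable_fst] borel_measurable_component) auto
  have e: "(\<lambda>\<omega>. (if snd \<omega> i then 1 else - 1 :: real)) \<in> borel_measurable ?S" if "i < m" for i
  proof -
    have "(\<lambda>\<omega>. snd \<omega> i) \<in> measurable ?S noise"
      unfolding sample_space_def using that
      by (intro measurable_compose[OF measurable_snd] measurable_component_singleton) auto
    from measurable_compose[OF this, of "\<lambda>b. if b then 1 else - 1 :: real" borel] show ?thesis by simp
  qed
  have "(\<lambda>\<omega>. ip n (avec i \<omega>) x) \<in> borel_measurable ?S" if "i < m" for i
    using a that by (intro borel_measurable_ip) auto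
  from measurable_compose[OF this sgnp_measurable]
  have s: "(\<lambda>\<omega>. sgnp (ip n (avec i \<omega>) x)) \<in> borel_measurable ?S" if "i < m" for i
    using that by auto
  show ?thesis
    unfolding dev_def yobs_def using a e s j
    by (intro borel_measurable_sum borel_measurable_times borel_measurable_diff borel_measurable_const) auto
qed

lemma support_fun_dev_measurable: "(\<lambda>\<omega>. h (dev m \<omega>)) \<in> borel_measurable (sample_space m n D p)"
  by (intro borel_measurable_support_fun dev_measurable)

text \<open>\<open>dev\<close> is a sum of \<open>m\<close> centred terms with weight
  \<open>1 / m\<close>, so rows can be exchanged for Gaussian vectors one at a time. The sum of the
  \<open>m\<close> Gaussian rows has scale \<open>sqrt m\<close>, which with the weight leaves
  \<open>1 / sqrt m\<close>.\<close>

lemma nn_integral_exp_dev_le_gauss: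
  assumes s: "s > 0" and m: "m \<ge> 1"
  shows "(\<integral>\<^sup>+\<omega>. ennreal (exp (s * h (dev m \<omega>))) \<partial>sample_space m n D p)
    \<le> (\<integral>\<^sup>+g. ennreal (exp (s * h (\<lambda>j. 34 * R / sqrt (real m) * g j))) \<partial>gauss)"
proof -
  let ?S = "sample_space m n D p"
  let ?B = "PiM {..<n} (\<lambda>_. borel :: real measure)"
  define \<alpha> where "\<alpha> = 1 / real m"
  have \<alpha>: "\<alpha> > 0" using m by (simp add: \<alpha>_def)
  define X where "X r = (\<lambda>j\<in>{..<n}. obs r j - (1 - 2 * p) * v j)" for r
  define Y where "Y g = (\<lambda>j\<in>{..<n}. 34 * R * g j)" for g :: "nat \<Rightarrow> real"
  define f where "f w = ennreal (exp (s * h (\<lambda>j. \<Sum>i<m. \<alpha> * w i j)))" for w :: "nat \<Rightarrow> nat \<Rightarrow> real"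
  have X: "X \<in> measurable (row \<Otimes>\<^sub>M noise) ?B"
    unfolding X_def by (intro measurable_restrict borel_measurable_diff obs_measurable borel_measurable_const) simp
  have Y: "Y \<in> measurable gauss ?B"
    unfolding Y_def by (intro measurable_restrict borel_measurable_times borel_measurable_component borel_measurable_const) auto
  have comp: "(\<lambda>w. w i j) \<in> borel_measurable (PiM {..<m} (\<lambda>_. ?B))" if "i < m" "j < n" for i j
    using that by (intro measurable_compose[of "\<lambda>w. w i" _ ?B "\<lambda>g. g j"]) auto
  have f: "f \<in> borel_measurable (PiM {..<m} (\<lambda>_. ?B))"
  proof -
    have [measurable]: "(\<lambda>w. h (\<lambda>j. \<Sum>i<m. \<alpha> * w i j)) \<in> borel_measurable (PiM {..<m} (\<lambda>_. ?B))"
      using comp by (intro borel_measurable_support_fun borel_measurable_sum borel_measurable_times) auto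
    show ?thesis unfolding f_def by measurable
  qed
  have "(\<integral>\<^sup>+\<omega>. ennreal (exp (s * h (dev m \<omega>))) \<partial>?S)
    = (\<integral>\<^sup>+r. f (\<lambda>i\<in>{..<m}. X (r i)) \<partial>PiM {..<m} (\<lambda>_. row \<Otimes>\<^sub>M noise))"
  proof (subst nn_integral_sample_space[OF prob_space_axioms])
    show "(\<lambda>\<omega>. ennreal (exp (s * h (dev m \<omega>)))) \<in> borel_measurable ?S"
      using support_fun_dev_measurable[of m] by measurable
    show "(\<integral>\<^sup>+r. ennreal (exp (s * h (dev m (\<lambda>(i, j)\<in>{..<m} \<times> {..<n}. (\<lambda>i\<in>{..<m}. fst (r i)) i j, \<lambda>i\<in>{..<m}. snd (r i)))))
        \<partial>PiM {..<m} (\<lambda>_. row \<Otimes>\<^sub>M noise)) = (\<integral>\<^sup>+r. f (\<lambda>i\<in>{..<m}. X (r i)) \<partial>PiM {..<m} (\<lambda>_. row \<Otimes>\<^sub>M noise))"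
      unfolding f_def
    proof (intro nn_integral_cong arg_cong[where f="\<lambda>t. ennreal (exp (s * t))"] support_fun_cong)
      fix r :: "nat \<Rightarrow> (nat \<Rightarrow> real) \<times> bool" and j assume j: "j < n"
      have ip: "ip n (avec i (\<lambda>(i, j)\<in>{..<m} \<times> {..<n}. (\<lambda>i\<in>{..<m}. fst (r i)) i j, \<lambda>i\<in>{..<m}. snd (r i))) x = ip n (fst (r i)) x"
        if "i < m" for i
        using that by (intro ip_cong) (simp add: avec_def)
      show "dev m (\<lambda>(i, j)\<in>{..<m} \<times> {..<n}. (\<lambda>i\<in>{..<m}. fst (r i)) i j, \<lambda>i\<in>{..<m}. snd (r i)) j = (\<Sum>i<m. \<alpha> * (\<lambda>i\<in>{..<m}. X (r i)) i j)"
        unfolding dev_def using j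
        by (intro sum.cong refl) (simp add: yobs_def ip X_def obs_def \<alpha>_def, simp add: avec_def)
    qed
  qed
  also have "\<dots> \<le> (\<integral>\<^sup>+g. f (\<lambda>i\<in>{..<m}. Y (g i)) \<partial>PiM {..<m} (\<lambda>_. gauss)) + (\<Sum>i\<in>{..<m}. 0)"
  proof (rule nn_integral_PiM_le[where K="?B"])
    fix i and y :: "nat \<Rightarrow> nat \<Rightarrow> real" assume i: "i \<in> {..<m}"
    \<comment> \<open>All other rows enter only as an offset, whether already replaced or not; the
      one-observation bound holds for any offset.\<close>
    define c where "c j = (\<Sum>k\<in>{..<m} - {i}. \<alpha> * y k j)" for j
    have eq: "(\<Sum>k<m. \<alpha> * (y(i := z)) k j) = c j + \<alpha> * z j" for z j
      unfolding c_def using i by (subst sum.remove[of _ i]) (auto intro!: sum.cong)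
    have "(\<integral>\<^sup>+r. f (y(i := X r)) \<partial>(row \<Otimes>\<^sub>M noise)) = (\<integral>\<^sup>+r. ennreal (exp (s * h (\<lambda>j. c j + \<alpha> * (obs r j - (1 - 2 * p) * v j)))) \<partial>(row \<Otimes>\<^sub>M noise))"
      unfolding f_def eq
      by (intro nn_integral_cong arg_cong[where f="\<lambda>t. ennreal (exp (s * t))"] support_fun_cong) (simp add: X_def)
    also have "\<dots> \<le> (\<integral>\<^sup>+g. ennreal (exp (s * h (\<lambda>j. c j + \<alpha> * (34 * R * g j)))) \<partial>gauss)"
      by (rule nn_integral_exp_obs_le_gauss[OF s \<alpha>])
    also have "\<dots> = (\<integral>\<^sup>+g. f (y(i := Y g)) \<partial>gauss)"
      unfolding f_def eq
      by (intro nn_integral_cong arg_cong[where f="\<lambda>t. ennreal (exp (s * t))"] support_fun_cong) (simp add: Y_def)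
    finally show "(\<integral>\<^sup>+r. f (y(i := X r)) \<partial>(row \<Otimes>\<^sub>M noise)) \<le> (\<integral>\<^sup>+g. f (y(i := Y g)) \<partial>gauss) + 0" by simp
  qed (use X Y f in \<open>auto intro: sample.prob_space_axioms gauss1_PiM.prob_space_axioms\<close>)
  also have "(\<Sum>i\<in>{..<m}. 0 :: ennreal) = 0" by simp
  also have "(\<integral>\<^sup>+g. f (\<lambda>i\<in>{..<m}. Y (g i)) \<partial>PiM {..<m} (\<lambda>_. gauss)) + 0
    = (\<integral>\<^sup>+g. ennreal (exp (s * h (\<lambda>j. \<alpha> * 34 * R * (\<lambda>j\<in>{..<n}. \<Sum>i<m. g i j) j))) \<partial>PiM {..<m} (\<lambda>_. gauss))"
    unfolding f_def add_0_right
    by (intro nn_integral_cong arg_cong[where f="\<lambda>t. ennreal (exp (s * t))"] support_fun_cong) (simp add: Y_def sum_distrib_left mult.assoc)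
  also have "\<dots> = (\<integral>\<^sup>+g. ennreal (exp (s * h (\<lambda>j. \<alpha> * 34 * R * (\<lambda>j\<in>{..<n}. sqrt (real m) * g j) j))) \<partial>gauss)"
  proof (rule nn_integral_gauss_row_sum[where f="\<lambda>z. ennreal (exp (s * h (\<lambda>j. \<alpha> * 34 * R * z j)))"])
    have [measurable]: "(\<lambda>z. h (\<lambda>j. \<alpha> * 34 * R * z j)) \<in> borel_measurable ?B"
      by (intro borel_measurable_support_fun borel_measurable_times borel_measurable_const borel_measurable_component) auto
    show "(\<lambda>z. ennreal (exp (s * h (\<lambda>j. \<alpha> * 34 * R * z j)))) \<in> borel_measurable ?B" by measurable
  qed
  also have "\<dots> = (\<integral>\<^sup>+g. ennreal (exp (s * h (\<lambda>j. 34 * R / sqrt (real m) * g j))) \<partial>gauss)"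
  proof -
    have "\<alpha> * sqrt (real m) = 1 / sqrt (real m)" using m by (simp add: \<alpha>_def field_simps)
    then have "\<alpha> * 34 * R * (sqrt (real m) * t) = 34 * R / sqrt (real m) * t" for t
    proof -
      have "\<alpha> * 34 * R * (sqrt (real m) * t) = (\<alpha> * sqrt (real m)) * (34 * R * t)" by simp
      then show ?thesis using \<open>\<alpha> * sqrt (real m) = _\<close> by simp
    qed
    then show ?thesis
      by (intro nn_integral_cong arg_cong[where f="\<lambda>t. ennreal (exp (s * t))"] support_fun_cong) simp
  qed
  finally show ?thesis .
qed

lemma prob_space_sample: "prob_space (sample_space m n D p)"
proof -
  interpret A: prob_space "PiM ({..<m} \<times> {..<n}) (\<lambda>_. D)" by (intro prob_space_PiM prob_space_axioms)
  interpret B: prob_space "PiM {..<m} (\<lambda>_. noise)" by (intro prob_space_PiM measure_pmf.prob_space_axioms)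
  interpret AB: pair_prob_space "PiM ({..<m} \<times> {..<n}) (\<lambda>_. D)" "PiM {..<m} (\<lambda>_. noise)" ..
  show ?thesis unfolding sample_space_def by (rule AB.prob_space_axioms)
qed

text \<open>Chernoff's bound. The factor 2 in \<open>68 = 2 * 34\<close> is the factor 1/2 in the
  Gaussian exponential moment, moved to the other side.\<close>

lemma deviation_bound:
  fixes m :: nat and \<beta> :: real
  assumes m: "m \<ge> 1" and \<beta>: "\<beta> > 0"
  defines "w \<equiv> (\<integral>g. h g \<partial>gauss)"
  defines "E \<equiv> {\<omega> \<in> space (sample_space m n D p). h (dev m \<omega>) < 68 * R / sqrt (real m) * (w + 4 * \<beta>)}"
  shows "E \<in> sets (sample_space m n D p)" "measure (sample_space m n D p) E \<ge> 1 - exp (- \<beta>\<^sup>2)"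
proof -
  let ?S = "sample_space m n D p"
  interpret S: prob_space ?S by (rule prob_space_sample)
  note [measurable] = support_fun_dev_measurable[of m]
  show E[measurable]: "E \<in> sets ?S" unfolding E_def by measurable
  \<comment> \<open>With \<open>s * a = t / 2\<close> the Gaussian moment bound applies verbatim.
    The exponent left over is \<open>4 * t\<^sup>2 - 4 * t * \<beta>\<close>, minimal at
    \<open>t = \<beta> / 2\<close>, where it equals \<open>- \<beta>\<^sup>2\<close>.\<close>
  define t where "t = \<beta> / 2"
  define a where "a = 34 * R / sqrt (real m)"
  have a: "a > 0" using R m by (simp add: a_def)
  define s where "s = t / (2 * a)"
  have t: "t > 0" using \<beta> by (simp add: t_def)
  have s: "s > 0" using a t by (simp add: s_def)
  define B where "B = 68 * R / sqrt (real m) * (w + 4 * \<beta>)"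
  have B: "B = 2 * a * (w + 4 * \<beta>)" by (simp add: B_def a_def)
  have sB: "s * B = t * (w + 4 * \<beta>)" using a by (simp add: B s_def)
  have "(\<integral>\<^sup>+\<omega>. ennreal (exp (s * h (dev m \<omega>))) \<partial>?S) \<le> (\<integral>\<^sup>+g. ennreal (exp (s * h (\<lambda>j. a * g j))) \<partial>gauss)"
    unfolding a_def by (rule nn_integral_exp_dev_le_gauss[OF s m])
  also have "\<dots> = (\<integral>\<^sup>+g. ennreal (exp (t / 2 * h g)) \<partial>gauss)"
    using a by (simp add: support_fun_scale s_def)
  also have "\<dots> \<le> ennreal (exp (t * w + 4 * t\<^sup>2))"
    unfolding w_def by (rule nn_integral_exp_support_fun_gauss[OF t])
  finally have mgf: "(\<integral>\<^sup>+\<omega>. ennreal (exp (s * h (dev m \<omega>))) \<partial>?S) \<le> ennreal (exp (t * w + 4 * t\<^sup>2))" .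
  have "emeasure ?S (space ?S - E) = (\<integral>\<^sup>+\<omega>. indicator (space ?S - E) \<omega> \<partial>?S)" by simp
  also have "\<dots> \<le> (\<integral>\<^sup>+\<omega>. ennreal (exp (- (s * B))) * ennreal (exp (s * h (dev m \<omega>))) \<partial>?S)"
  proof (rule nn_integral_mono)
    fix \<omega> assume "\<omega> \<in> space ?S"
    have "1 \<le> ennreal (exp (- (s * B))) * ennreal (exp (s * h (dev m \<omega>)))" if "B \<le> h (dev m \<omega>)"
    proof -
      have "1 \<le> exp (- (s * B) + s * h (dev m \<omega>))" using mult_left_mono[OF that, of s] s by simp
      then show ?thesis by (simp add: ennreal_mult[symmetric] exp_add[symmetric])
    qed
    moreover have "B \<le> h (dev m \<omega>)" if "\<omega> \<in> space ?S - E"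
      using that unfolding E_def B_def by (auto simp: not_less)
    ultimately show "indicator (space ?S - E) \<omega> \<le> ennreal (exp (- (s * B))) * ennreal (exp (s * h (dev m \<omega>)))"
      by (auto simp: indicator_def)
  qed
  also have "\<dots> = ennreal (exp (- (s * B))) * (\<integral>\<^sup>+\<omega>. ennreal (exp (s * h (dev m \<omega>))) \<partial>?S)"
    by (rule nn_integral_cmult) measurable
  also have "\<dots> \<le> ennreal (exp (- (s * B))) * ennreal (exp (t * w + 4 * t\<^sup>2))"
    by (intro mult_left_mono mgf) simp
  also have "\<dots> = ennreal (exp (- \<beta>\<^sup>2))"
  proof -
    have "- (s * B) + (t * w + 4 * t\<^sup>2) = - \<beta>\<^sup>2" unfolding sB by (simp add: t_def power2_eq_square field_simps)
    then show ?thesis by (simp add: ennreal_mult[symmetric] exp_add[symmetric])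
  qed
  finally have "measure ?S (space ?S - E) \<le> exp (- \<beta>\<^sup>2)"
    by (simp add: S.emeasure_eq_measure)
  then show "measure ?S E \<ge> 1 - exp (- \<beta>\<^sup>2)" using S.prob_compl[OF E] by simp
qed

section \<open>Bias of the mean observation\<close>

lemma ip_v: "ip n v u = (\<integral>a. sgnp (ip n a x) * ip n a u \<partial>row)"
  and integrable_sgnp_ip: "integrable row (\<lambda>a. sgnp (ip n a x) * ip n a u)"
  and integrable_abs_ip: "integrable row (\<lambda>a. \<bar>ip n a u\<bar>)"
proof -
  have m: "(\<lambda>a. sgnp (ip n a x)) \<in> borel_measurable row"
    using measurable_compose[OF ip_row sgnp_measurable] .
  have i: "integrable row (\<lambda>a. sgnp (ip n a x) * a j)" if "j < n" for j
    using integrable_row_component[OF that]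
    by (rule Bochner_Integration.integrable_bound) (use m component_row[OF that] in \<open>auto simp: abs_mult\<close>)
  have i2: "integrable row (\<lambda>a. a j)" if "j < n" for j
    using integrable_row_component[OF that]
    by (rule Bochner_Integration.integrable_bound) (use component_row[OF that] in auto)
  show "integrable row (\<lambda>a. \<bar>ip n a u\<bar>)"
    unfolding ip_def by (intro Bochner_Integration.integrable_abs Bochner_Integration.integrable_sum integrable_mult_left i2) auto
  have eq: "sgnp (ip n a x) * ip n a u = (\<Sum>j<n. (sgnp (ip n a x) * a j) * u j)" for a
    unfolding ip_def[of n a u] by (simp add: sum_distrib_left mult.assoc)
  show "integrable row (\<lambda>a. sgnp (ip n a x) * ip n a u)"
    unfolding eq by (intro Bochner_Integration.integrable_sum integrable_mult_left i) auto
  show "ip n v u = (\<integral>a. sgnp (ip n a x) * ip n a u \<partial>row)"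
    unfolding eq by (subst Bochner_Integration.integral_sum) (auto simp: ip_def[of n v u] v_def intro: integrable_mult_left i)
qed

text \<open>Among all signs, that of \<open>ip n a u\<close> itself gives the largest expectation.
  At \<open>u = x\<close> it is the sign actually used, so equality holds there; the two facts
  reduce the study of \<open>v\<close> to first absolute moments.\<close>

lemma ip_v_le: "ip n v u \<le> (\<integral>a. \<bar>ip n a u\<bar> \<partial>row)"
  unfolding ip_v
proof (rule integral_mono[OF integrable_sgnp_ip integrable_abs_ip])
  show "sgnp (ip n a x) * ip n a u \<le> \<bar>ip n a u\<bar>" for a
    by (simp add: sgnp_def abs_ge_self abs_ge_minus_self)
qed

lemma ip_v_self: "ip n v x = (\<integral>a. \<bar>ip n a x\<bar> \<partial>row)"
  unfolding ip_v by (intro Bochner_Integration.integral_cong) (auto simp: sgnp_def)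

lemma abs_measure_diff_le_tv_dist:
  assumes "A \<in> sets borel"
  shows "\<bar>measure D A - measure gauss1 A\<bar> \<le> tv_dist D gauss1"
proof -
  have "bdd_above ((\<lambda>A. \<bar>measure D A - measure gauss1 A\<bar>) ` sets borel)"
  proof (rule bdd_aboveI[where M=1], clarsimp)
    fix A
    have "0 \<le> measure D A" "measure D A \<le> 1" "0 \<le> measure gauss1 A" "measure gauss1 A \<le> 1" by auto
    then show "\<bar>measure D A - measure gauss1 A\<bar> \<le> 1" by linarith
  qed
  then show ?thesis unfolding tv_dist_def by (rule cSUP_upper[OF assms])
qed

lemma integral_abs_ip_bounds:
  assumes tv: "tv_dist D gauss1 \<le> \<epsilon>" and \<epsilon>: "\<epsilon> > 0" and u: "nrm n u = 1"
  defines "\<delta> \<equiv> 4 * \<kappa> * \<epsilon> powr (1/4)"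
  shows "(\<integral>a. \<bar>ip n a u\<bar> \<partial>row) \<le> sqrt (2 / pi) + \<delta>" "sqrt (2 / pi) - \<delta> \<le> (\<integral>a. \<bar>ip n a u\<bar> \<partial>row)"
proof -
  have diff: "\<bar>measure D A - measure gauss1 A\<bar> \<le> \<epsilon>" if "A \<in> sets borel" for A
    using abs_measure_diff_le_tv_dist[OF that] tv by simp
  have D4: "(\<integral>\<^sup>+t. ennreal (t ^ 4) \<partial>D) \<le> ennreal (16 * \<kappa> ^ 4)"
    using nn_even_moment[of 2] by (simp add: power_mult_distrib mult.commute flip: power_mult)
  \<comment> \<open>Needed for the comparison with the two laws swapped. The Gaussian fourth moment
    is 3, while \<open>\<kappa>\<^sup>2 \<ge> 1 / 2\<close> gives
    \<open>16 * \<kappa> ^ 4 \<ge> 4\<close>.\<close>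
  have gauss4: "(\<integral>\<^sup>+t. ennreal (t ^ 4) \<partial>gauss1) \<le> ennreal (16 * \<kappa> ^ 4)"
  proof -
    have "(1/2)\<^sup>2 \<le> (\<kappa>\<^sup>2)\<^sup>2" using norm_ge by (intro power_mono) auto
    moreover have "(\<kappa>\<^sup>2)\<^sup>2 = \<kappa> ^ 4" by (simp flip: power_mult)
    ultimately have "3 \<le> 16 * \<kappa> ^ 4" by (simp add: power2_eq_square)
    then have "ennreal 3 \<le> ennreal (16 * \<kappa> ^ 4)" by (rule ennreal_leI)
    then show ?thesis by (simp add: nn_integral_gauss1_power4)
  qed
  have g: "(\<integral>\<^sup>+a. ennreal \<bar>ip n a u\<bar> \<partial>gauss) = ennreal (sqrt (2 / pi))"
    using nn_integral_gauss_ip[of "\<lambda>t. ennreal \<bar>t\<bar>" n u] nn_integral_gauss1_abs u by simp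
  have d: "(\<integral>\<^sup>+a. ennreal \<bar>ip n a u\<bar> \<partial>row) = ennreal (\<integral>a. \<bar>ip n a u\<bar> \<partial>row)"
    by (rule nn_integral_eq_integral[OF integrable_abs_ip]) simp
  have \<delta>: "\<delta> \<ge> 0" using norm_pos by (simp add: \<delta>_def)
  have "ennreal (\<integral>a. \<bar>ip n a u\<bar> \<partial>row) \<le> ennreal (sqrt (2 / pi)) + ennreal \<delta>"
    unfolding d[symmetric] g[symmetric] \<delta>_def
    using diff by (intro nn_integral_abs_ip_le prob_space_axioms prob_space_gauss1 nn_integral_uminus nn_integral_gauss1_uminus D4 \<epsilon> norm_pos u)
      (auto simp: abs_le_iff algebra_simps)
  then have "ennreal (\<integral>a. \<bar>ip n a u\<bar> \<partial>row) \<le> ennreal (sqrt (2 / pi) + \<delta>)"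
    using \<delta> by simp
  then show "(\<integral>a. \<bar>ip n a u\<bar> \<partial>row) \<le> sqrt (2 / pi) + \<delta>"
    using \<delta> by (subst (asm) ennreal_le_iff) auto
  have "ennreal (sqrt (2 / pi)) \<le> ennreal (\<integral>a. \<bar>ip n a u\<bar> \<partial>row) + ennreal \<delta>"
    unfolding d[symmetric] g[symmetric] \<delta>_def
    using diff by (intro nn_integral_abs_ip_le prob_space_axioms prob_space_gauss1 nn_integral_uminus nn_integral_gauss1_uminus gauss4 \<epsilon> norm_pos u)
      (auto simp: abs_le_iff algebra_simps)
  also have "\<dots> = ennreal ((\<integral>a. \<bar>ip n a u\<bar> \<partial>row) + \<delta>)"
    using \<delta> by (intro ennreal_plus[symmetric] integral_nonneg_AE) auto
  finally show "sqrt (2 / pi) - \<delta> \<le> (\<integral>a. \<bar>ip n a u\<bar> \<partial>row)"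
    using \<delta> by (subst (asm) ennreal_le_iff) (auto intro!: add_nonneg_nonneg integral_nonneg_AE)
qed

text \<open>Testing \<open>v\<close> against its own direction bounds its norm by
  \<open>l + \<delta>\<close>, and testing against \<open>x\<close> gives an inner product of at
  least \<open>l - \<delta>\<close>. In the expanded square the terms without
  \<open>\<delta>\<close> cancel.\<close>

lemma nrm_mean_diff_le:
  assumes tv: "tv_dist D gauss1 \<le> \<epsilon>" and \<epsilon>: "\<epsilon> > 0" and x: "nrm n x = 1"
    and small: "4 * \<kappa> * \<epsilon> powr (1/4) \<le> 1"
  shows "nrm n (\<lambda>j. v j - sqrt (2 / pi) * x j) \<le> 9 / 2 * (sqrt \<kappa> * \<epsilon> powr (1/8))"
proof -
  define \<delta> where "\<delta> = 4 * \<kappa> * \<epsilon> powr (1/4)"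
  define l where "l = sqrt (2 / pi)"
  define q where "q = sqrt \<kappa> * \<epsilon> powr (1/8)"
  have q: "q \<ge> 0" using norm_pos by (simp add: q_def)
  have \<delta>: "0 \<le> \<delta>" "\<delta> \<le> 1" "\<delta> = 4 * q\<^sup>2"
    using norm_nonneg small \<epsilon> sqrt_mult_powr_eighth_square[OF norm_nonneg \<epsilon>] by (simp_all add: \<delta>_def q_def)
  have l: "0 \<le> l" "l \<le> 1" using pi_gt3 by (simp_all add: l_def)
  define r where "r = nrm n v"
  have r: "r \<ge> 0" by (simp add: r_def nrm_def sum_nonneg)
  have r_le: "r \<le> l + \<delta>"
  proof (cases "r = 0")
    case False
    with r have r0: "r > 0" by simp
    have ip_vv: "ip n v v = r\<^sup>2" by (simp add: r_def nrm_def ip_def power2_eq_square sum_nonneg)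
    have u: "nrm n (\<lambda>j. v j / r) = 1"
    proof -
      have "(\<Sum>j<n. (v j / r)\<^sup>2) = ip n v v / r\<^sup>2" by (simp add: ip_def power_divide sum_divide_distrib power2_eq_square)
      then show ?thesis using r0 by (simp add: nrm_def ip_vv)
    qed
    have "ip n v (\<lambda>j. v j / r) = ip n v v / r" by (simp add: ip_def sum_divide_distrib)
    also have "\<dots> = r" using r0 by (simp add: ip_vv power2_eq_square)
    finally show ?thesis
      using ip_v_le[of "\<lambda>j. v j / r"] integral_abs_ip_bounds(1)[OF tv \<epsilon> u] by (simp add: \<delta>_def l_def)
  qed (use l \<delta> in simp)
  have vx: "l - \<delta> \<le> ip n v x"
    unfolding ip_v_self using integral_abs_ip_bounds(2)[OF tv \<epsilon> x] by (simp add: \<delta>_def l_def)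
  have "(nrm n (\<lambda>j. v j - l * x j))\<^sup>2 = (\<Sum>j<n. (v j - l * x j)\<^sup>2)" by (simp add: nrm_def sum_nonneg)
  also have "\<dots> = (\<Sum>j<n. (v j)\<^sup>2 - 2 * l * (v j * x j) + l\<^sup>2 * (x j)\<^sup>2)"
    by (intro sum.cong) (auto simp: power2_eq_square algebra_simps)
  also have "\<dots> = (\<Sum>j<n. (v j)\<^sup>2) - 2 * l * ip n v x + l\<^sup>2 * (\<Sum>j<n. (x j)\<^sup>2)"
    by (simp add: sum.distrib sum_subtractf sum_distrib_left ip_def)
  also have "\<dots> = r\<^sup>2 - 2 * l * ip n v x + l\<^sup>2"
    using x by (simp add: r_def nrm_def sum_nonneg)
  also have "\<dots> \<le> (l + \<delta>)\<^sup>2 - 2 * l * (l - \<delta>) + l\<^sup>2"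
  proof -
    have "r\<^sup>2 \<le> (l + \<delta>)\<^sup>2" using r_le r by (rule power_mono)
    moreover have "2 * l * (l - \<delta>) \<le> 2 * l * ip n v x" using vx l by (intro mult_left_mono) auto
    ultimately show ?thesis by linarith
  qed
  also have "\<dots> = 4 * (l * \<delta>) + \<delta> * \<delta>" by (simp add: power2_eq_square algebra_simps)
  also have "\<dots> \<le> 4 * \<delta> + \<delta>"
    using mult_left_le_one_le[OF \<delta>(1) l] mult_left_le_one_le[OF \<delta>(1) \<delta>(1,2)] by linarith
  \<comment> \<open>Here \<open>5 * \<delta>\<close> is \<open>20 * q\<^sup>2\<close>, just below
    \<open>(81 / 4) * q\<^sup>2\<close>.\<close>
  also have "\<dots> \<le> (9 / 2 * q)\<^sup>2" unfolding \<delta>(3) by (simp add: power_mult_distrib power2_eq_square)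
  finally show ?thesis
    unfolding q_def[symmetric] l_def[symmetric] by (rule power2_le_imp_le) (use q in simp)
qed

section \<open>Deterministic recovery on the deviation event\<close>

lemma recovery_bound:
  assumes U: "U = {k1 - k2 | k1 k2. k1 \<in> K \<and> k2 \<in> K}" and K: "K \<subseteq> ball2 n" and xK: "x \<in> K"
    and x: "nrm n x = 1" and m: "m \<ge> 1" and p2: "p < 1/2"
    and tv: "tv_dist D gauss1 \<le> \<epsilon>" and \<epsilon>: "\<epsilon> > 0"
    and dev: "h (dev m \<omega>) < B" and sol: "is_solution m n K x \<omega> xh"
  shows "(nrm n (x - xh))\<^sup>2 \<le> 36 * (sqrt \<kappa> * \<epsilon> powr (1/8)) + 4 * B / (1 - 2 * p)"
proof -
  define q where "q = sqrt \<kappa> * \<epsilon> powr (1/8)"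
  define l where "l = sqrt (2 / pi)"
  define N where "N = (nrm n (x - xh))\<^sup>2"
  have q: "q \<ge> 0" using norm_pos by (simp add: q_def)
  have xh: "xh \<in> K" using sol by (simp add: is_solution_def)
  have nrm_xh: "nrm n xh \<le> 1" using K xh by (auto simp: ball2_def)
  have sq: "(nrm n u)\<^sup>2 = ip n u u" for u by (simp add: nrm_def ip_def power2_eq_square sum_nonneg)
  have diffU: "xh - x \<in> U" "x - xh \<in> U" "x - x \<in> U" unfolding U using xK xh by blast+
  have N4: "N \<le> 4" unfolding N_def using bounded[OF diffU(2)]
    power_mono[of "nrm n (x - xh)" 2 2] by (simp add: nrm_def sum_nonneg)
  have ip_diff: "ip n u (a - b) = ip n u a - ip n u b" for u a b
    by (simp add: ip_def algebra_simps sum_subtractf)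
  have B0: "B > 0" using support_fun_upper[OF diffU(3), of "dev m \<omega>"] dev by (simp add: ip_diff)
  have p3: "1 - 2 * p > 0" using p2 by simp
  show ?thesis
  \<comment> \<open>If the bias estimate is not in its range, then \<open>q > 1 / 2\<close>, and the
    squared diameter 4 of the unit ball already lies below \<open>36 * q\<close>.\<close>
  proof (cases "4 * \<kappa> * \<epsilon> powr (1/4) \<le> 1")
    case False
    have "4 * \<kappa> * \<epsilon> powr (1/4) = (2 * q)\<^sup>2"
      using sqrt_mult_powr_eighth_square[OF norm_nonneg \<epsilon>] unfolding q_def[symmetric] by (simp add: power_mult_distrib)
    with False have "1 < (2 * q)\<^sup>2" by simp
    then have "1 < 2 * q" using q power_le_one[of "2 * q" 2] by linarith
    then have "N \<le> 36 * q" using N4 by simp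
    then show ?thesis using B0 p3 by (simp add: N_def q_def add_increasing2)
  next
    case True
    define e where "e = (\<lambda>j. v j - l * x j)"
    have e: "nrm n e \<le> 9 / 2 * q"
      unfolding e_def l_def q_def by (rule nrm_mean_diff_le[OF tv \<epsilon> x True])
    have l: "l \<ge> 1 / 2" unfolding l_def using pi_less_4 by (intro real_le_rsqrt) (simp add: power2_eq_square field_simps)
    define S where "S z = (\<Sum>i<m. yobs n x i \<omega> * ip n (avec i \<omega>) z)" for z
    have "S x \<le> S xh" using sol xK by (simp add: is_solution_def S_def)
    have ip_dev: "ip n (dev m \<omega>) u = 1 / real m * S u - (1 - 2 * p) * ip n v u" for u
    proof -
      have "ip n (dev m \<omega>) u = (\<Sum>j<n. \<Sum>i<m. 1 / real m * (yobs n x i \<omega> * (avec i \<omega> j * u j)) - 1 / real m * ((1 - 2 * p) * (v j * u j)))"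
        unfolding ip_def dev_def sum_distrib_right by (intro sum.cong refl) (simp only: right_diff_distrib left_diff_distrib mult.assoc)
      also have "\<dots> = (\<Sum>i<m. \<Sum>j<n. 1 / real m * (yobs n x i \<omega> * (avec i \<omega> j * u j)) - 1 / real m * ((1 - 2 * p) * (v j * u j)))"
        by (rule sum.swap)
      also have "\<dots> = (\<Sum>i<m. 1 / real m * (yobs n x i \<omega> * ip n (avec i \<omega>) u) - 1 / real m * ((1 - 2 * p) * ip n v u))"
        by (simp only: sum_subtractf sum_distrib_left[symmetric] ip_def)
      also have "\<dots> = 1 / real m * S u - 1 / real m * ((1 - 2 * p) * (real m * ip n v u))"
        by (simp only: sum_subtractf sum_distrib_left[symmetric] S_def sum_constant card_lessThan)
      finally show ?thesis using m by simp
    qed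
    have S_diff: "S (a - b) = S a - S b" for a b
      by (simp add: S_def ip_diff algebra_simps sum_subtractf)
    have "1 / real m * S (xh - x) \<ge> 0" using \<open>S x \<le> S xh\<close> by (simp add: S_diff)
    \<comment> \<open>Optimality makes the empirical objective nonnegative in the direction
      \<open>xh - x\<close>. Hence the part of \<open>dev\<close> in that direction is at least
      minus its mean part, and it is also below \<open>B\<close>.\<close>
    then have "- ((1 - 2 * p) * ip n v (xh - x)) < B"
      using support_fun_upper[OF diffU(1), of "dev m \<omega>"] dev unfolding ip_dev by linarith
    then have "(1 - 2 * p) * ip n v (x - xh) < B" by (simp add: ip_diff algebra_simps)
    then have 1: "ip n v (x - xh) < B / (1 - 2 * p)" using p3 by (simp add: field_simps)
    \<comment> \<open>Since \<open>xh\<close> lies in the unit ball and \<open>x\<close> on the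
      sphere, the inner product of \<open>x\<close> with \<open>x - xh\<close> is at least half the
      squared distance; this is how an error in the objective becomes an error in the
      solution.\<close>
    have "N = ip n x x - 2 * ip n x xh + ip n xh xh"
      unfolding N_def sq by (simp add: ip_def algebra_simps sum_subtractf sum.distrib sum_distrib_left)
    moreover have "ip n xh xh \<le> 1" using power_mono[OF nrm_xh, of 2] by (simp add: sq[symmetric] nrm_def sum_nonneg)
    moreover have "ip n x x = 1" using x sq[of x] by simp
    ultimately have 2: "N / 2 \<le> ip n x (x - xh)" by (simp add: ip_diff)
    have 3: "ip n v (x - xh) = l * ip n x (x - xh) + ip n e (x - xh)"
      by (simp add: e_def ip_def sum_distrib_left sum.distrib[symmetric] algebra_simps)
    have 4: "\<bar>ip n e (x - xh)\<bar> \<le> 9 * q"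
    proof (rule power2_le_imp_le)
      have "(ip n e (x - xh))\<^sup>2 \<le> (\<Sum>j<n. (e j)\<^sup>2) * (\<Sum>j<n. ((x - xh) j)\<^sup>2)"
        unfolding ip_def by (rule Cauchy_Schwarz_ineq_sum)
      also have "\<dots> = (nrm n e)\<^sup>2 * N" by (simp add: nrm_def N_def sum_nonneg)
      also have "\<dots> \<le> (9 / 2 * q)\<^sup>2 * 4"
        using e N4 by (intro mult_mono power_mono) (auto simp: nrm_def N_def sum_nonneg)
      also have "\<dots> = (9 * q)\<^sup>2" by (simp add: power_mult_distrib power2_eq_square)
      finally show "\<bar>ip n e (x - xh)\<bar>\<^sup>2 \<le> (9 * q)\<^sup>2" by simp
    qed (use q in simp)
    \<comment> \<open>Both factors are at least one half. Multiplying the resulting bound on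
      \<open>N / 4\<close> by 4 turns \<open>9 * q\<close> into \<open>36 * q\<close> and produces
      the factor 4 in front of \<open>B\<close>.\<close>
    have "1 / 2 * (N / 2) \<le> l * ip n x (x - xh)"
      using l 2 by (intro mult_mono) (auto simp: N_def)
    with 1 3 4 have "N / 4 \<le> B / (1 - 2 * p) + 9 * q" by linarith
    moreover have "4 * (B / (1 - 2 * p)) = 4 * B / (1 - 2 * p)" by simp
    ultimately show ?thesis unfolding N_def q_def by linarith
  qed
qed

end

theorem theorem5p1:
  shows "\<exists>C>0. \<forall>(D::real measure) \<kappa> \<epsilon> (m::nat) (n::nat) K x p \<beta>.
     prob_space D \<and> sets D = sets borel \<and>
     distr D borel uminus = D \<and>
     subgaussian D \<and> (\<integral>t. t\<^sup>2 \<partial>D) = 1 \<and> \<kappa> = subg_norm D \<and>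
     tv_dist D gauss1 \<le> \<epsilon> \<and>
     m \<ge> 1 \<and> K \<subseteq> ball2 n \<and> x \<in> K \<and> nrm n x = 1 \<and>
     0 \<le> p \<and> p < 1/2 \<and> \<beta> > 0
     \<longrightarrow> (\<exists>E \<in> sets (sample_space m n D p).
            measure (sample_space m n D p) E \<ge> 1 - 4 * exp (- \<beta>\<^sup>2) \<and>
            (\<forall>\<omega>\<in>E. \<forall>xh. is_solution m n K x \<omega> xh \<longrightarrow>
               (nrm n (x - xh))\<^sup>2 \<le> C * sqrt \<kappa> * \<epsilon> powr (1/8)
                  + C * \<kappa> / ((1 - 2 * p) * sqrt (real m)) * (gwidth n K + \<beta>)))"
proof (intro exI[of _ 5000] conjI allI impI)
  fix D :: "real measure" and \<kappa> \<epsilon> :: real and m n :: nat and K :: "(nat \<Rightarrow> real) set" and x :: "nat \<Rightarrow> real" and p \<beta> :: real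
  assume "prob_space D \<and> sets D = sets borel \<and> distr D borel uminus = D \<and> subgaussian D \<and>
     (\<integral>t. t\<^sup>2 \<partial>D) = 1 \<and> \<kappa> = subg_norm D \<and> tv_dist D gauss1 \<le> \<epsilon> \<and>
     m \<ge> 1 \<and> K \<subseteq> ball2 n \<and> x \<in> K \<and> nrm n x = 1 \<and> 0 \<le> p \<and> p < 1/2 \<and> \<beta> > 0"
  then have D: "prob_space D" "sets D = sets borel" "distr D borel uminus = D" "subgaussian D" "(\<integral>t. t\<^sup>2 \<partial>D) = 1"
    and \<kappa>: "\<kappa> = subg_norm D" and tv: "tv_dist D gauss1 \<le> \<epsilon>" and m: "m \<ge> 1"
    and K: "K \<subseteq> ball2 n" and xK: "x \<in> K" and x: "nrm n x = 1" and p01: "0 \<le> p" "p < 1/2" and \<beta>: "\<beta> > 0"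
    by auto
  define U where "U = {k1 - k2 | k1 k2. k1 \<in> K \<and> k2 \<in> K}"
  interpret D: symmetric_subgaussian D
    using D by (simp add: symmetric_subgaussian_def symmetric_subgaussian_axioms_def)
  interpret bounded_index n U
  proof
    show "U \<noteq> {}" using xK by (auto simp: U_def)
    fix u assume "u \<in> U"
    then obtain k1 k2 where u: "u = k1 - k2" and k: "k1 \<in> K" "k2 \<in> K" by (auto simp: U_def)
    have le1: "(\<Sum>j<n. (k j)\<^sup>2) \<le> 1" if "k \<in> K" for k
      using K that by (auto simp: ball2_def nrm_def)
    have "(\<Sum>j<n. (u j)\<^sup>2) \<le> (\<Sum>j<n. 2 * (k1 j)\<^sup>2 + 2 * (k2 j)\<^sup>2)"
    proof (rule sum_mono)
      fix j
      have "0 \<le> (k1 j + k2 j)\<^sup>2" by simp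
      then show "(u j)\<^sup>2 \<le> 2 * (k1 j)\<^sup>2 + 2 * (k2 j)\<^sup>2" by (simp add: u power2_eq_square algebra_simps)
    qed
    also have "\<dots> \<le> 4" using le1[OF k(1)] le1[OF k(2)] by (simp add: sum.distrib sum_distrib_left[symmetric])
    finally show "nrm n u \<le> 2" unfolding nrm_def by (intro real_le_lsqrt) (auto simp: sum_nonneg)
  qed
  interpret one_bit_model D n U x p by unfold_locales (use p01 in auto)
  define w where "w = gwidth n K"
  have w_eq: "w = (\<integral>g. h g \<partial>gauss)"
    unfolding w_def gwidth_def support_fun_def U_def ..
  define B where "B = 68 * R / sqrt (real m) * (w + 4 * \<beta>)"
  \<comment> \<open>The event depends on the deviation alone and not on a chosen maximiser, so one
    event serves every solution at once.\<close>
  define E where "E = {\<omega> \<in> space (sample_space m n D p). h (dev m \<omega>) < B}"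
  have E: "E \<in> sets (sample_space m n D p)" "measure (sample_space m n D p) E \<ge> 1 - exp (- \<beta>\<^sup>2)"
    unfolding E_def B_def w_eq by (rule deviation_bound[OF m \<beta>])+
  have w: "w \<ge> 0" unfolding w_eq
  proof (rule integral_nonneg_AE, rule AE_I2)
    have "x - x \<in> U" using xK unfolding U_def by blast
    from support_fun_upper[OF this] show "0 \<le> h g" for g by (simp add: ip_def)
  qed
  have R4: "R \<le> 4 * \<kappa>"
  proof -
    have "sqrt (exp 1) \<le> 2" using exp_le by (intro real_le_lsqrt) auto
    then show ?thesis using D.norm_pos unfolding R_def \<kappa> by (simp add: mult_right_mono)
  qed
  have p3: "1 - 2 * p > 0" using p01 by simp
  define T where "T = 5000 * \<kappa> / ((1 - 2 * p) * sqrt (real m)) * (w + \<beta>)"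
  \<comment> \<open>Origin of 5000: \<open>4 * 68 = 272\<close>, one factor 4 from
    \<open>R \<le> 4 * \<kappa>\<close> and one from
    \<open>w + 4 * \<beta> \<le> 4 * (w + \<beta>)\<close>, giving 4352.\<close>
  have T: "4 * B / (1 - 2 * p) \<le> T"
  proof -
    have "272 * R * (w + 4 * \<beta>) \<le> 272 * (4 * \<kappa>) * (4 * (w + \<beta>))"
      using R4 R w \<beta> D.norm_pos unfolding \<kappa> by (intro mult_mono) auto
    also have "\<dots> \<le> 5000 * \<kappa> * (w + \<beta>)" using w \<beta> D.norm_pos unfolding \<kappa> by simp
    finally have "272 * R * (w + 4 * \<beta>) / ((1 - 2 * p) * sqrt (real m)) \<le> 5000 * \<kappa> * (w + \<beta>) / ((1 - 2 * p) * sqrt (real m))"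
      using p3 by (intro divide_right_mono) auto
    moreover have "4 * B / (1 - 2 * p) = 272 * R * (w + 4 * \<beta>) / ((1 - 2 * p) * sqrt (real m))"
      using p01 m by (simp add: B_def field_simps)
    moreover have "T = 5000 * \<kappa> * (w + \<beta>) / ((1 - 2 * p) * sqrt (real m))" by (simp add: T_def)
    ultimately show ?thesis by (simp only:)
  qed
  have bound: "(nrm n (x - xh))\<^sup>2 \<le> 36 * (sqrt \<kappa> * e powr (1/8)) + T"
    if "\<omega> \<in> E" "is_solution m n K x \<omega> xh" "tv_dist D gauss1 \<le> e" "e > 0" for \<omega> xh e
    using recovery_bound[OF U_def K xK x m p01(2) that(3,4) _ that(2), of B] that(1) T
    unfolding \<kappa> by (auto simp: E_def)
  have "0 \<le> tv_dist D gauss1" using abs_measure_diff_le_tv_dist[of "{}"] by simp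
  then have \<epsilon>: "\<epsilon> \<ge> 0" using tv by simp
  have "(nrm n (x - xh))\<^sup>2 \<le> 5000 * sqrt \<kappa> * \<epsilon> powr (1/8) + T"
    if \<omega>: "\<omega> \<in> E" and sol: "is_solution m n K x \<omega> xh" for \<omega> xh
  proof (cases "\<epsilon> = 0")
    case False
    have "36 * (sqrt \<kappa> * \<epsilon> powr (1/8)) \<le> 5000 * (sqrt \<kappa> * \<epsilon> powr (1/8))"
      using D.norm_nonneg unfolding \<kappa> by (intro mult_right_mono) auto
    then show ?thesis using bound[OF \<omega> sol tv] False \<epsilon> by (simp add: mult.assoc)
  next
    case True
    (* The choice of the truncation level in the exchange argument needs a positive distance. *)
    have "(nrm n (x - xh))\<^sup>2 \<le> T + r" if r: "r > 0" for r
    proof -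
      have s: "sqrt \<kappa> > 0" using D.norm_pos unfolding \<kappa> by simp
      \<comment> \<open>A zero distance is also at most the positive number \<open>b powr 8\<close>;
        this \<open>b\<close> makes the bias term equal to the prescribed \<open>r\<close>, which is
        then arbitrary.\<close>
      define b where "b = r / (36 * sqrt \<kappa>)"
      have b: "b > 0" using r s by (simp add: b_def)
      have "(b powr 8) powr (1/8) = b" using b by (simp only: powr_powr) simp
      moreover have "b powr 8 > 0" using b by simp
      ultimately have "(nrm n (x - xh))\<^sup>2 \<le> 36 * (sqrt \<kappa> * b) + T"
        using bound[OF \<omega> sol, of "b powr 8"] tv True by (simp del: powr_numeral)
      also have "36 * (sqrt \<kappa> * b) = r" using s by (simp add: b_def)
      finally show ?thesis by (simp only: add.commute)
    qed
    then have "(nrm n (x - xh))\<^sup>2 \<le> T" by (rule field_le_epsilon)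
    then show ?thesis using True by simp
  qed
  moreover have "measure (sample_space m n D p) E \<ge> 1 - 4 * exp (- \<beta>\<^sup>2)"
    using E(2) exp_ge_zero[of "- \<beta>\<^sup>2"] by linarith
  ultimately show "\<exists>E \<in> sets (sample_space m n D p).
            measure (sample_space m n D p) E \<ge> 1 - 4 * exp (- \<beta>\<^sup>2) \<and>
            (\<forall>\<omega>\<in>E. \<forall>xh. is_solution m n K x \<omega> xh \<longrightarrow>
               (nrm n (x - xh))\<^sup>2 \<le> 5000 * sqrt \<kappa> * \<epsilon> powr (1/8)
                  + 5000 * \<kappa> / ((1 - 2 * p) * sqrt (real m)) * (gwidth n K + \<beta>))"
    unfolding T_def w_def by (intro bexI[OF _ E(1)] conjI ballI allI impI)
qed simp

end
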